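(* Let $A_1,\dots,A_m$ be real symmetric $n\times n$ matrices, let $\mathcal A(x)=\sum_{i=1}^m x_iA_i$ for $x\in\mathbb R^m$, and let $\mathcal A^*(Y)=(A_1\bullet Y,\dots,A_m\bullet Y)$ for $Y\in\mathcal S^n$. Suppose that for some $0\le r\le n$ the matrix $Z=\begin{pmatrix} I_r & 0 \\ 0 & 0 \end{pmatrix}$ is a maximum rank slack of the homogeneous system $$(P_{SDH})\qquad \sum_{i=1}^m x_iA_i\preceq 0 .$$ Then $\mathcal A^*(\mathcal S^n_+)$ is (1) not closed if and only if $(P_{SDH})$ has a bad reformulation, i.e., an elementary reformulation in bad normal form; (2) closed if and only if $(P_{SDH})$ has a good reformulation, i.e., an elementary reformulation in good normal form.
   Context: $\mathcal S^n$ is the space of real symmetric $n\times n$ matrices and $\mathcal S^n_+$ the cone of positive semidefinite (psd) ones. For symmetric matrices $S,T$, $S\preceq T$ means $T-S$ is psd, $S\succ0$ means $S$ is symmetric positive definite, and $S\bullet T:=\operatorname{trace}(ST)$. A slack of a system $\sum_{i=1}^m x_iA_i\preceq B$ is a psd matrix of the form $B-\sum_{i=1}^m x_iA_i$ with $x\in\mathbb R^m$; a maximum rank slack is a slack whose rank is largest among all slacks. For $(P_{SDH})$, $B=0$. Elementary reformulation of a system $\sum_{i=1}^m x_iA_i\preceq B$: a semidefinite system obtained from it by a finite sequence of the following operations, in any order (not all need be used): (i) choose an invertible matrix $T=\begin{pmatrix} I_r & 0 \\ 0 & M \end{pmatrix}$ and replace every $A_i$ by $T^TA_iT$ and $B$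 by $T^TBT$; (ii) choose $\mu\in\mathbb R^m$ and replace $B$ by $B+\sum_{j=1}^m\mu_jA_j$; (iii) choose indices $i\ne j$ and exchange $A_i$ and $A_j$; (iv) choose $\lambda\in\mathbb R^m$ and an index $i$ with $\lambda_i\neq0$, and replace $A_i$ by $\sum_{j=1}^m\lambda_jA_j$. (In these operations $A_i$ and $B$ denote the current matrices.) Bad normal form: a system $$\sum_{i=1}^k x_i\begin{pmatrix} F_i & 0 \\ 0 & 0 \end{pmatrix}+\sum_{i=k+1}^m x_i\begin{pmatrix} F_i & G_i \\ G_i^T & H_i \end{pmatrix}\preceq\begin{pmatrix} I_r & 0 \\ 0 & 0 \end{pmatrix}=Z$$ with $0\le k<m$ and upper left blocks $r\times r$, such that: $Z$ is a maximum rank slack of this system; the matrices $\begin{pmatrix} G_i \\ H_i \end{pmatrix}$ $(i=k+1,\dots,m)$ are linearly independent; and $H_m\succeq0$. Good normal form: a system of the same displayed shape, with $0\le k\le m$ and upper left blocks $r\times r$, such that: $Z$ is a maximum rank slack of this system; the matrices $H_i$ $(i=k+1,\dots,m)$ are linearly independent; and there is $U\succ0$ with $H_{k+1}\bullet U=\dots=H_m\bullet U=0$. *)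

theory Defs
  imports "HOL-Analysis.Abstract_Euclidean_Space" "Jordan_Normal_Form.DL_Rank"
begin

definition sym_mat :: "nat \<Rightarrow> real mat \<Rightarrow> bool" where
  "sym_mat n S \<longleftrightarrow> S \<in> carrier_mat n n \<and> transpose_mat S = S"

definition psd_mat :: "nat \<Rightarrow> real mat \<Rightarrow> bool" where
  "psd_mat n S \<longleftrightarrow> sym_mat n S \<and>
     (\<forall>v \<in> carrier_vec n. scalar_prod v (S *\<^sub>v v) \<ge> 0)"

definition pd_mat :: "nat \<Rightarrow> real mat \<Rightarrow> bool" where
  "pd_mat n S \<longleftrightarrow> sym_mat n S \<and>
     (\<forall>v \<in> carrier_vec n. v \<noteq> 0\<^sub>v n \<longrightarrow> scalar_prod v (S *\<^sub>v v) > 0)"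

definition mat_trace :: "real mat \<Rightarrow> real" where
  "mat_trace S = (\<Sum>i<dim_row S. S $$ (i, i))"

definition mat_inner :: "real mat \<Rightarrow> real mat \<Rightarrow> real" where
  "mat_inner S T = mat_trace (S * T)"

text \<open>
  Families \<open>A\<^sub>1, \<dots>, A\<^sub>m\<close> are indexed from 0, so \<open>A i\<close> with \<open>i < m\<close> is \<open>A\<^sub>i\<^sub>+\<^sub>1\<close>, and the index
  range \<open>k+1, \<dots>, m\<close> becomes \<open>{k..<m}\<close>. Values at indices \<open>\<ge> m\<close> are irrelevant throughout.
\<close>

definition mat_lincomb ::
  "nat \<Rightarrow> nat \<Rightarrow> nat set \<Rightarrow> (nat \<Rightarrow> real) \<Rightarrow> (nat \<Rightarrow> real mat) \<Rightarrow> real mat" where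
  "mat_lincomb p q I c M = Matrix.mat p q (\<lambda>(a, b). \<Sum>i\<in>I. c i * M i $$ (a, b))"

definition mat_lin_indep :: "nat \<Rightarrow> nat \<Rightarrow> nat set \<Rightarrow> (nat \<Rightarrow> real mat) \<Rightarrow> bool" where
  "mat_lin_indep p q I M \<longleftrightarrow>
     (\<forall>c. mat_lincomb p q I c M = 0\<^sub>m p q \<longrightarrow> (\<forall>i\<in>I. c i = 0))"

text \<open>A pair \<open>(A, B)\<close> stands for the system \<open>\<Sum>i<m. x i A i \<preceq> B\<close>.\<close>

type_synonym sd_system = "(nat \<Rightarrow> real mat) \<times> real mat"

fun slack :: "nat \<Rightarrow> nat \<Rightarrow> sd_system \<Rightarrow> real mat \<Rightarrow> bool" where
  "slack n m (A, B) S \<longleftrightarrow> psd_mat n S \<and> (\<exists>x. S = B - mat_lincomb n n {..<m} x A)"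

definition max_rank_slack :: "nat \<Rightarrow> nat \<Rightarrow> sd_system \<Rightarrow> real mat \<Rightarrow> bool" where
  "max_rank_slack n m P Z \<longleftrightarrow> slack n m P Z \<and>
     (\<forall>S. slack n m P S \<longrightarrow> vec_space.rank n S \<le> vec_space.rank n Z)"

definition block_id :: "nat \<Rightarrow> nat \<Rightarrow> real mat" where
  "block_id n r =
     four_block_mat (1\<^sub>m r) (0\<^sub>m r (n - r)) (0\<^sub>m (n - r) r) (0\<^sub>m (n - r) (n - r))"

inductive elem_step :: "nat \<Rightarrow> nat \<Rightarrow> nat \<Rightarrow> sd_system \<Rightarrow> sd_system \<Rightarrow> bool" for n m r where
  rotate: "\<lbrakk>M \<in> carrier_mat (n - r) (n - r);
      T = four_block_mat (1\<^sub>m r) (0\<^sub>m r (n - r)) (0\<^sub>m (n - r) r) M; invertible_mat T\<rbrakk> \<Longrightarrow>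
    elem_step n m r (A, B)
      (\<lambda>i. transpose_mat T * A i * T, transpose_mat T * B * T)"
| shift: "elem_step n m r (A, B) (A, B + mat_lincomb n n {..<m} \<mu> A)"
| swap: "\<lbrakk>i < m; j < m; i \<noteq> j\<rbrakk> \<Longrightarrow> elem_step n m r (A, B) (A(i := A j, j := A i), B)"
| combine: "\<lbrakk>i < m; l i \<noteq> 0\<rbrakk> \<Longrightarrow>
    elem_step n m r (A, B) (A(i := mat_lincomb n n {..<m} l A), B)"

definition elementary_reformulation :: "nat \<Rightarrow> nat \<Rightarrow> nat \<Rightarrow> sd_system \<Rightarrow> sd_system \<Rightarrow> bool" where
  "elementary_reformulation n m r = (elem_step n m r)\<^sup>*\<^sup>*"

fun normal_shape :: "nat \<Rightarrow> nat \<Rightarrow> nat \<Rightarrow> nat \<Rightarrow> (nat \<Rightarrow> real mat) \<Rightarrow> (nat \<Rightarrow> real mat) \<Rightarrow>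
    (nat \<Rightarrow> real mat) \<Rightarrow> sd_system \<Rightarrow> bool" where
  "normal_shape n m r k F G H (A, B) \<longleftrightarrow>
     r \<le> n \<and> k \<le> m \<and>
     (\<forall>i<k. sym_mat r (F i) \<and>
        A i = four_block_mat (F i) (0\<^sub>m r (n - r)) (0\<^sub>m (n - r) r) (0\<^sub>m (n - r) (n - r))) \<and>
     (\<forall>i\<in>{k..<m}. sym_mat r (F i) \<and> G i \<in> carrier_mat r (n - r) \<and> sym_mat (n - r) (H i) \<and>
        A i = four_block_mat (F i) (G i) (transpose_mat (G i)) (H i)) \<and>
     B = block_id n r"

definition bad_normal_form :: "nat \<Rightarrow> nat \<Rightarrow> nat \<Rightarrow> sd_system \<Rightarrow> bool" where
  "bad_normal_form n m r P \<longleftrightarrow> (\<exists>k F G H. k < m \<and> normal_shape n m r k F G H P \<and>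
     max_rank_slack n m P (block_id n r) \<and>
     mat_lin_indep n (n - r) {k..<m} (\<lambda>i. G i @\<^sub>r H i) \<and>
     psd_mat (n - r) (H (m - 1)))"

definition good_normal_form :: "nat \<Rightarrow> nat \<Rightarrow> nat \<Rightarrow> sd_system \<Rightarrow> bool" where
  "good_normal_form n m r P \<longleftrightarrow> (\<exists>k F G H. k \<le> m \<and> normal_shape n m r k F G H P \<and>
     max_rank_slack n m P (block_id n r) \<and>
     mat_lin_indep (n - r) (n - r) {k..<m} H \<and>
     (\<exists>U. pd_mat (n - r) U \<and> (\<forall>i\<in>{k..<m}. mat_inner (H i) U = 0)))"

definition has_bad_reformulation :: "nat \<Rightarrow> nat \<Rightarrow> nat \<Rightarrow> sd_system \<Rightarrow> bool" where
  "has_bad_reformulation n m r P \<longleftrightarrow>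
     (\<exists>P'. elementary_reformulation n m r P P' \<and> bad_normal_form n m r P')"

definition has_good_reformulation :: "nat \<Rightarrow> nat \<Rightarrow> nat \<Rightarrow> sd_system \<Rightarrow> bool" where
  "has_good_reformulation n m r P \<longleftrightarrow>
     (\<exists>P'. elementary_reformulation n m r P P' \<and> good_normal_form n m r P')"

text \<open>
  A vector of \<open>\<real>\<^sup>m\<close> is a sequence vanishing from index \<open>m\<close> on, as in the library topology
  \<^const>\<open>Euclidean_space\<close>.
\<close>

definition adjoint_map :: "nat \<Rightarrow> (nat \<Rightarrow> real mat) \<Rightarrow> real mat \<Rightarrow> (nat \<Rightarrow> real)" where
  "adjoint_map m A Y = (\<lambda>i. if i < m then mat_inner (A i) Y else 0)"

end

theory Submission
  imports Defs
begin

text \<open>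
  Let \<open>L\<close> be the span of the \<open>A\<^sub>i\<close>, and write \<open>(F, G, H)\<close> for the blocks of \<open>V \<in> L\<close> relative to the first
  \<open>r\<close> coordinates. Call \<open>L\<close> rigid if \<open>H \<succeq> 0\<close> forces \<open>G = 0\<close> and \<open>H = 0\<close>. Rigidity is invariant under
  elementary operations, and it is equivalent to both closedness and the good form.

  If \<open>L\<close> is not rigid, the maximality of \<open>Z\<close> yields \<open>V \<in> L\<close> with \<open>H \<succeq> 0\<close> and a vector \<open>w\<close> supported on
  the last coordinates with \<open>w\<^sup>TVw = 0\<close> and \<open>u = Vw \<noteq> 0\<close>; otherwise \<open>Z + \<epsilon>V\<close> would be a slack of larger
  rank. The value of the adjoint map at \<open>- (u w\<^sup>T + w u\<^sup>T) / 2\<close> is then in the closure of the image, since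
  no psd element of \<open>L\<close> separates it, but not in the image: a psd preimage \<open>Y\<close> would have \<open>Z \<bullet> Y = 0\<close>,
  hence \<open>V \<bullet> Y \<ge> 0\<close>, whereas \<open>V \<bullet> Y = - u\<^sup>Tu\<close>.

  If \<open>L\<close> is rigid, change the basis so that as many \<open>(G\<^sub>i, H\<^sub>i)\<close> as possible vanish. The remaining \<open>H\<^sub>i\<close>
  are independent and span no nonzero psd matrix, so some \<open>U \<succ> 0\<close> is orthogonal to all of them. For a
  convergent sequence in the image the blocks \<open>Y\<^sub>1\<^sub>1\<close> of preimages have bounded trace \<open>Z \<bullet> Y\<close> and subconverge;
  the limit is completed by a lower block \<open>X + t U\<close> where \<open>X\<close> solves the equations for the \<open>H\<^sub>i\<close>.
\<close>

section \<open>Positive semidefinite functions on a finite index set\<close>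

text \<open>The obstacle to closedness is that preimages of a convergent sequence need not be
  bounded: \<open>Z\<close> controls only the upper left block, and the other blocks may diverge.
  Rigidity permits discarding them. In the adapted basis a matrix either sees only the upper left
  block or has a lower block whose equation can be solved anew, so the limit preimage can be block
  diagonal. The matrix \<open>U\<close> thus serves twice: as the certificate in the good form, and
  as the direction in which a merely symmetric solution of the lower equations becomes psd. In the
  other direction the vector \<open>w\<close> comes from a failed range condition. If the kernel of
  the psd block \<open>H\<close> lies in the kernel of \<open>G\<close>, then completing squares
  makes \<open>Z + \<epsilon> V\<close> psd for some \<open>\<epsilon> > 0\<close>. Maximality of
  \<open>Z\<close> therefore forces a kernel vector of \<open>H\<close> that \<open>G\<close> does
  not annihilate. The two normal forms are never compared with each other. Each is compared with
  rigidity, which depends only on the span and on the subspace of vectors whose first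
  \<open>r\<close> coordinates vanish; elementary operations respect both up to an invertible change
  of variables.\<close>

definition quad_form :: "nat set \<Rightarrow> (nat \<times> nat \<Rightarrow> real) \<Rightarrow> (nat \<Rightarrow> real) \<Rightarrow> real" where
  "quad_form I f v = (\<Sum>i\<in>I. \<Sum>j\<in>I. f (i, j) * v i * v j)"

text \<open>Entries form a total function on index pairs, so a principal block is the same function
  on a smaller \<open>I\<close>, and limits can be taken in the product topology on
  functions.\<close>

definition psd_on :: "nat set \<Rightarrow> (nat \<times> nat \<Rightarrow> real) \<Rightarrow> bool" where
  "psd_on I f \<longleftrightarrow> (\<forall>i\<in>I. \<forall>j\<in>I. f (i, j) = f (j, i)) \<and> (\<forall>v. quad_form I f v \<ge> 0)"

definition frob :: "nat set \<Rightarrow> (nat \<times> nat \<Rightarrow> real) \<Rightarrow> (nat \<times> nat \<Rightarrow> real) \<Rightarrow> real" where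
  "frob I f g = (\<Sum>i\<in>I. \<Sum>j\<in>I. f (i, j) * g (i, j))"

lemma quad_form_cong:
  assumes "\<And>i j. i \<in> I \<Longrightarrow> j \<in> I \<Longrightarrow> f (i, j) = g (i, j)" "\<And>i. i \<in> I \<Longrightarrow> v i = w i"
  shows "quad_form I f v = quad_form I g w"
  unfolding quad_form_def using assms by (intro sum.cong refl) auto

lemma psd_on_cong:
  assumes "\<And>i j. i \<in> I \<Longrightarrow> j \<in> I \<Longrightarrow> f (i, j) = g (i, j)"
  shows "psd_on I f \<longleftrightarrow> psd_on I g"
  unfolding psd_on_def using assms quad_form_cong[of I f g] by auto

lemma frob_cong:
  assumes "\<And>i j. i \<in> I \<Longrightarrow> j \<in> I \<Longrightarrow> f (i, j) = f' (i, j)"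
    "\<And>i j. i \<in> I \<Longrightarrow> j \<in> I \<Longrightarrow> g (i, j) = g' (i, j)"
  shows "frob I f g = frob I f' g'"
  unfolding frob_def using assms by (intro sum.cong refl) auto

lemma quad_form_mono_neutral:
  assumes "finite J" "I \<subseteq> J" "\<And>i. i \<in> J - I \<Longrightarrow> v i = 0"
  shows "quad_form J f v = quad_form I f v"
proof -
  have "(\<Sum>j\<in>J. f (i, j) * v i * v j) = (\<Sum>j\<in>I. f (i, j) * v i * v j)" for i
    using assms by (intro sum.mono_neutral_right) auto
  then show ?thesis
    unfolding quad_form_def using assms by (simp, intro sum.mono_neutral_right) auto
qed

lemma frob_mono_neutral:
  assumes "finite J" "I \<subseteq> J" 
    "\<And>i j. i \<in> J \<Longrightarrow> j \<in> J \<Longrightarrow> i \<notin> I \<or> j \<notin> I \<Longrightarrow> f (i, j) * g (i, j) = 0"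
  shows "frob J f g = frob I f g"
proof -
  have "(\<Sum>j\<in>J. f (i, j) * g (i, j)) = (\<Sum>j\<in>I. f (i, j) * g (i, j))" if "i \<in> I" for i
    using assms that by (intro sum.mono_neutral_right) auto
  moreover have "frob J f g = (\<Sum>i\<in>I. \<Sum>j\<in>J. f (i, j) * g (i, j))"
    unfolding frob_def using assms by (intro sum.mono_neutral_right) auto
  ultimately show ?thesis
    unfolding frob_def by simp
qed

lemma psd_on_sym: "psd_on I f \<Longrightarrow> i \<in> I \<Longrightarrow> j \<in> I \<Longrightarrow> f (i, j) = f (j, i)"
  unfolding psd_on_def by blast

lemma psd_on_nonneg: "psd_on I f \<Longrightarrow> quad_form I f v \<ge> 0"
  unfolding psd_on_def by blast

text \<open>A test vector on \<open>I\<close> extends by zero to \<open>J\<close> without changing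
  the value of the form.\<close>

lemma psd_on_subset:
  assumes "finite J" "I \<subseteq> J" "psd_on J f"
  shows "psd_on I f"
  unfolding psd_on_def
proof (intro conjI allI)
  show "\<forall>i\<in>I. \<forall>j\<in>I. f (i, j) = f (j, i)" using assms by (auto simp: psd_on_def)
  fix v
  have "0 \<le> quad_form J f (\<lambda>i. if i \<in> I then v i else 0)" using assms by (simp add: psd_on_def)
  also have "\<dots> = quad_form I f (\<lambda>i. if i \<in> I then v i else 0)"
    using assms by (intro quad_form_mono_neutral) auto
  also have "\<dots> = quad_form I f v" by (intro quad_form_cong) auto
  finally show "0 \<le> quad_form I f v" .
qed

lemma quad_form_insert:
  assumes "finite I" "k \<notin> I" "\<And>i. i \<in> I \<Longrightarrow> f (i, k) = f (k, i)"
  shows "quad_form (insert k I) f v =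
    f (k, k) * (v k)\<^sup>2 + 2 * v k * (\<Sum>i\<in>I. f (k, i) * v i) + quad_form I f v"
proof -
  have "(\<Sum>i\<in>I. f (i, k) * v i * v k) = v k * (\<Sum>i\<in>I. f (k, i) * v i)"
    using assms by (simp add: sum_distrib_left mult_ac)
  moreover have "(\<Sum>i\<in>I. f (k, i) * v k * v i) = v k * (\<Sum>i\<in>I. f (k, i) * v i)"
    by (simp add: sum_distrib_left mult_ac)
  ultimately show ?thesis
    unfolding quad_form_def using assms
    by (simp add: sum.distrib power2_eq_square algebra_simps)
qed

lemma psd_on_diag_nonneg:
  assumes "finite I" "psd_on I f" "i \<in> I"
  shows "f (i, i) \<ge> 0"
proof -
  have "psd_on {i} f" using psd_on_subset[OF assms(1) _ assms(2), of "{i}"] assms(3) by simp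
  then have "quad_form {i} f (\<lambda>_. 1) \<ge> 0" by (simp add: psd_on_def)
  then show ?thesis by (simp add: quad_form_def)
qed

lemma quad_form_pair:
  assumes "i \<noteq> j" "f (j, i) = f (i, j)"
  shows "quad_form {i, j} f v = f (i, i) * (v i)\<^sup>2 + 2 * f (i, j) * v i * v j + f (j, j) * (v j)\<^sup>2"
proof -
  have "quad_form {j} f v = f (j, j) * (v j)\<^sup>2"
    by (simp add: quad_form_def power2_eq_square)
  then show ?thesis using assms by (subst quad_form_insert) auto
qed

text \<open>The vectors (1, 1) and (1, -1) test the principal 2 by 2 block. The trace thus controls
  every entry, which is the source of compactness later.\<close>

lemma psd_on_abs_le:
  assumes "finite I" "psd_on I f" "i \<in> I" "j \<in> I"
  shows "2 * \<bar>f (i, j)\<bar> \<le> f (i, i) + f (j, j)"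
proof (cases "i = j")
  case True
  then show ?thesis using psd_on_diag_nonneg[OF assms(1,2,3)] by simp
next
  case False
  have "psd_on {i, j} f" using psd_on_subset[OF assms(1) _ assms(2), of "{i, j}"] assms(3,4) by simp
  then have "f (j, i) = f (i, j)" and q: "\<And>v. quad_form {i, j} f v \<ge> 0"
    by (simp_all add: psd_on_sym psd_on_nonneg)
  then have "quad_form {i, j} f v = f (i, i) * (v i)\<^sup>2 + 2 * f (i, j) * v i * v j + f (j, j) * (v j)\<^sup>2" for v
    using False by (intro quad_form_pair)
  from q[unfolded this, of "\<lambda>_. 1"] q[unfolded this, of "\<lambda>k. if k = i then 1 else - 1"]
  show ?thesis using False by (simp add: abs_le_iff)
qed

lemma psd_on_diag_zero:
  assumes "finite I" "psd_on I f" "i \<in> I" "j \<in> I" "f (i, i) = 0"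
  shows "f (i, j) = 0"
proof (rule ccontr)
  assume nz: "f (i, j) \<noteq> 0"
  then have ij: "i \<noteq> j" using assms by auto
  have "psd_on {i, j} f" using psd_on_subset[OF assms(1) _ assms(2), of "{i, j}"] assms(3,4) by simp
  then have s: "f (j, i) = f (i, j)" and q: "\<And>v. quad_form {i, j} f v \<ge> 0"
    by (simp_all add: psd_on_sym psd_on_nonneg)
  \<comment> \<open>With \<open>f (i, i) = 0\<close> the form is linear in coordinate
    \<open>i\<close>; this value makes it equal to -1.\<close>
  have "quad_form {i, j} f (\<lambda>k. if k = i then - (f (j, j) + 1) / (2 * f (i, j)) else 1) = - 1"
    using ij nz assms(5) by (subst quad_form_pair[OF ij s]) (simp add: field_simps)
  then show False using q by (metis neg_0_le_iff_le not_one_le_zero)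
qed

text \<open>Cholesky: eliminating one index of \<open>I\<close> leaves the Schur complement, which is again positive
  semidefinite.\<close>

lemma psd_on_decomp:
  assumes "finite I" "psd_on I f"
  shows "\<exists>w :: nat \<Rightarrow> nat \<Rightarrow> real. \<forall>i\<in>I. \<forall>j\<in>I. f (i, j) = (\<Sum>a\<in>I. w a i * w a j)"
  using assms
proof (induction I arbitrary: f rule: finite_induct)
  case empty
  then show ?case by simp
next
  case (insert k I)
  have sym: "\<And>i j. i \<in> insert k I \<Longrightarrow> j \<in> insert k I \<Longrightarrow> f (i, j) = f (j, i)"
    using insert.prems by (rule psd_on_sym)
  have fk: "f (k, k) \<ge> 0" using psd_on_diag_nonneg[of "insert k I" f k] insert by simp
  \<comment> \<open>For a zero pivot \<open>f (k, k)\<close>, division by zero makes the correction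
    vanish, so \<open>g\<close> agrees with \<open>f\<close> and the argument below needs no case
    distinction.\<close>
  define g where "g = (\<lambda>(i, j). f (i, j) - f (k, i) * f (k, j) / f (k, k))"
  have "psd_on I g"
    unfolding psd_on_def
  proof (intro conjI allI)
    show "\<forall>i\<in>I. \<forall>j\<in>I. g (i, j) = g (j, i)" using sym by (auto simp: g_def)
    fix v
    let ?s = "\<Sum>i\<in>I. f (k, i) * v i"
    \<comment> \<open>For a positive pivot, coordinate \<open>k\<close> takes the value that
      minimises the form when the other coordinates are given.\<close>
    let ?v = "v(k := - ?s / f (k, k))"
    have s: "(\<Sum>i\<in>I. f (k, i) * ?v i) = ?s" using insert.hyps by (intro sum.cong) auto
    have "quad_form I f ?v = quad_form I f v" using insert.hyps by (intro quad_form_cong) auto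
    then have "quad_form (insert k I) f ?v = quad_form I f v - ?s\<^sup>2 / f (k, k)"
      using insert.hyps sym s
      by (subst quad_form_insert) (auto simp: power2_eq_square field_simps)
    moreover have "?s\<^sup>2 / f (k, k) = (\<Sum>i\<in>I. \<Sum>j\<in>I. f (k, i) * f (k, j) / f (k, k) * v i * v j)"
      by (simp add: power2_eq_square sum_product sum_divide_distrib mult_ac)
    then have "quad_form I g v = quad_form I f v - ?s\<^sup>2 / f (k, k)"
      by (simp add: g_def quad_form_def sum_subtractf left_diff_distrib)
    ultimately show "0 \<le> quad_form I g v" using insert.prems by (metis psd_on_def)
  qed
  then obtain w :: "nat \<Rightarrow> nat \<Rightarrow> real"
    where w: "\<And>i j. i \<in> I \<Longrightarrow> j \<in> I \<Longrightarrow> g (i, j) = (\<Sum>a\<in>I. w a i * w a j)"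
    using insert.IH by blast
  \<comment> \<open>Vector \<open>k\<close> is the scaled pivot row, and the vectors from the
    induction are extended by 0 at \<open>k\<close>. For a zero pivot the new vector is 0, in
    accordance with \<open>psd_on_diag_zero\<close>.\<close>
  define w' where "w' = (\<lambda>a i. if a = k then f (k, i) / sqrt (f (k, k)) else if i = k then 0 else w a i)"
  have wk: "w' k i * w' k j = f (k, i) * f (k, j) / f (k, k)" for i j
    using fk by (simp add: w'_def)
  have "f (i, j) = (\<Sum>a\<in>insert k I. w' a i * w' a j)" if ij: "i \<in> insert k I" "j \<in> insert k I" for i j
  proof (cases "i = k \<or> j = k")
    case True
    then have "(\<Sum>a\<in>I. w' a i * w' a j) = 0"
      using insert.hyps by (intro sum.neutral) (auto simp: w'_def)
    moreover have "f (k, i) * f (k, j) / f (k, k) = f (i, j)"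
      using True sym[OF ij] psd_on_diag_zero[OF _ insert.prems, of k] insert.hyps ij
      by (cases "f (k, k) = 0") auto
    ultimately show ?thesis using insert.hyps wk by simp
  next
    case False
    then have "(\<Sum>a\<in>I. w' a i * w' a j) = (\<Sum>a\<in>I. w a i * w a j)"
      using insert.hyps by (intro sum.cong) (auto simp: w'_def)
    then show ?thesis using insert.hyps wk False ij w[of i j] by (simp add: g_def)
  qed
  then show ?case by blast
qed

text \<open>Together with \<open>psd_on_decomp\<close> this reduces the pairing with a psd matrix to
  values of a quadratic form; in particular the pairing of two psd matrices is nonnegative.\<close>

lemma frob_decomp:
  assumes "\<And>i j. i \<in> I \<Longrightarrow> j \<in> I \<Longrightarrow> g (i, j) = (\<Sum>a\<in>K. w a i * w a j)"
  shows "frob I f g = (\<Sum>a\<in>K. quad_form I f (w a))"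
proof -
  have "frob I f g = (\<Sum>i\<in>I. \<Sum>j\<in>I. \<Sum>a\<in>K. f (i, j) * w a i * w a j)"
    unfolding frob_def using assms by (intro sum.cong refl) (simp add: sum_distrib_left mult.assoc)
  also have "\<dots> = (\<Sum>i\<in>I. \<Sum>a\<in>K. \<Sum>j\<in>I. f (i, j) * w a i * w a j)"
    by (intro sum.cong refl sum.swap)
  also have "\<dots> = (\<Sum>a\<in>K. quad_form I f (w a))"
    unfolding quad_form_def by (rule sum.swap)
  finally show ?thesis .
qed

lemma frob_commute: "frob I f g = frob I g f"
  unfolding frob_def by (simp add: mult.commute)

lemma frob_rank_one: "frob I f (\<lambda>(i, j). v i * v j) = quad_form I f v"
  unfolding frob_def quad_form_def by (simp add: mult.assoc)

text \<open>Here \<open>f\<close> and \<open>g a\<close> are coefficient vectors of linear functionals on \<open>I \<Rightarrow> \<real>\<close>.\<close>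

lemma functional_in_span:
  fixes f :: "'i \<Rightarrow> real" and g :: "'a \<Rightarrow> 'i \<Rightarrow> real"
  assumes "finite I" "finite K"
    and "\<And>x. (\<And>a. a \<in> K \<Longrightarrow> (\<Sum>i\<in>I. g a i * x i) = 0) \<Longrightarrow> (\<Sum>i\<in>I. f i * x i) = 0"
  shows "\<exists>c. \<forall>i\<in>I. f i = (\<Sum>a\<in>K. c a * g a i)"
  using assms(2,3)
proof (induction K arbitrary: f rule: finite_induct)
  case empty
  have "f i = 0" if "i \<in> I" for i
    using empty[of "\<lambda>j. if j = i then 1 else 0"] assms(1) that by (simp add: if_distrib[of "(*) _"] cong: if_cong)
  then show ?case by simp
next
  case (insert b K)
  show ?case
  proof (cases "\<exists>x. (\<forall>a\<in>K. (\<Sum>i\<in>I. g a i * x i) = 0) \<and> (\<Sum>i\<in>I. g b i * x i) \<noteq> 0")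
    case True
    then obtain x where x: "\<And>a. a \<in> K \<Longrightarrow> (\<Sum>i\<in>I. g a i * x i) = 0"
      and xb: "(\<Sum>i\<in>I. g b i * x i) \<noteq> 0" by blast
    \<comment> \<open>This choice makes \<open>f - t * g b\<close> vanish at \<open>x\<close>. A
      vector \<open>y\<close> killed by \<open>K\<close> is corrected by a multiple of
      \<open>x\<close> so that \<open>g b\<close> kills it too.\<close>
    define t where "t = (\<Sum>i\<in>I. f i * x i) / (\<Sum>i\<in>I. g b i * x i)"
    have "\<exists>c. \<forall>i\<in>I. f i - t * g b i = (\<Sum>a\<in>K. c a * g a i)"
    proof (rule insert.IH)
      fix y assume y: "\<And>a. a \<in> K \<Longrightarrow> (\<Sum>i\<in>I. g a i * y i) = 0"
      define s where "s = (\<Sum>i\<in>I. g b i * y i) / (\<Sum>i\<in>I. g b i * x i)"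
      have lin: "(\<Sum>i\<in>I. h i * (y i - s * x i)) = (\<Sum>i\<in>I. h i * y i) - s * (\<Sum>i\<in>I. h i * x i)"
        for h by (simp add: algebra_simps sum_subtractf sum_distrib_left)
      have "(\<Sum>i\<in>I. f i * (y i - s * x i)) = 0"
      proof (rule insert.prems)
        fix a assume "a \<in> insert b K"
        then show "(\<Sum>i\<in>I. g a i * (y i - s * x i)) = 0"
          unfolding lin using x y xb by (cases "a = b") (auto simp: s_def)
      qed
      then show "(\<Sum>i\<in>I. (f i - t * g b i) * y i) = 0"
        unfolding lin using xb
        by (simp add: left_diff_distrib sum_subtractf mult.assoc flip: sum_distrib_left)
           (simp add: t_def s_def)
    qed
    then obtain c where c: "\<forall>i\<in>I. f i - t * g b i = (\<Sum>a\<in>K. c a * g a i)" by blast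
    have "f i = (\<Sum>a\<in>insert b K. (c(b := t)) a * g a i)" if "i \<in> I" for i
    proof -
      have "(\<Sum>a\<in>K. (c(b := t)) a * g a i) = (\<Sum>a\<in>K. c a * g a i)"
        using insert.hyps by (intro sum.cong) auto
      then show ?thesis using c that insert.hyps by (simp add: algebra_simps)
    qed
    then show ?thesis by blast
  next
    case False
    \<comment> \<open>Here \<open>g b\<close> vanishes wherever all of \<open>K\<close> does, so
      \<open>b\<close> receives coefficient 0.\<close>
    then have "\<exists>c. \<forall>i\<in>I. f i = (\<Sum>a\<in>K. c a * g a i)"
      by (intro insert.IH insert.prems) auto
    then obtain c where c: "\<forall>i\<in>I. f i = (\<Sum>a\<in>K. c a * g a i)" by blast
    have "f i = (\<Sum>a\<in>insert b K. (c(b := 0)) a * g a i)" if "i \<in> I" for i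
    proof -
      have "(\<Sum>a\<in>K. (c(b := 0)) a * g a i) = (\<Sum>a\<in>K. c a * g a i)"
        using insert.hyps by (intro sum.cong) auto
      then show ?thesis using c that insert.hyps by simp
    qed
    then show ?thesis by blast
  qed
qed

section \<open>Separation and theorems of the alternative\<close>

lemma frob_prod: "frob I f g = (\<Sum>p\<in>I \<times> I. f p * g p)"
  unfolding frob_def by (simp add: sum.cartesian_product)

lemma frob_add_left: "frob I (\<lambda>p. f p + g p) h = frob I f h + frob I g h"
  unfolding frob_prod by (simp add: distrib_right sum.distrib)

lemma frob_diff_left: "frob I (\<lambda>p. f p - g p) h = frob I f h - frob I g h"
  unfolding frob_prod by (simp add: left_diff_distrib sum_subtractf)

lemma frob_scale_left: "frob I (\<lambda>p. c * f p) h = c * frob I f h"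
  unfolding frob_prod by (simp add: sum_distrib_left mult.assoc)

lemma frob_add_right: "frob I h (\<lambda>p. f p + g p) = frob I h f + frob I h g"
  unfolding frob_prod by (simp add: distrib_left sum.distrib)

lemma frob_diff_right: "frob I h (\<lambda>p. f p - g p) = frob I h f - frob I h g"
  unfolding frob_prod by (simp add: right_diff_distrib sum_subtractf)

lemma frob_scale_right: "frob I h (\<lambda>p. c * f p) = c * frob I h f"
  unfolding frob_prod by (simp add: sum_distrib_left mult_ac)

lemma frob_sum_left: "frob I (\<lambda>p. \<Sum>k\<in>K. c k * f k p) h = (\<Sum>k\<in>K. c k * frob I (f k) h)"
  unfolding frob_prod sum_distrib_right sum_distrib_left
  by (subst sum.swap) (simp add: mult.assoc)

lemma frob_sum_right: "frob I h (\<lambda>p. \<Sum>k\<in>K. c k * f k p) = (\<Sum>k\<in>K. c k * frob I h (f k))"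
  using frob_sum_left[of I c f K h] by (simp add: frob_commute)

lemma frob_transpose:
  assumes "\<And>i j. i \<in> I \<Longrightarrow> j \<in> I \<Longrightarrow> f (i, j) = f (j, i)"
  shows "frob I f (\<lambda>(i, j). g (j, i)) = frob I f g"
proof -
  have "frob I f (\<lambda>(i, j). g (j, i)) = (\<Sum>i\<in>I. \<Sum>j\<in>I. f (j, i) * g (j, i))"
    unfolding frob_def using assms by (intro sum.cong refl) auto
  also have "\<dots> = frob I f g"
    unfolding frob_def by (rule sum.swap)
  finally show ?thesis .
qed

lemma frob_self_eq_0:
  assumes "finite I" "frob I f f = 0" "i \<in> I" "j \<in> I"
  shows "f (i, j) = 0"
proof -
  have "\<forall>p\<in>I \<times> I. f p * f p = 0"
    using assms(1,2) unfolding frob_prod by (subst (asm) sum_nonneg_eq_0_iff) auto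
  then show ?thesis using assms by auto
qed

lemma quad_form_add: "quad_form I (\<lambda>p. f p + g p) v = quad_form I f v + quad_form I g v"
  unfolding quad_form_def by (simp add: distrib_right sum.distrib)

lemma quad_form_scale: "quad_form I (\<lambda>p. c * f p) v = c * quad_form I f v"
  unfolding quad_form_def by (simp add: sum_distrib_left mult.assoc)

lemma psd_on_add: "psd_on I f \<Longrightarrow> psd_on I g \<Longrightarrow> psd_on I (\<lambda>p. f p + g p)"
  unfolding psd_on_def quad_form_add by fastforce

lemma psd_on_scale: "psd_on I f \<Longrightarrow> c \<ge> 0 \<Longrightarrow> psd_on I (\<lambda>p. c * f p)"
  unfolding psd_on_def quad_form_scale by (metis mult_nonneg_nonneg)

lemma psd_on_rank_one:
  assumes "finite I"
  shows "psd_on I (\<lambda>(i, j). v i * v j)"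
proof -
  have "quad_form I (\<lambda>(i, j). v i * v j) w = (\<Sum>i\<in>I. v i * w i)\<^sup>2" for w
    unfolding quad_form_def power2_eq_square sum_product by (simp add: mult_ac)
  then show ?thesis by (auto simp: psd_on_def mult.commute)
qed

section \<open>Compactness in spaces of real functions\<close>

lemma continuous_coord: "continuous_on UNIV (\<lambda>f. f p)" for p :: 'i
  by simp

text \<open>Coordinates outside \<open>K\<close> are pinned to the compact set {0}, so Tychonoff's
  theorem applies to the whole function space.\<close>

lemma compact_function_box:
  fixes K :: "'i set" and R :: real
  shows "compact {f. (\<forall>p\<in>K. \<bar>f p\<bar> \<le> R) \<and> (\<forall>p. p \<notin> K \<longrightarrow> f p = 0)}"
proof -
  have "compactin (product_topology (\<lambda>_. euclidean) UNIV)
      (PiE UNIV (\<lambda>p. if p \<in> K then {- R..R} else {0 :: real}))"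
    unfolding compactin_PiE by (auto simp: compactin_euclidean_iff)
  moreover have "PiE UNIV (\<lambda>p. if p \<in> K then {- R..R} else {0 :: real}) =
      {f. (\<forall>p\<in>K. \<bar>f p\<bar> \<le> R) \<and> (\<forall>p. p \<notin> K \<longrightarrow> f p = 0)}"
    by (auto simp: PiE_iff abs_le_iff minus_le_iff split: if_splits)
  ultimately show ?thesis
    by (simp add: euclidean_product_topology compactin_euclidean_iff)
qed

lemma compact_subset_closed: "compact T \<Longrightarrow> closed S \<Longrightarrow> S \<subseteq> T \<Longrightarrow> compact S"
  by (drule (1) compact_Int_closed) (simp add: inf.absorb2)

text \<open>Every condition is closed in the coordinates, and \<open>psd_on_abs_le\<close> places
  all entries in the box of radius \<open>R\<close>.\<close>

lemma compact_psd_trace_le: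
  assumes "finite I"
  shows "compact {f. psd_on I f \<and> (\<forall>p. p \<notin> I \<times> I \<longrightarrow> f p = 0) \<and> (\<Sum>i\<in>I. f (i, i)) \<le> R}"
    (is "compact ?S")
proof -
  let ?B = "{f. (\<forall>p\<in>I \<times> I. \<bar>f p\<bar> \<le> R) \<and> (\<forall>p. p \<notin> I \<times> I \<longrightarrow> f p = (0::real))}"
  have "closed ?S"
    unfolding psd_on_def quad_form_def Ball_def
    by (intro closed_Collect_conj closed_Collect_all closed_Collect_imp closed_Collect_le
        closed_Collect_eq open_Collect_const continuous_intros continuous_coord)
  moreover have "?S \<subseteq> ?B"
  proof safe
    fix f i j
    assume f: "psd_on I f" "(\<Sum>i\<in>I. f (i, i)) \<le> R" and ij: "i \<in> I" "j \<in> I"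
    have "f (k, k) \<le> (\<Sum>i\<in>I. f (i, i))" if "k \<in> I" for k
      using assms that psd_on_diag_nonneg[OF assms f(1)] by (intro member_le_sum) auto
    then show "\<bar>f (i, j)\<bar> \<le> R"
      using psd_on_abs_le[OF assms f(1) ij] ij f(2) by (smt (verit))
  qed
  ultimately show ?thesis
    using compact_subset_closed[OF compact_function_box] by blast
qed

section \<open>First-order optimality and separation from a closed cone\<close>

lemma nonneg_if_quadratic_nonneg:
  fixes a b :: real
  assumes "\<And>t. 0 < t \<Longrightarrow> t \<le> 1 \<Longrightarrow> 0 \<le> 2 * t * a + t\<^sup>2 * b"
  shows "0 \<le> a"
proof (rule ccontr)
  assume "\<not> 0 \<le> a"
  \<comment> \<open>This \<open>t\<close> gives \<open>t * b \<le> - a\<close>, hence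
    \<open>2 * a + t * b < 0\<close>; the added 1 covers \<open>b = 0\<close>.\<close>
  define t where "t = min 1 (- a / (\<bar>b\<bar> + 1))"
  have t: "0 < t" "t \<le> 1" using \<open>\<not> 0 \<le> a\<close> by (auto simp: t_def divide_simps)
  have "t * b \<le> t * (\<bar>b\<bar> + 1)" using t by (intro mult_left_mono) auto
  also have "\<dots> \<le> - a / (\<bar>b\<bar> + 1) * (\<bar>b\<bar> + 1)" unfolding t_def by (intro mult_right_mono) auto
  also have "\<dots> = - a" by (simp add: field_simps)
  finally have "2 * a + t * b < 0" using \<open>\<not> 0 \<le> a\<close> by simp
  moreover have "0 \<le> t * (2 * a + t * b)"
    using assms[OF t] by (simp add: algebra_simps power2_eq_square)
  ultimately show False using t by (simp add: zero_le_mult_iff)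
qed

text \<open>Let \<open>s0\<close> be a point of \<open>S\<close> nearest to \<open>y\<close> and
  \<open>x = s0 - y\<close>. Adding multiples of \<open>s\<close> to \<open>s0\<close> shows that
  \<open>x\<close> is nonnegative on \<open>S\<close>, and shrinking \<open>s0\<close> shows that it
  is nonpositive at \<open>s0\<close>. Its value at \<open>y\<close> is then at most minus the
  squared length of \<open>x\<close>.\<close>

lemma closed_cone_separation:
  fixes S :: "(nat \<Rightarrow> real) set"
  assumes "closed S" and zero: "(\<lambda>_. 0) \<in> S"
    and supp: "\<And>s i. s \<in> S \<Longrightarrow> m \<le> i \<Longrightarrow> s i = 0"
    and cone: "\<And>s t c. s \<in> S \<Longrightarrow> t \<in> S \<Longrightarrow> 0 \<le> c \<Longrightarrow> (\<lambda>i. s i + c * t i) \<in> S"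
    and y: "y \<notin> S" "\<And>i. m \<le> i \<Longrightarrow> y i = 0"
  shows "\<exists>x. (\<Sum>i<m. x i * y i) < 0 \<and> (\<forall>s\<in>S. 0 \<le> (\<Sum>i<m. x i * s i))"
proof -
  let ?d = "\<lambda>s. \<Sum>i<m. (s i - y i)\<^sup>2"
  \<comment> \<open>Points of \<open>?C\<close> are no farther from \<open>y\<close> than the origin
    is, and twice \<open>\<bar>s i - y i\<bar>\<close> is at most its square plus 1; this bounds
    each coordinate by \<open>R\<close>.\<close>
  define R where "R = (\<Sum>i<m. \<bar>y i\<bar>) + (\<Sum>i<m. (y i)\<^sup>2) + 1"
  let ?C = "S \<inter> {s. ?d s \<le> (\<Sum>i<m. (y i)\<^sup>2)}"
  have cont: "continuous_on UNIV ?d" by (intro continuous_intros continuous_coord)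
  have "?C \<subseteq> {f. (\<forall>p\<in>{..<m}. \<bar>f p\<bar> \<le> R) \<and> (\<forall>p. p \<notin> {..<m} \<longrightarrow> f p = 0)}"
  proof safe
    fix s i assume s: "s \<in> S" "?d s \<le> (\<Sum>i<m. (y i)\<^sup>2)" and i: "i < m"
    have "(s i - y i)\<^sup>2 \<le> ?d s" using i by (intro member_le_sum) auto
    moreover have "\<bar>y i\<bar> \<le> (\<Sum>i<m. \<bar>y i\<bar>)" using i by (intro member_le_sum) auto
    moreover have "2 * \<bar>s i - y i\<bar> \<le> (s i - y i)\<^sup>2 + 1"
      using sum_squares_bound[of "\<bar>s i - y i\<bar>" 1] by simp
    moreover have "0 \<le> (\<Sum>i<m. \<bar>y i\<bar>)" by (intro sum_nonneg) auto
    moreover have "\<bar>s i\<bar> \<le> \<bar>s i - y i\<bar> + \<bar>y i\<bar>" "0 \<le> \<bar>s i - y i\<bar>" by auto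
    ultimately show "\<bar>s i\<bar> \<le> R"
      using s(2) unfolding R_def by argo
  qed (metis lessThan_iff not_le supp)
  moreover have "closed ?C"
    using assms(1) cont by (intro closed_Int closed_Collect_le continuous_on_const)
  ultimately have "compact ?C"
    using compact_subset_closed[OF compact_function_box] by blast
  moreover have "?C \<noteq> {}" using zero by auto
  moreover have "continuous_on ?C ?d" using cont by (rule continuous_on_subset) simp
  ultimately have "\<exists>s0\<in>?C. \<forall>s\<in>?C. ?d s0 \<le> ?d s" by (rule continuous_attains_inf)
  then obtain s0 where s0: "s0 \<in> ?C" and "\<And>s. s \<in> ?C \<Longrightarrow> ?d s0 \<le> ?d s" by blast
  then have min: "?d s0 \<le> ?d s" if "s \<in> S" for s
    using that by (cases "s \<in> ?C") auto
  define x where "x = (\<lambda>i. s0 i - y i)"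
  have x_sq: "?d (\<lambda>i. s0 i + c * s i) = ?d s0 + 2 * c * (\<Sum>i<m. x i * s i) + c\<^sup>2 * (\<Sum>i<m. (s i)\<^sup>2)" for c s
    unfolding sum_distrib_left sum.distrib[symmetric] x_def
    by (intro sum.cong refl) (simp add: power2_eq_square algebra_simps)
  have dual: "0 \<le> (\<Sum>i<m. x i * s i)" if "s \<in> S" for s
  proof (rule nonneg_if_quadratic_nonneg)
    fix t :: real assume "0 < t" "t \<le> 1"
    then have "?d s0 \<le> ?d (\<lambda>i. s0 i + t * s i)"
      using s0 that cone[of s0 s t] by (intro min) simp
    then show "0 \<le> 2 * t * (\<Sum>i<m. x i * s i) + t\<^sup>2 * (\<Sum>i<m. (s i)\<^sup>2)"
      unfolding x_sq by simp
  qed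
  have "0 \<le> - (\<Sum>i<m. x i * s0 i)"
  proof (rule nonneg_if_quadratic_nonneg)
    fix t :: real assume t: "0 < t" "t \<le> 1"
    \<comment> \<open>The shrunken point is reached from the origin, since the cone hypothesis only
      adds nonnegative multiples.\<close>
    have "(\<lambda>i. 0 + (1 - t) * s0 i) \<in> S" using t s0 cone[OF zero, of s0 "1 - t"] by simp
    moreover have "(\<lambda>i. 0 + (1 - t) * s0 i) = (\<lambda>i. s0 i + (- t) * s0 i)"
      by (simp add: algebra_simps)
    ultimately have "?d s0 \<le> ?d (\<lambda>i. s0 i + (- t) * s0 i)"
      by (intro min) (simp only:)
    then show "0 \<le> 2 * t * - (\<Sum>i<m. x i * s0 i) + t\<^sup>2 * (\<Sum>i<m. (s0 i)\<^sup>2)"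
      unfolding x_sq by simp
  qed
  moreover have "(\<Sum>i<m. x i * y i) = (\<Sum>i<m. x i * s0 i) - (\<Sum>i<m. (x i)\<^sup>2)"
    unfolding sum_subtractf[symmetric] x_def
    by (intro sum.cong refl) (simp add: power2_eq_square algebra_simps)
  moreover have "0 < (\<Sum>i<m. (x i)\<^sup>2)"
  proof -
    have "\<exists>i<m. x i \<noteq> 0"
    proof (rule ccontr)
      assume "\<not> ?thesis"
      then have "s0 i = y i" for i
        using supp[of s0 i] s0 y(2)[of i] unfolding x_def by (cases "i < m") auto
      then have "s0 = y" by blast
      then show False using s0 y by auto
    qed
    then obtain i where "i < m" "x i \<noteq> 0" by blast
    then show ?thesis by (intro sum_pos2[of _ i]) auto
  qed
  ultimately show ?thesis using dual by (intro exI[of _ x]) auto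
qed

section \<open>Dual bases and positive definite matrices orthogonal to a span\<close>

text \<open>Since \<open>H l\<close> lies outside the span of the others,
  \<open>functional_in_span\<close> yields a matrix that is orthogonal to the others but not to
  \<open>H l\<close>. Symmetrising and scaling it gives \<open>X l\<close>.\<close>

lemma dual_basis_exists:
  fixes H :: "'k \<Rightarrow> nat \<times> nat \<Rightarrow> real"
  assumes "finite I" "finite K"
    and sym: "\<And>k i j. k \<in> K \<Longrightarrow> i \<in> I \<Longrightarrow> j \<in> I \<Longrightarrow> H k (i, j) = H k (j, i)"
    and indep: "\<And>c. (\<And>i j. i \<in> I \<Longrightarrow> j \<in> I \<Longrightarrow> (\<Sum>k\<in>K. c k * H k (i, j)) = 0) \<Longrightarrow> \<forall>k\<in>K. c k = 0"
  shows "\<exists>X. (\<forall>l i j. X l (i, j) = X l (j, i)) \<and>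
    (\<forall>k\<in>K. \<forall>l\<in>K. frob I (H k) (X l) = (if k = l then 1 else 0))"
proof -
  have "\<exists>X. (\<forall>i j. X (i, j) = X (j, i)) \<and> (\<forall>k\<in>K. frob I (H k) X = (if k = l then 1 else 0))"
    if l: "l \<in> K" for l
  proof -
    have "\<exists>x. (\<forall>k\<in>K - {l}. frob I (H k) x = 0) \<and> frob I (H l) x \<noteq> 0"
    proof (rule ccontr)
      assume "\<not> ?thesis"
      then have "\<exists>c. \<forall>p\<in>I \<times> I. H l p = (\<Sum>k\<in>K - {l}. c k * H k p)"
        using assms(1,2) by (intro functional_in_span) (auto simp: frob_prod)
      then obtain c where c: "\<And>p. p \<in> I \<times> I \<Longrightarrow> H l p = (\<Sum>k\<in>K - {l}. c k * H k p)" by blast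
      have "\<forall>k\<in>K. (c(l := - 1)) k = 0"
      proof (rule indep)
        fix i j assume "i \<in> I" "j \<in> I"
        then have "(\<Sum>k\<in>K - {l}. (c(l := - 1)) k * H k (i, j)) = H l (i, j)"
          by (subst c) auto
        then show "(\<Sum>k\<in>K. (c(l := - 1)) k * H k (i, j)) = 0"
          using l assms(2) by (subst sum.remove[of _ l]) auto
      qed
      then show False using l by (metis fun_upd_same neg_equal_0_iff_equal one_neq_zero)
    qed
    then obtain x where x: "\<And>k. k \<in> K \<Longrightarrow> k \<noteq> l \<Longrightarrow> frob I (H k) x = 0" "frob I (H l) x \<noteq> 0" by blast
    \<comment> \<open>The factor 2 appears because the symmetric \<open>H l\<close> pairs equally
      with \<open>x\<close> and its transpose.\<close>
    define s where "s = 1 / (2 * frob I (H l) x)"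
    define X where "X = (\<lambda>p. s * (x p + (case p of (i, j) \<Rightarrow> x (j, i))))"
    have "frob I (H k) X = s * (2 * frob I (H k) x)" if "k \<in> K" for k
      unfolding X_def using frob_transpose[of I "H k" x] sym[OF that]
      by (simp add: frob_scale_right frob_add_right)
    then have "\<forall>k\<in>K. frob I (H k) X = (if k = l then 1 else 0)"
      using x by (auto simp: s_def)
    moreover have "\<forall>i j. X (i, j) = X (j, i)" by (simp add: X_def)
    ultimately show ?thesis by blast
  qed
  then have "\<forall>l. \<exists>X. l \<in> K \<longrightarrow> (\<forall>i j. X (i, j) = X (j, i)) \<and>
    (\<forall>k\<in>K. frob I (H k) X = (if k = l then 1 else 0))" by blast
  then obtain X where X: "\<And>l. l \<in> K \<Longrightarrow> (\<forall>i j. X l (i, j) = X l (j, i)) \<and>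
    (\<forall>k\<in>K. frob I (H k) (X l) = (if k = l then 1 else 0))" by metis
  then show ?thesis
    \<comment> \<open>The default value 0 outside \<open>K\<close> makes the symmetry hold for every
      \<open>l\<close>.\<close>
    by (intro exI[of _ "\<lambda>l. if l \<in> K then X l else (\<lambda>_. 0)"]) auto
qed

text \<open>\<open>Q\<close> projects along the span of the \<open>H k\<close>, by means of a dual basis \<open>X\<close>. If \<open>D\<close> is the element of least
  norm in the image under \<open>Q\<close> of the psd matrices of trace one, then \<open>U\<close> is the transpose of \<open>Q\<close> applied to \<open>D\<close>.\<close>

lemma pd_orthogonal_exists:
  fixes H :: "'k \<Rightarrow> nat \<times> nat \<Rightarrow> real"
  assumes fin: "finite I" "finite K"
    and sym: "\<And>k i j. k \<in> K \<Longrightarrow> i \<in> I \<Longrightarrow> j \<in> I \<Longrightarrow> H k (i, j) = H k (j, i)"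
    and indep: "\<And>c. (\<And>i j. i \<in> I \<Longrightarrow> j \<in> I \<Longrightarrow> (\<Sum>k\<in>K. c k * H k (i, j)) = 0) \<Longrightarrow> \<forall>k\<in>K. c k = 0"
    and no_psd: "\<And>c i j. psd_on I (\<lambda>p. \<Sum>k\<in>K. c k * H k p) \<Longrightarrow> i \<in> I \<Longrightarrow> j \<in> I \<Longrightarrow>
      (\<Sum>k\<in>K. c k * H k (i, j)) = 0"
  shows "\<exists>U \<delta>. 0 < \<delta> \<and> (\<forall>i\<in>I. \<forall>j\<in>I. U (i, j) = U (j, i)) \<and>
    (\<forall>v. \<delta> * (\<Sum>i\<in>I. (v i)\<^sup>2) \<le> quad_form I U v) \<and> (\<forall>k\<in>K. frob I (H k) U = 0)"
\<comment> \<open>On an empty index set there is no matrix of trace one to minimise over.\<close>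
proof (cases "I = {}")
  case True
  then show ?thesis by (intro exI[of _ "\<lambda>_. 0"] exI[of _ 1]) (auto simp: frob_def quad_form_def)
next
  case False
  obtain X where Xsym: "\<And>l i j. X l (i, j) = X l (j, i)"
    and X: "\<And>k l. k \<in> K \<Longrightarrow> l \<in> K \<Longrightarrow> frob I (H k) (X l) = (if k = l then 1 else 0)"
    using dual_basis_exists[of I K H, OF fin sym indep] by blast
  define Q where "Q = (\<lambda>S p. S p - (\<Sum>k\<in>K. frob I S (X k) * H k p))"
  let ?S = "{f. psd_on I f \<and> (\<forall>p. p \<notin> I \<times> I \<longrightarrow> f p = 0) \<and> (\<Sum>i\<in>I. f (i, i)) \<le> 1}"
  let ?C = "?S \<inter> {f. (\<Sum>i\<in>I. f (i, i)) = 1}"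
  have rank_one: "(\<lambda>p. if p \<in> I \<times> I then (case p of (i, j) \<Rightarrow> v i * v j) / (\<Sum>i\<in>I. (v i)\<^sup>2) else 0) \<in> ?C"
    (is "?f \<in> _") if "0 < (\<Sum>i\<in>I. (v i)\<^sup>2)" for v
  proof -
    have "psd_on I (\<lambda>p. 1 / (\<Sum>i\<in>I. (v i)\<^sup>2) * (case p of (i, j) \<Rightarrow> v i * v j))"
      using that fin by (intro psd_on_scale psd_on_rank_one) auto
    also have "?this \<longleftrightarrow> psd_on I ?f" by (intro psd_on_cong) auto
    finally have "psd_on I ?f" .
    moreover have "(\<Sum>i\<in>I. ?f (i, i)) = 1"
      using that by (simp add: power2_eq_square flip: sum_divide_distrib)
    ultimately show ?thesis by auto
  qed
  have cont: "continuous_on UNIV (\<lambda>S. frob I (Q S) (Q S))"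
    unfolding Q_def frob_def by (intro continuous_intros continuous_coord)
  have "compact ?C"
    using compact_psd_trace_le[OF fin(1)]
    by (intro compact_Int_closed closed_Collect_eq continuous_intros continuous_coord)
  moreover have "0 < (\<Sum>i\<in>I. (1::real)\<^sup>2)" using False fin by (simp add: card_gt_0_iff)
  then have "?C \<noteq> {}" using rank_one[of "\<lambda>_. 1"] by (metis (no_types, lifting) emptyE)
  moreover have "continuous_on ?C (\<lambda>S. frob I (Q S) (Q S))"
    using cont by (rule continuous_on_subset) simp
  ultimately have "\<exists>S0\<in>?C. \<forall>S\<in>?C. frob I (Q S0) (Q S0) \<le> frob I (Q S) (Q S)"
    by (rule continuous_attains_inf)
  then obtain S0 where S0: "S0 \<in> ?C"
    and min: "\<And>S. S \<in> ?C \<Longrightarrow> frob I (Q S0) (Q S0) \<le> frob I (Q S) (Q S)" by blast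
  define D where "D = Q S0"
  define \<delta> where "\<delta> = frob I D D"
  \<comment> \<open>If \<open>D\<close> vanished, \<open>S0\<close> would be a psd combination of
    the \<open>H k\<close>, hence 0 on \<open>I \<times> I\<close>, against trace one.\<close>
  have "\<delta> \<noteq> 0"
  proof
    assume "\<delta> = 0"
    define c where "c = (\<lambda>k. frob I S0 (X k))"
    have S0_eq: "S0 (i, j) = (\<Sum>k\<in>K. c k * H k (i, j))" if "i \<in> I" "j \<in> I" for i j
      using frob_self_eq_0[OF fin(1), of D i j] \<open>\<delta> = 0\<close> that by (simp add: \<delta>_def D_def Q_def c_def)
    have "psd_on I S0" using S0 by simp
    moreover have "psd_on I S0 \<longleftrightarrow> psd_on I (\<lambda>p. \<Sum>k\<in>K. c k * H k p)"
      by (intro psd_on_cong S0_eq)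
    ultimately have "S0 (i, i) = 0" if "i \<in> I" for i
      using no_psd that S0_eq by simp
    then show False using S0 by simp
  qed
  moreover have "0 \<le> \<delta>" unfolding \<delta>_def frob_prod by (intro sum_nonneg) auto
  ultimately have "0 < \<delta>" by simp
  have Q_lin: "Q (\<lambda>p. S p + t * (T p - S p)) = (\<lambda>p. Q S p + t * (Q T p - Q S p))" for S T t
    unfolding Q_def frob_add_left frob_scale_left frob_diff_left
    by (intro ext) (simp add: distrib_right left_diff_distrib right_diff_distrib mult.assoc
        sum.distrib sum_subtractf sum_distrib_left)
  \<comment> \<open>The segment from \<open>S0\<close> to \<open>S\<close> stays in the convex set
    \<open>?C\<close>, so minimality at \<open>S0\<close> makes the pairing of \<open>D\<close> with
    \<open>Q S - D\<close> nonnegative.\<close>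
  have ge: "\<delta> \<le> frob I D (Q S)" if S: "S \<in> ?C" for S
  proof -
    have "0 \<le> frob I D (\<lambda>p. Q S p - D p)"
    proof (rule nonneg_if_quadratic_nonneg)
      fix t :: real assume t: "0 < t" "t \<le> 1"
      have eq: "(\<lambda>p. S0 p + t * (S p - S0 p)) = (\<lambda>p. (1 - t) * S0 p + t * S p)"
        by (simp add: algebra_simps)
      have "psd_on I (\<lambda>p. S0 p + t * (S p - S0 p))"
        unfolding eq using S S0 t by (intro psd_on_add psd_on_scale) auto
      moreover have "(\<Sum>i\<in>I. S0 (i, i) + t * (S (i, i) - S0 (i, i))) = 1"
        using S S0 by (simp add: sum.distrib sum_subtractf flip: sum_distrib_left)
      ultimately have "(\<lambda>p. S0 p + t * (S p - S0 p)) \<in> ?C" using S S0 by simp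
      from min[OF this]
      have "frob I D D \<le> frob I (\<lambda>p. D p + t * (Q S p - D p)) (\<lambda>p. D p + t * (Q S p - D p))"
        unfolding Q_lin D_def .
      also have "\<dots> = frob I D D + (2 * t * frob I D (\<lambda>p. Q S p - D p) +
          t\<^sup>2 * frob I (\<lambda>p. Q S p - D p) (\<lambda>p. Q S p - D p))"
        unfolding frob_prod sum_distrib_left sum.distrib[symmetric]
        by (intro sum.cong refl) (simp add: power2_eq_square algebra_simps)
      finally show "0 \<le> 2 * t * frob I D (\<lambda>p. Q S p - D p) +
          t\<^sup>2 * frob I (\<lambda>p. Q S p - D p) (\<lambda>p. Q S p - D p)" by simp
    qed
    then show ?thesis by (simp add: frob_diff_right \<delta>_def)
  qed
  define U where "U = (\<lambda>p. D p - (\<Sum>k\<in>K. frob I D (H k) * X k p))"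
  \<comment> \<open>\<open>U\<close> is defined to make this adjointness hold; it turns
    \<open>ge\<close> into a lower bound for the pairing of \<open>U\<close> with trace-one psd
    matrices.\<close>
  have U_Q: "frob I U S = frob I D (Q S)" for S
  proof -
    have "frob I D (Q S) = frob I D S - (\<Sum>k\<in>K. frob I S (X k) * frob I D (H k))"
      unfolding Q_def by (simp add: frob_diff_right frob_sum_right)
    then show ?thesis
      unfolding U_def frob_diff_left frob_sum_left by (simp add: frob_commute[of I S] mult.commute)
  qed
  have "U (i, j) = U (j, i)" if "i \<in> I" "j \<in> I" for i j
  proof -
    have "S0 (i, j) = S0 (j, i)" using S0 psd_on_sym[of I S0 i j] that by simp
    moreover have "(\<Sum>k\<in>K. c k * H k (i, j)) = (\<Sum>k\<in>K. c k * H k (j, i))" for c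
      by (intro sum.cong refl arg_cong2[of _ _ _ _ "(*)"] sym that)
    moreover have "(\<Sum>k\<in>K. c k * X k (i, j)) = (\<Sum>k\<in>K. c k * X k (j, i))" for c
      by (intro sum.cong refl arg_cong2[of _ _ _ _ "(*)"] Xsym)
    ultimately show ?thesis unfolding U_def D_def Q_def by simp
  qed
  moreover have "\<delta> * (\<Sum>i\<in>I. (v i)\<^sup>2) \<le> quad_form I U v" for v
  proof (cases "0 < (\<Sum>i\<in>I. (v i)\<^sup>2)")
    case True
    let ?s = "\<Sum>i\<in>I. (v i)\<^sup>2"
    \<comment> \<open>Applied to the normalised rank-one matrix of \<open>v\<close>, that bound
      becomes uniform positive definiteness of \<open>U\<close>.\<close>
    have "\<delta> \<le> frob I U (\<lambda>p. if p \<in> I \<times> I then (case p of (i, j) \<Rightarrow> v i * v j) / ?s else 0)"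
      using ge[OF rank_one[OF True]] U_Q by simp
    also have "\<dots> = frob I U (\<lambda>p. 1 / ?s * (case p of (i, j) \<Rightarrow> v i * v j))"
      by (intro frob_cong) auto
    also have "\<dots> = 1 / ?s * quad_form I U v"
      by (simp only: frob_scale_right frob_rank_one)
    finally show ?thesis using True by (simp add: pos_le_divide_eq)
  next
    case False
    moreover have "0 \<le> (\<Sum>i\<in>I. (v i)\<^sup>2)" by (intro sum_nonneg) auto
    ultimately have s: "(\<Sum>i\<in>I. (v i)\<^sup>2) = 0" by linarith
    then have "\<forall>i\<in>I. v i = 0" using fin by (simp add: sum_nonneg_eq_0_iff)
    then show ?thesis using s by (simp add: quad_form_def)
  qed
  moreover have "frob I (H l) U = 0" if l: "l \<in> K" for l
  proof -
    have "frob I (H l) U = frob I D (H l) - (\<Sum>k\<in>K. frob I D (H k) * frob I (H l) (X k))"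
      unfolding U_def by (simp add: frob_diff_right frob_sum_right frob_commute[of I D])
    \<comment> \<open>By duality only the term \<open>k = l\<close> survives, and it cancels
      \<open>frob I D (H l)\<close>.\<close>
    also have "(\<Sum>k\<in>K. frob I D (H k) * frob I (H l) (X k)) = (\<Sum>k\<in>K. if k = l then frob I D (H k) else 0)"
      using X l by (intro sum.cong) auto
    finally show ?thesis using l fin by simp
  qed
  ultimately show ?thesis using \<open>0 < \<delta>\<close> by blast
qed

section \<open>Matrices and ranks\<close>

lemma sym_mat_iff:
  "sym_mat n S \<longleftrightarrow> S \<in> carrier_mat n n \<and> (\<forall>i<n. \<forall>j<n. S $$ (i, j) = S $$ (j, i))"
proof
  assume S: "sym_mat n S"
  have "S $$ (i, j) = S $$ (j, i)" if "i < n" "j < n" for i j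
  proof -
    have C: "S \<in> carrier_mat n n" using S by (simp add: sym_mat_def)
    have "S $$ (i, j) = transpose_mat S $$ (i, j)" using S by (simp add: sym_mat_def)
    also have "\<dots> = S $$ (j, i)" using C that by simp
    finally show ?thesis .
  qed
  then show "S \<in> carrier_mat n n \<and> (\<forall>i<n. \<forall>j<n. S $$ (i, j) = S $$ (j, i))"
    using S by (simp add: sym_mat_def)
next
  assume "S \<in> carrier_mat n n \<and> (\<forall>i<n. \<forall>j<n. S $$ (i, j) = S $$ (j, i))"
  then show "sym_mat n S" unfolding sym_mat_def by (auto intro!: eq_matI)
qed

lemma scalar_prod_mult_mat_vec:
  assumes "S \<in> carrier_mat n n" "v \<in> carrier_vec n"
  shows "v \<bullet> (S *\<^sub>v v) = quad_form {..<n} (($$) S) (($) v)"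
  unfolding quad_form_def scalar_prod_def using assms
  by (simp add: scalar_prod_def atLeast0LessThan sum_distrib_left mult_ac)

lemma quad_form_vec: "quad_form {..<n} f (($) (vec n v)) = quad_form {..<n} f v"
  by (intro quad_form_cong) auto

lemma psd_mat_iff: "psd_mat n S \<longleftrightarrow> S \<in> carrier_mat n n \<and> psd_on {..<n} (($$) S)"
proof -
  have "(\<forall>v\<in>carrier_vec n. 0 \<le> v \<bullet> (S *\<^sub>v v)) \<longleftrightarrow> (\<forall>v. 0 \<le> quad_form {..<n} (($$) S) v)"
    if S: "S \<in> carrier_mat n n"
  proof
    assume *: "\<forall>v\<in>carrier_vec n. 0 \<le> v \<bullet> (S *\<^sub>v v)"
    show "\<forall>v. 0 \<le> quad_form {..<n} (($$) S) v"
    proof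
      fix v
      have "0 \<le> vec n v \<bullet> (S *\<^sub>v vec n v)" using * by simp
      then show "0 \<le> quad_form {..<n} (($$) S) v"
        by (simp add: scalar_prod_mult_mat_vec[OF S] quad_form_vec)
    qed
  qed (simp add: scalar_prod_mult_mat_vec[OF S])
  then show ?thesis
    unfolding psd_mat_def sym_mat_iff psd_on_def by auto
qed

lemma mat_inner_eq_frob:
  assumes "S \<in> carrier_mat n n" "sym_mat n T"
  shows "mat_inner S T = frob {..<n} (($$) S) (($$) T)"
proof -
  have T: "T \<in> carrier_mat n n" "\<And>i j. i < n \<Longrightarrow> j < n \<Longrightarrow> T $$ (j, i) = T $$ (i, j)"
    using assms(2) unfolding sym_mat_iff by blast+
  have "mat_inner S T = (\<Sum>i<n. \<Sum>j<n. S $$ (i, j) * T $$ (j, i))"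
    unfolding mat_inner_def mat_trace_def using assms(1) T(1)
    by (simp add: scalar_prod_def atLeast0LessThan)
  also have "\<dots> = frob {..<n} (($$) S) (($$) T)"
    unfolding frob_def by (intro sum.cong refl) (simp add: T(2))
  finally show ?thesis .
qed

lemma mat_lincomb_carrier [simp]: "mat_lincomb p q K c M \<in> carrier_mat p q"
  by (simp add: mat_lincomb_def)

lemma mat_lincomb_index [simp]:
  "i < p \<Longrightarrow> j < q \<Longrightarrow> mat_lincomb p q K c M $$ (i, j) = (\<Sum>k\<in>K. c k * M k $$ (i, j))"
  by (simp add: mat_lincomb_def)

lemma mat_lincomb_dim [simp]:
  "dim_row (mat_lincomb p q K c M) = p" "dim_col (mat_lincomb p q K c M) = q"
  by (simp_all add: mat_lincomb_def)

lemma mat_lincomb_sym: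
  assumes "\<And>k. k \<in> K \<Longrightarrow> sym_mat n (M k)"
  shows "sym_mat n (mat_lincomb n n K c M)"
  unfolding sym_mat_iff
proof (intro conjI allI impI)
  fix i j assume "i < n" "j < n"
  then have "(\<Sum>k\<in>K. c k * M k $$ (i, j)) = (\<Sum>k\<in>K. c k * M k $$ (j, i))"
    using assms by (intro sum.cong refl arg_cong2[of _ _ _ _ "(*)"]) (auto simp: sym_mat_iff)
  then show "mat_lincomb n n K c M $$ (i, j) = mat_lincomb n n K c M $$ (j, i)"
    using \<open>i < n\<close> \<open>j < n\<close> by simp
qed simp

lemma frob_mat_lincomb:
  "frob {..<n} (($$) (mat_lincomb n n K c M)) g = (\<Sum>k\<in>K. c k * frob {..<n} (($$) (M k)) g)"
proof -
  have "frob {..<n} (($$) (mat_lincomb n n K c M)) g = frob {..<n} (\<lambda>p. \<Sum>k\<in>K. c k * M k $$ p) g"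
    by (intro frob_cong) auto
  then show ?thesis by (simp add: frob_sum_left)
qed

lemma block_id_carrier: "r \<le> n \<Longrightarrow> block_id n r \<in> carrier_mat n n"
  unfolding block_id_def using four_block_carrier_mat[of "1\<^sub>m r" r r "0\<^sub>m (n - r) (n - r)" "n - r" "n - r"]
  by simp

lemma block_id_index:
  assumes "r \<le> n" "i < n" "j < n"
  shows "block_id n r $$ (i, j) = (if i = j \<and> i < r then 1 else 0)"
  unfolding block_id_def using assms by (subst index_mat_four_block) auto

lemma quad_form_block_id:
  assumes "r \<le> n"
  shows "quad_form {..<n} (($$) (block_id n r)) v = (\<Sum>i<r. (v i)\<^sup>2)"
proof -
  have "(\<Sum>j<n. block_id n r $$ (i, j) * v i * v j) = (if i < r then (v i)\<^sup>2 else 0)" if "i < n" for i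
  proof -
    have "(\<Sum>j<n. block_id n r $$ (i, j) * v i * v j) = (\<Sum>j<n. if j = i then (if i < r then (v i)\<^sup>2 else 0) else 0)"
      using assms that by (intro sum.cong) (auto simp: block_id_index power2_eq_square)
    then show ?thesis using that by simp
  qed
  then have "quad_form {..<n} (($$) (block_id n r)) v = (\<Sum>i<n. if i < r then (v i)\<^sup>2 else 0)"
    unfolding quad_form_def by simp
  also have "\<dots> = (\<Sum>i<r. (v i)\<^sup>2)"
    using assms by (intro sum.mono_neutral_cong_right) auto
  finally show ?thesis .
qed

lemma frob_block_id:
  assumes "r \<le> n"
  shows "frob {..<n} (($$) (block_id n r)) g = (\<Sum>i<r. g (i, i))"
proof -
  have "(\<Sum>j<n. block_id n r $$ (i, j) * g (i, j)) = (if i < r then g (i, i) else 0)" if "i < n" for i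
  proof -
    have "(\<Sum>j<n. block_id n r $$ (i, j) * g (i, j)) = (\<Sum>j<n. if j = i then (if i < r then g (i, i) else 0) else 0)"
      using assms that by (intro sum.cong) (auto simp: block_id_index)
    then show ?thesis using that by simp
  qed
  then have "frob {..<n} (($$) (block_id n r)) g = (\<Sum>i<n. if i < r then g (i, i) else 0)"
    unfolding frob_def by simp
  also have "\<dots> = (\<Sum>i<r. g (i, i))"
    using assms by (intro sum.mono_neutral_cong_right) auto
  finally show ?thesis .
qed

section \<open>Rank bounds by counting columns\<close>

text \<open>Independence is stated for columns as an indexed family. Two equal columns would violate
  it with coefficients 1 and -1, so \<open>col A\<close> is injective on \<open>J\<close> and the
  family becomes an independent set of vectors.\<close>

lemma (in vec_space) card_le_rank:
  assumes A: "A \<in> carrier_mat n nc" and J: "J \<subseteq> {..<nc}"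
    and indep: "\<And>c k. (\<And>i. i < n \<Longrightarrow> (\<Sum>k\<in>J. A $$ (i, k) * c k) = 0) \<Longrightarrow> k \<in> J \<Longrightarrow> c k = 0"
  shows "card J \<le> rank A"
proof -
  have fin: "finite J" using J finite_subset by blast
  have inj: "inj_on (col A) J"
  proof (rule inj_onI, rule ccontr)
    fix k l assume kl: "k \<in> J" "l \<in> J" "col A k = col A l" "k \<noteq> l"
    define c where "c = (\<lambda>j. if j = k then 1 else if j = l then - 1 else (0 :: 'a))"
    have "(\<Sum>j\<in>J. A $$ (i, j) * c j) = 0" if "i < n" for i
    proof -
      have "(\<Sum>j\<in>J. A $$ (i, j) * c j) = (\<Sum>j\<in>{k, l}. A $$ (i, j) * c j)"
        using kl fin by (intro sum.mono_neutral_right) (auto simp: c_def)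
      also have "\<dots> = A $$ (i, k) - A $$ (i, l)"
        using kl(4) by (simp add: c_def)
      also have "\<dots> = col A k $ i - col A l $ i"
        using kl(1,2) A that subsetD[OF J kl(1)] subsetD[OF J kl(2)] by simp
      finally show ?thesis using kl by simp
    qed
    then have "c k = 0" by (rule indep[OF _ kl(1)])
    then show False by (simp add: c_def)
  qed
  have sub: "col A ` J \<subseteq> set (cols A)"
    using A J by (auto simp: cols_def)
  have carr: "col A ` J \<subseteq> carrier_vec n" using A by auto
  have "a (col A k) = 0" if z: "lincomb a (col A ` J) = 0\<^sub>v n" and k: "k \<in> J" for a k
  proof (rule indep[of "\<lambda>k. a (col A k)", OF _ k])
    fix i assume i: "i < n"
    have "0 = lincomb a (col A ` J) $ i" using z i by simp
    also have "\<dots> = (\<Sum>k\<in>J. a (col A k) * col A k $ i)"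
      by (simp add: lincomb_index[OF i carr] sum.reindex[OF inj])
    also have "\<dots> = (\<Sum>k\<in>J. A $$ (i, k) * a (col A k))"
      using A J i by (intro sum.cong) (auto simp: mult.commute)
    finally show "(\<Sum>k\<in>J. A $$ (i, k) * a (col A k)) = 0" by simp
  qed
  then have "lin_indpt (col A ` J)"
    using fin carr by (intro finite_lin_indpt2) auto
  then have "card (col A ` J) \<le> rank A" by (rule rank_ge_card_indpt[OF A sub])
  then show ?thesis by (simp add: card_image[OF inj])
qed

text \<open>The rank is the size of a maximal independent set of columns, and such a set avoids the
  zero vector.\<close>

lemma (in vec_space) rank_le_card_nonzero_cols:
  assumes A: "A \<in> carrier_mat n nc" and fin: "finite K" and cols: "set (cols A) - {0\<^sub>v n} \<subseteq> K"
  shows "rank A \<le> card K"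
proof -
  have "lin_indpt {}" by (rule finite_lin_indpt2) auto
  then obtain S where max: "maximal S (\<lambda>T. T \<subseteq> set (cols A) \<and> lin_indpt T)"
    using maximal_exists_superset[of "set (cols A)" "\<lambda>T. T \<subseteq> set (cols A) \<and> lin_indpt T" "{}"] by auto
  then have S: "S \<subseteq> set (cols A)" "lin_indpt S" by (auto simp: maximal_def)
  moreover have "set (cols A) \<subseteq> carrier_vec n" using A cols_dim by blast
  ultimately have "0\<^sub>v n \<notin> S" using vs_zero_lin_dep[of S] by auto
  then have "S \<subseteq> K" using S cols by auto
  then show ?thesis
    using rank_card_indpt[OF A max] card_mono[OF fin] by simp
qed

lemma rank_block_id_le:
  assumes "r \<le> n"
  shows "vec_space.rank n (block_id n r) \<le> r"
proof -
  have "set (cols (block_id n r)) - {0\<^sub>v n} \<subseteq> unit_vec n ` {..<r}"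
  proof
    fix v assume v: "v \<in> set (cols (block_id n r)) - {0\<^sub>v n}"
    then obtain j where j: "j < n" "v = col (block_id n r) j"
      using block_id_carrier[OF assms] by (auto simp: cols_def)
    have "v = (if j < r then unit_vec n j else 0\<^sub>v n)"
      using j block_id_carrier[OF assms] assms
      by (intro eq_vecI) (auto simp: block_id_index)
    then show "v \<in> unit_vec n ` {..<r}" using v by (auto split: if_splits)
  qed
  then have "vec_space.rank n (block_id n r) \<le> card (unit_vec n ` {..<r} :: real vec set)"
    by (intro vec_space.rank_le_card_nonzero_cols[OF block_id_carrier[OF assms]]) auto
  also have "\<dots> \<le> card {..<r}" by (intro card_image_le) auto
  finally show ?thesis by simp
qed

section \<open>Rigidity\<close>

definition mat_span :: "nat \<Rightarrow> nat \<Rightarrow> (nat \<Rightarrow> real mat) \<Rightarrow> real mat set" where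
  "mat_span n m A = range (\<lambda>x. mat_lincomb n n {..<m} x A)"

text \<open>In the last \<open>n - r\<close> columns, the rows \<open>i < r\<close> form the block
  \<open>G\<close> and the other rows the block \<open>H\<close>; the block \<open>F\<close> is
  unconstrained.\<close>

definition rigid :: "nat \<Rightarrow> nat \<Rightarrow> real mat set \<Rightarrow> bool" where
  "rigid n r L \<longleftrightarrow>
    (\<forall>V\<in>L. psd_on {r..<n} (($$) V) \<longrightarrow> (\<forall>i<n. \<forall>j\<in>{r..<n}. V $$ (i, j) = 0))"

lemma mat_lincomb_add:
  "mat_lincomb p q K x A + c \<cdot>\<^sub>m mat_lincomb p q K y A = mat_lincomb p q K (\<lambda>k. x k + c * y k) A"
  by (intro eq_matI) (simp_all add: distrib_right sum.distrib sum_distrib_left mult.assoc)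

lemma mat_span_add_scale:
  assumes "V \<in> mat_span n m A" "W \<in> mat_span n m A"
  shows "V + c \<cdot>\<^sub>m W \<in> mat_span n m A"
  using assms unfolding mat_span_def by (auto simp: mat_lincomb_add)

lemma mat_span_carrier: "V \<in> mat_span n m A \<Longrightarrow> V \<in> carrier_mat n n"
  unfolding mat_span_def by auto

lemma zero_minus_lincomb: "0\<^sub>m n n - mat_lincomb n n K x A = mat_lincomb n n K (\<lambda>k. - x k) A"
  by (intro eq_matI) (simp_all add: sum_negf)

text \<open>Negating the coefficients absorbs the minus sign when the right-hand side is 0, so
  slacks depend on the span alone.\<close>

lemma slack_homogeneous_iff: "slack n m (A, 0\<^sub>m n n) S \<longleftrightarrow> psd_mat n S \<and> S \<in> mat_span n m A"
proof -
  have "\<exists>y. mat_lincomb n n {..<m} x A = 0\<^sub>m n n - mat_lincomb n n {..<m} y A" for x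
    by (rule exI[of _ "\<lambda>k. - x k"]) (simp add: zero_minus_lincomb)
  moreover have "0\<^sub>m n n - mat_lincomb n n {..<m} x A \<in> mat_span n m A" for x
    by (simp add: zero_minus_lincomb mat_span_def)
  ultimately show ?thesis
    unfolding slack.simps by (auto simp: mat_span_def)
qed

lemma quad_form_index_add:
  assumes "V \<in> carrier_mat n n" "W \<in> carrier_mat n n"
  shows "quad_form {..<n} (($$) (V + c \<cdot>\<^sub>m W)) v = quad_form {..<n} (($$) V) v + c * quad_form {..<n} (($$) W) v"
proof -
  have "quad_form {..<n} (($$) (V + c \<cdot>\<^sub>m W)) v = quad_form {..<n} (\<lambda>p. V $$ p + c * W $$ p) v"
    using assms by (intro quad_form_cong) auto
  then show ?thesis by (simp add: quad_form_add quad_form_scale)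
qed

text \<open>\<open>?Z + V\<close> is again a slack. A nonzero \<open>V $$ (j, j)\<close> would make
  its first \<open>r\<close> columns and column \<open>j\<close> independent, giving rank at least
  \<open>r + 1\<close>, whereas \<open>?Z\<close> has rank at most \<open>r\<close>.\<close>

lemma psd_tail_zero:
  assumes "r \<le> n"
    and max: "max_rank_slack n m (A, 0\<^sub>m n n) (block_id n r)"
    and V: "V \<in> mat_span n m A" "psd_on {..<n} (($$) V)"
    and ij: "i < n" "j \<in> {r..<n}"
  shows "V $$ (i, j) = 0"
proof -
  let ?Z = "block_id n r"
  have Z: "psd_mat n ?Z" "?Z \<in> mat_span n m A"
    and max_rank: "\<And>S. psd_mat n S \<Longrightarrow> S \<in> mat_span n m A \<Longrightarrow> vec_space.rank n S \<le> vec_space.rank n ?Z"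
    using max unfolding max_rank_slack_def slack_homogeneous_iff by auto
  have carr: "?Z \<in> carrier_mat n n" "V \<in> carrier_mat n n"
    using Z V mat_span_carrier by auto
  define R where "R = ?Z + 1 \<cdot>\<^sub>m V"
  have R: "R \<in> mat_span n m A" unfolding R_def by (intro mat_span_add_scale Z V)
  have Rc: "R \<in> carrier_mat n n" using R by (rule mat_span_carrier)
  have quad: "quad_form {..<n} (($$) R) v = (\<Sum>i<r. (v i)\<^sup>2) + quad_form {..<n} (($$) V) v" for v
    unfolding R_def quad_form_index_add[OF carr] quad_form_block_id[OF assms(1)] by simp
  have R_index: "R $$ (a, b) = ?Z $$ (a, b) + V $$ (a, b)" if "a < n" "b < n" for a b
    unfolding R_def using carr that by simp
  have "psd_on {..<n} (($$) R)"
    unfolding psd_on_def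
  proof (intro conjI ballI allI)
    fix a b assume "a \<in> {..<n}" "b \<in> {..<n}"
    then show "R $$ (a, b) = R $$ (b, a)"
      using psd_on_sym[OF V(2), of a b] by (simp add: R_index block_id_index[OF assms(1)])
  next
    fix v show "0 \<le> quad_form {..<n} (($$) R) v"
      unfolding quad using psd_on_nonneg[OF V(2)] by (intro add_nonneg_nonneg sum_nonneg) auto
  qed
  then have "vec_space.rank n R \<le> vec_space.rank n ?Z"
    using R Rc by (intro max_rank) (auto simp: psd_mat_iff)
  then have rank: "vec_space.rank n R \<le> r"
    using rank_block_id_le[OF assms(1)] by simp
  have "V $$ (j, j) = 0"
  proof (rule ccontr)
    assume nz: "V $$ (j, j) \<noteq> 0"
    let ?J = "insert j {..<r}"
    have J: "?J \<subseteq> {..<n}" using ij assms(1) by auto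
    have "card ?J \<le> vec_space.rank n R"
    proof (rule vec_space.card_le_rank[OF Rc J])
      fix c :: "nat \<Rightarrow> real" and k
      assume c: "\<And>i. i < n \<Longrightarrow> (\<Sum>k\<in>?J. R $$ (i, k) * c k) = 0" and k: "k \<in> ?J"
      define d where "d = (\<lambda>i. if i \<in> ?J then c i else 0)"
      \<comment> \<open>A dependency makes the form of \<open>?Z + V\<close> vanish at
        \<open>d\<close>. Both summands are nonnegative, so the first kills the first
        \<open>r\<close> coefficients and the second the coefficient at \<open>j\<close>.\<close>
      have "quad_form {..<n} (($$) R) d = quad_form ?J (($$) R) d"
        using J by (intro quad_form_mono_neutral) (auto simp: d_def)
      also have "\<dots> = (\<Sum>i\<in>?J. c i * (\<Sum>k\<in>?J. R $$ (i, k) * c k))"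
        unfolding quad_form_def sum_distrib_left
        by (intro sum.cong refl) (auto simp: d_def)
      also have "\<dots> = 0" using c J by (intro sum.neutral) auto
      finally have "(\<Sum>i<r. (d i)\<^sup>2) + quad_form {..<n} (($$) V) d = 0"
        unfolding quad .
      moreover have "0 \<le> (\<Sum>i<r. (d i)\<^sup>2)" by (intro sum_nonneg) auto
      moreover have "0 \<le> quad_form {..<n} (($$) V) d" by (rule psd_on_nonneg[OF V(2)])
      ultimately have 1: "(\<Sum>i<r. (d i)\<^sup>2) = 0" and 2: "quad_form {..<n} (($$) V) d = 0"
        by linarith+
      from 1 have "\<forall>i<r. d i = 0" by (simp add: sum_nonneg_eq_0_iff)
      then have c0: "c i = 0" if "i < r" for i using that by (simp add: d_def)
      have "quad_form {..<n} (($$) V) d = quad_form {j} (($$) V) d"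
        using ij c0 by (intro quad_form_mono_neutral) (auto simp: d_def)
      then have "c j = 0" using 2 nz by (simp add: quad_form_def d_def)
      then show "c k = 0" using k c0 by auto
    qed
    moreover have "card ?J = Suc r" using ij by simp
    ultimately show False using rank by simp
  qed
  then have "V $$ (j, i) = 0" using psd_on_diag_zero[OF _ V(2), of j i] ij by simp
  then show ?thesis using psd_on_sym[OF V(2), of i j] ij by simp
qed

lemma quad_form_bounded:
  assumes "finite I"
  shows "\<exists>B\<ge>0. \<forall>v. \<bar>quad_form I f v\<bar> \<le> B * (\<Sum>i\<in>I. (v i)\<^sup>2)"
proof (intro exI conjI allI)
  let ?B = "\<Sum>i\<in>I. \<Sum>j\<in>I. \<bar>f (i, j)\<bar>"
  show "0 \<le> ?B" by (intro sum_nonneg) auto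
  fix v :: "nat \<Rightarrow> real"
  let ?S = "\<Sum>i\<in>I. (v i)\<^sup>2"
  have "\<bar>f (i, j) * v i * v j\<bar> \<le> \<bar>f (i, j)\<bar> * ?S" if "i \<in> I" "j \<in> I" for i j
  proof -
    have "(v i)\<^sup>2 \<le> ?S" "(v j)\<^sup>2 \<le> ?S" using assms that by (auto intro!: member_le_sum)
    moreover have "2 * (\<bar>v i\<bar> * \<bar>v j\<bar>) \<le> (v i)\<^sup>2 + (v j)\<^sup>2"
      using sum_squares_bound[of "\<bar>v i\<bar>" "\<bar>v j\<bar>"] by simp
    ultimately have "\<bar>v i\<bar> * \<bar>v j\<bar> \<le> ?S" by linarith
    then have "\<bar>f (i, j)\<bar> * (\<bar>v i\<bar> * \<bar>v j\<bar>) \<le> \<bar>f (i, j)\<bar> * ?S" by (intro mult_left_mono) auto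
    then show ?thesis by (simp add: abs_mult mult.assoc)
  qed
  then have "\<bar>quad_form I f v\<bar> \<le> (\<Sum>i\<in>I. \<Sum>j\<in>I. \<bar>f (i, j)\<bar> * ?S)"
    unfolding quad_form_def by (intro order.trans[OF sum_abs] sum_mono) auto
  then show "\<bar>quad_form I f v\<bar> \<le> ?B * ?S" by (simp add: sum_distrib_right)
qed

lemma quad_form_split:
  assumes "finite I" "finite J" "I \<inter> J = {}" "\<And>i j. i \<in> I \<Longrightarrow> j \<in> J \<Longrightarrow> f (j, i) = f (i, j)"
  shows "quad_form (I \<union> J) f v =
    quad_form I f v + 2 * (\<Sum>i\<in>I. v i * (\<Sum>j\<in>J. f (i, j) * v j)) + quad_form J f v"
proof -
  have "(\<Sum>i\<in>J. \<Sum>j\<in>I. f (i, j) * v i * v j) = (\<Sum>i\<in>I. v i * (\<Sum>j\<in>J. f (i, j) * v j))"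
    unfolding sum_distrib_left using assms(4) by (subst sum.swap) (intro sum.cong refl, simp)
  moreover have "(\<Sum>i\<in>I. \<Sum>j\<in>J. f (i, j) * v i * v j) = (\<Sum>i\<in>I. v i * (\<Sum>j\<in>J. f (i, j) * v j))"
    unfolding sum_distrib_left by (intro sum.cong refl) simp
  ultimately show ?thesis
    unfolding quad_form_def using assms(1-3) by (simp add: sum.union_disjoint sum.distrib)
qed

text \<open>The kernel condition puts the rows of the off-diagonal block into the span of the vectors \<open>w a\<close>
  that generate the tail block, so that completing squares dominates the mixed term.\<close>

lemma perturbed_block_id_psd:
  assumes "r \<le> n" and V: "sym_mat n V" "psd_on {r..<n} (($$) V)"
    and ker: "\<And>w i. quad_form {r..<n} (($$) V) w = 0 \<Longrightarrow> i < n \<Longrightarrow> (\<Sum>j\<in>{r..<n}. V $$ (i, j) * w j) = 0"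
  shows "\<exists>\<epsilon>>0. psd_on {..<n} (($$) (block_id n r + \<epsilon> \<cdot>\<^sub>m V))"
proof -
  let ?I = "{r..<n}"
  have Vc: "V \<in> carrier_mat n n" and Vsym: "\<And>i j. i < n \<Longrightarrow> j < n \<Longrightarrow> V $$ (i, j) = V $$ (j, i)"
    using V(1) unfolding sym_mat_iff by blast+
  obtain w where w: "\<And>i j. i \<in> ?I \<Longrightarrow> j \<in> ?I \<Longrightarrow> V $$ (i, j) = (\<Sum>a\<in>?I. w a i * w a j)"
    using psd_on_decomp[OF finite_atLeastLessThan V(2)] by blast
  have quad_I: "quad_form ?I (($$) V) v = (\<Sum>a\<in>?I. (\<Sum>j\<in>?I. w a j * v j)\<^sup>2)" for v
  proof -
    have "quad_form ?I (($$) V) v = frob ?I (\<lambda>(i, j). v i * v j) (($$) V)"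
      by (subst frob_commute) (simp add: frob_rank_one)
    also have "\<dots> = (\<Sum>a\<in>?I. quad_form ?I (\<lambda>(i, j). v i * v j) (w a))"
      using w by (intro frob_decomp)
    also have "\<dots> = (\<Sum>a\<in>?I. (\<Sum>j\<in>?I. w a j * v j)\<^sup>2)"
      unfolding quad_form_def power2_eq_square sum_product by (intro sum.cong refl) simp
    finally show ?thesis .
  qed
  have "\<exists>c. \<forall>j\<in>?I. V $$ (i, j) = (\<Sum>a\<in>?I. c a * w a j)" if "i < n" for i
  proof (rule functional_in_span)
    fix x assume "\<And>a. a \<in> ?I \<Longrightarrow> (\<Sum>j\<in>?I. w a j * x j) = 0"
    then have "quad_form ?I (($$) V) x = 0" unfolding quad_I by simp
    then show "(\<Sum>j\<in>?I. V $$ (i, j) * x j) = 0" using that by (rule ker)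
  qed auto
  then have "\<forall>i. \<exists>c. i < n \<longrightarrow> (\<forall>j\<in>?I. V $$ (i, j) = (\<Sum>a\<in>?I. c a * w a j))" by blast
  then have "\<exists>c. \<forall>i. i < n \<longrightarrow> (\<forall>j\<in>?I. V $$ (i, j) = (\<Sum>a\<in>?I. c i a * w a j))" by (rule choice)
  then obtain c where c: "\<And>i j. i < n \<Longrightarrow> j \<in> ?I \<Longrightarrow> V $$ (i, j) = (\<Sum>a\<in>?I. c i a * w a j)"
    by blast
  \<comment> \<open>The off-diagonal block is the product of \<open>c\<close> and \<open>w\<close>.
    With the Gram matrix of the rows of \<open>c\<close> subtracted from the upper left block, the
    form of \<open>V\<close> becomes that of \<open>f\<close> plus the squares of
    \<open>?p a + ?q a\<close>.\<close>
  define f where "f = (\<lambda>(i, j). V $$ (i, j) - (\<Sum>a\<in>?I. c i a * c j a))"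
  obtain B where B: "0 \<le> B" "\<And>v. \<bar>quad_form {..<r} f v\<bar> \<le> B * (\<Sum>i<r. (v i)\<^sup>2)"
    using quad_form_bounded[of "{..<r}" f] by auto
  have lower: "- B * (\<Sum>i<r. (v i)\<^sup>2) \<le> quad_form {..<n} (($$) V) v" for v
  proof -
    let ?p = "\<lambda>a. \<Sum>i<r. c i a * v i" and ?q = "\<lambda>a. \<Sum>j\<in>?I. w a j * v j"
    have "(\<Sum>i<r. v i * (\<Sum>j\<in>?I. V $$ (i, j) * v j)) = (\<Sum>i<r. \<Sum>a\<in>?I. c i a * v i * ?q a)"
    proof (intro sum.cong refl)
      fix i assume "i \<in> {..<r}"
      then have "i < n" using assms(1) by simp
      have "(\<Sum>j\<in>?I. V $$ (i, j) * v j) = (\<Sum>j\<in>?I. \<Sum>a\<in>?I. c i a * (w a j * v j))"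
        using c[OF \<open>i < n\<close>] by (intro sum.cong refl) (simp add: sum_distrib_right mult.assoc)
      also have "\<dots> = (\<Sum>a\<in>?I. c i a * ?q a)"
        by (subst sum.swap) (simp add: sum_distrib_left)
      finally show "v i * (\<Sum>j\<in>?I. V $$ (i, j) * v j) = (\<Sum>a\<in>?I. c i a * v i * ?q a)"
        by (simp add: sum_distrib_left mult_ac)
    qed
    also have "\<dots> = (\<Sum>a\<in>?I. ?p a * ?q a)"
      by (subst sum.swap) (simp add: sum_distrib_right)
    finally have cross: "(\<Sum>i<r. v i * (\<Sum>j\<in>?I. V $$ (i, j) * v j)) = (\<Sum>a\<in>?I. ?p a * ?q a)" .
    have "quad_form {..<r} f v = quad_form {..<r} (($$) V) v - (\<Sum>a\<in>?I. (?p a)\<^sup>2)"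
    proof -
      have "(\<Sum>a\<in>?I. (?p a)\<^sup>2) = (\<Sum>a\<in>?I. \<Sum>i<r. \<Sum>j<r. c i a * c j a * v i * v j)"
        unfolding power2_eq_square sum_product by (intro sum.cong refl) simp
      also have "\<dots> = (\<Sum>i<r. \<Sum>a\<in>?I. \<Sum>j<r. c i a * c j a * v i * v j)"
        by (rule sum.swap)
      also have "\<dots> = (\<Sum>i<r. \<Sum>j<r. \<Sum>a\<in>?I. c i a * c j a * v i * v j)"
        by (intro sum.cong refl sum.swap)
      also have "\<dots> = quad_form {..<r} (\<lambda>(i, j). \<Sum>a\<in>?I. c i a * c j a) v"
        unfolding quad_form_def by (simp add: sum_distrib_right)
      finally show ?thesis
        unfolding quad_form_def f_def by (simp add: left_diff_distrib sum_subtractf)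
    qed
    moreover have "0 \<le> (\<Sum>a\<in>?I. (?p a)\<^sup>2 + 2 * (?p a * ?q a) + (?q a)\<^sup>2)"
    proof (intro sum_nonneg)
      fix a
      have "(?p a)\<^sup>2 + 2 * (?p a * ?q a) + (?q a)\<^sup>2 = (?p a + ?q a)\<^sup>2" by (simp add: power2_sum)
      then show "0 \<le> (?p a)\<^sup>2 + 2 * (?p a * ?q a) + (?q a)\<^sup>2" by simp
    qed
    moreover have "{..<n} = {..<r} \<union> ?I" using assms(1) by auto
    then have "quad_form {..<n} (($$) V) v = quad_form {..<r} (($$) V) v +
        2 * (\<Sum>i<r. v i * (\<Sum>j\<in>?I. V $$ (i, j) * v j)) + quad_form ?I (($$) V) v"
      using quad_form_split[of "{..<r}" ?I "($$) V" v] Vsym assms(1) by (simp add: disjoint_iff)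
    ultimately show ?thesis
      using B(2)[of v] unfolding cross quad_I
      by (simp add: sum.distrib abs_le_iff flip: sum_distrib_left)
  qed
  \<comment> \<open>\<open>\<epsilon> * B \<le> 1\<close> lets the identity block absorb the loss
    \<open>B\<close>; the added 1 covers \<open>B = 0\<close>.\<close>
  define \<epsilon> where "\<epsilon> = 1 / (B + 1)"
  have \<epsilon>: "0 < \<epsilon>" "\<epsilon> * B \<le> 1" using B(1) by (auto simp: \<epsilon>_def divide_simps)
  have "psd_on {..<n} (($$) (block_id n r + \<epsilon> \<cdot>\<^sub>m V))"
    unfolding psd_on_def
  proof (intro conjI ballI allI)
    fix i j assume "i \<in> {..<n}" "j \<in> {..<n}"
    then show "(block_id n r + \<epsilon> \<cdot>\<^sub>m V) $$ (i, j) = (block_id n r + \<epsilon> \<cdot>\<^sub>m V) $$ (j, i)"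
      using Vsym[of i j] Vc by (simp add: block_id_index[OF assms(1)])
  next
    fix v
    have "0 \<le> (1 - \<epsilon> * B) * (\<Sum>i<r. (v i)\<^sup>2)" using \<epsilon> by (intro mult_nonneg_nonneg sum_nonneg) auto
    also have "\<dots> = (\<Sum>i<r. (v i)\<^sup>2) + \<epsilon> * (- B * (\<Sum>i<r. (v i)\<^sup>2))" by (simp add: algebra_simps)
    also have "\<dots> \<le> (\<Sum>i<r. (v i)\<^sup>2) + \<epsilon> * quad_form {..<n} (($$) V) v"
      using lower \<epsilon> by (intro add_left_mono mult_left_mono) auto
    finally show "0 \<le> quad_form {..<n} (($$) (block_id n r + \<epsilon> \<cdot>\<^sub>m V)) v"
      using block_id_carrier[OF assms(1)] Vc
      by (simp add: quad_form_index_add quad_form_block_id[OF assms(1)])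
  qed
  then show ?thesis using \<epsilon>(1) by blast
qed

section \<open>The cone of values of the adjoint map\<close>

lemma adjoint_map_eq_frob:
  assumes "\<And>i. i < m \<Longrightarrow> sym_mat n (A i)" "psd_mat n Y" "i < m"
  shows "adjoint_map m A Y i = frob {..<n} (($$) (A i)) (($$) Y)"
  using assms mat_inner_eq_frob[of "A i" n Y] by (simp add: adjoint_map_def psd_mat_def sym_mat_def)

text \<open>This is the adjoint identity: a linear functional on the values of the map is the
  pairing of \<open>Y\<close> with an element of the span.\<close>

lemma sum_adjoint_map:
  assumes "\<And>i. i < m \<Longrightarrow> sym_mat n (A i)" "psd_mat n Y"
  shows "(\<Sum>i<m. x i * adjoint_map m A Y i) = frob {..<n} (($$) (mat_lincomb n n {..<m} x A)) (($$) Y)"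
  unfolding frob_mat_lincomb using adjoint_map_eq_frob[OF assms(1) assms(2)] by simp

lemma psd_mat_add_scale:
  assumes "psd_mat n Y" "psd_mat n W" "0 \<le> c"
  shows "psd_mat n (Y + c \<cdot>\<^sub>m W)"
proof -
  have carr: "Y \<in> carrier_mat n n" "W \<in> carrier_mat n n"
    and psd: "psd_on {..<n} (($$) Y)" "psd_on {..<n} (($$) W)"
    using assms by (simp_all add: psd_mat_iff)
  have "psd_on {..<n} (($$) (Y + c \<cdot>\<^sub>m W)) \<longleftrightarrow> psd_on {..<n} (\<lambda>p. Y $$ p + c * W $$ p)"
    using carr by (intro psd_on_cong) auto
  then show ?thesis
    using psd_on_add[OF psd(1) psd_on_scale[OF psd(2) assms(3)]] carr by (simp add: psd_mat_iff)
qed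

lemma adjoint_map_add_scale:
  assumes A: "\<And>i. i < m \<Longrightarrow> sym_mat n (A i)" and Y: "psd_mat n Y" and W: "psd_mat n W" and "0 \<le> c"
  shows "adjoint_map m A (Y + c \<cdot>\<^sub>m W) = (\<lambda>i. adjoint_map m A Y i + c * adjoint_map m A W i)"
proof
  fix i
  have carr: "Y \<in> carrier_mat n n" "W \<in> carrier_mat n n" using Y W by (simp_all add: psd_mat_iff)
  show "adjoint_map m A (Y + c \<cdot>\<^sub>m W) i = adjoint_map m A Y i + c * adjoint_map m A W i"
  proof (cases "i < m")
    case True
    have "frob {..<n} (($$) (A i)) (($$) (Y + c \<cdot>\<^sub>m W)) = frob {..<n} (($$) (A i)) (\<lambda>p. Y $$ p + c * W $$ p)"
      using carr by (intro frob_cong) auto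
    then show ?thesis
      using adjoint_map_eq_frob[OF A _ True] psd_mat_add_scale[OF Y W \<open>0 \<le> c\<close>] Y W
      by (simp add: frob_add_right frob_scale_right)
  qed (simp add: adjoint_map_def)
qed

lemma psd_mat_zero: "psd_mat n (0\<^sub>m n n)"
proof -
  have "quad_form {..<n} (($$) (0\<^sub>m n n)) v = 0" for v
    unfolding quad_form_def by (intro sum.neutral) auto
  then show ?thesis by (simp add: psd_mat_iff psd_on_def)
qed

lemma psd_mat_rank_one: "psd_mat n (Matrix.mat n n (\<lambda>(i, j). v i * v j))"
proof -
  have "psd_on {..<n} (($$) (Matrix.mat n n (\<lambda>(i, j). v i * v j))) \<longleftrightarrow> psd_on {..<n} (\<lambda>(i, j). v i * v j)"
    by (intro psd_on_cong) auto
  then show ?thesis by (simp add: psd_mat_iff psd_on_rank_one)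
qed

lemma closed_imp_rigid:
  assumes A: "\<And>i. i < m \<Longrightarrow> sym_mat n (A i)" and "r \<le> n"
    and max: "max_rank_slack n m (A, 0\<^sub>m n n) (block_id n r)"
    and closed: "closed (adjoint_map m A ` {Y. psd_mat n Y})"
  shows "rigid n r (mat_span n m A)"
proof (rule ccontr)
  assume "\<not> ?thesis"
  then obtain x i1 j1 where V_psd: "psd_on {r..<n} (($$) (mat_lincomb n n {..<m} x A))"
    and nz: "i1 < n" "j1 \<in> {r..<n}" "mat_lincomb n n {..<m} x A $$ (i1, j1) \<noteq> 0"
    unfolding rigid_def mat_span_def by blast
  define V where "V = mat_lincomb n n {..<m} x A"
  let ?I = "{r..<n}"
  let ?lc = "\<lambda>x. mat_lincomb n n {..<m} x A"
  have V: "V \<in> mat_span n m A" "sym_mat n V"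
    unfolding V_def using A by (auto simp: mat_span_def intro!: mat_lincomb_sym)
  have "slack n m (A, 0\<^sub>m n n) (block_id n r)"
    using max by (simp add: max_rank_slack_def)
  then have Z: "block_id n r \<in> mat_span n m A" unfolding slack_homogeneous_iff by blast
  have tail: "S $$ (i, j) = 0" if "S \<in> mat_span n m A" "psd_on {..<n} (($$) S)" "i < n" "j \<in> ?I" for S i j
    using psd_tail_zero[OF \<open>r \<le> n\<close> max that] .
  \<comment> \<open>Otherwise \<open>block_id n r + \<epsilon> V\<close> would be a psd element of
    the span for some \<open>\<epsilon> > 0\<close>, and its tail would vanish although the entry at
    \<open>(i1, j1)\<close> does not.\<close>
  have "\<exists>w i. quad_form ?I (($$) V) w = 0 \<and> i < n \<and> (\<Sum>j\<in>?I. V $$ (i, j) * w j) \<noteq> 0"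
  proof (rule ccontr)
    assume neg: "\<not> ?thesis"
    have "\<exists>\<epsilon>>0. psd_on {..<n} (($$) (block_id n r + \<epsilon> \<cdot>\<^sub>m V))"
      by (rule perturbed_block_id_psd[OF \<open>r \<le> n\<close> V(2) V_psd[folded V_def]]) (use neg in blast)
    then obtain \<epsilon> where \<epsilon>: "\<epsilon> > 0" "psd_on {..<n} (($$) (block_id n r + \<epsilon> \<cdot>\<^sub>m V))"
      by blast
    have "(block_id n r + \<epsilon> \<cdot>\<^sub>m V) $$ (i1, j1) = 0"
      using tail[OF mat_span_add_scale[OF Z V(1)] \<epsilon>(2) nz(1,2)] .
    then have "\<epsilon> * V $$ (i1, j1) = 0"
      using nz(1,2) V(2) by (auto simp: block_id_index[OF \<open>r \<le> n\<close>] sym_mat_def split: if_splits)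
    then show False using \<epsilon>(1) nz(3) by (simp add: V_def)
  qed
  then obtain w0 i0 where w0: "quad_form ?I (($$) V) w0 = 0" "i0 < n"
    "(\<Sum>j\<in>?I. V $$ (i0, j) * w0 j) \<noteq> 0" by blast
  define w where "w = (\<lambda>j. if j \<in> ?I then w0 j else 0)"
  define u where "u = (\<lambda>i. \<Sum>j\<in>?I. V $$ (i, j) * w0 j)"
  \<comment> \<open>The rank-one matrix is left unsymmetrised: paired with the symmetric
    \<open>A k\<close> it gives the same value as its symmetric part.\<close>
  define y where "y = (\<lambda>k. if k < m then - frob {..<n} (($$) (A k)) (\<lambda>(i, j). u i * w j) else 0)"
  have sum_y: "(\<Sum>k<m. x' k * y k) = - (\<Sum>i<n. u i * (\<Sum>j\<in>?I. ?lc x' $$ (i, j) * w0 j))" for x'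
  proof -
    have "(\<Sum>k<m. x' k * y k) = - frob {..<n} (($$) (?lc x')) (\<lambda>(i, j). u i * w j)"
      unfolding frob_mat_lincomb by (simp add: y_def sum_negf)
    also have "frob {..<n} (($$) (?lc x')) (\<lambda>(i, j). u i * w j) =
        (\<Sum>i<n. u i * (\<Sum>j<n. ?lc x' $$ (i, j) * w j))"
      unfolding frob_def sum_distrib_left by (intro sum.cong refl) simp
    also have "\<dots> = (\<Sum>i<n. u i * (\<Sum>j\<in>?I. ?lc x' $$ (i, j) * w0 j))"
      by (intro sum.cong refl arg_cong2[of _ _ _ _ "(*)"] sum.mono_neutral_cong_right)
        (auto simp: w_def)
    finally show ?thesis .
  qed
  \<comment> \<open>The pairing with \<open>y\<close> sees only the last \<open>n - r\<close>
    columns, where psd elements of the span have zeros.\<close>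
  have sum_y_0: "(\<Sum>k<m. x' k * y k) = 0"
    if zero: "\<And>i j. i < n \<Longrightarrow> j \<in> ?I \<Longrightarrow> ?lc x' $$ (i, j) = 0" for x'
  proof -
    have "(\<Sum>j\<in>?I. ?lc x' $$ (i, j) * w0 j) = 0" if "i < n" for i
      using zero[OF that] by (intro sum.neutral ballI) (simp del: mat_lincomb_index)
    then show ?thesis unfolding sum_y by simp
  qed
  have sum_y_V: "(\<Sum>k<m. x k * y k) < 0"
  proof -
    have "(\<Sum>k<m. x k * y k) = - (\<Sum>i<n. u i * u i)"
      unfolding sum_y u_def V_def by simp
    moreover have "0 < (\<Sum>i<n. u i * u i)"
      using w0(2,3) by (intro sum_pos2[of _ i0]) (auto simp: u_def zero_less_mult_iff not_less)
    ultimately show ?thesis by simp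
  qed
  obtain z where z: "block_id n r = ?lc z" using Z unfolding mat_span_def by blast
  have y: "y \<notin> adjoint_map m A ` {Y. psd_mat n Y}"
  proof
    assume "y \<in> adjoint_map m A ` {Y. psd_mat n Y}"
    then obtain Y where Y: "psd_mat n Y" "y = adjoint_map m A Y" by blast
    have Yp: "psd_on {..<n} (($$) Y)" using Y(1) by (simp add: psd_mat_iff)
    have sum_Y: "(\<Sum>k<m. x' k * y k) = frob {..<n} (($$) (?lc x')) (($$) Y)" for x'
      unfolding Y(2) by (rule sum_adjoint_map[OF A Y(1)])
    \<comment> \<open>\<open>block_id n r\<close> has zeros in those columns too, so the upper left
      block of a psd preimage \<open>Y\<close> has trace 0 and \<open>Y\<close> lives on the lower
      block.\<close>
    have "(\<Sum>k<m. z k * y k) = 0"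
      using \<open>r \<le> n\<close> by (intro sum_y_0) (auto simp: z[symmetric] block_id_index simp del: mat_lincomb_index)
    then have tr: "(\<Sum>i<r. Y $$ (i, i)) = 0"
      unfolding sum_Y z[symmetric] frob_block_id[OF \<open>r \<le> n\<close>] .
    have diag: "Y $$ (i, i) = 0" if "i < r" for i
    proof -
      have "0 \<le> Y $$ (j, j)" if "j \<in> {..<r}" for j
        using psd_on_diag_nonneg[OF _ Yp, of j] that \<open>r \<le> n\<close> by simp
      then show ?thesis using tr that by (subst (asm) sum_nonneg_eq_0_iff) auto
    qed
    have row: "Y $$ (i, j) = 0" if "i < n" "j < n" "i < r \<or> j < r" for i j
      using psd_on_diag_zero[OF _ Yp, of i j] psd_on_diag_zero[OF _ Yp, of j i]
        psd_on_sym[OF Yp, of i j] diag[of i] diag[of j] that by auto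
    \<comment> \<open>On the lower block both \<open>V\<close> and \<open>Y\<close> are psd, so
      their pairing cannot have the negative value found in \<open>sum_y_V\<close>.\<close>
    have "frob {..<n} (($$) V) (($$) Y) = frob ?I (($$) V) (($$) Y)"
      by (intro frob_mono_neutral) (auto intro: row)
    moreover obtain v where v: "\<And>i j. i \<in> ?I \<Longrightarrow> j \<in> ?I \<Longrightarrow> Y $$ (i, j) = (\<Sum>a\<in>?I. v a i * v a j)"
      using psd_on_decomp[OF finite_atLeastLessThan psd_on_subset[OF _ _ Yp, of ?I]]
      by (auto simp: subset_iff)
    have "frob ?I (($$) V) (($$) Y) = (\<Sum>a\<in>?I. quad_form ?I (($$) V) (v a))"
      using v by (intro frob_decomp)
    moreover have "0 \<le> (\<Sum>a\<in>?I. quad_form ?I (($$) V) (v a))"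
      using V_psd by (intro sum_nonneg) (simp add: V_def psd_on_nonneg)
    ultimately show False using sum_y_V unfolding sum_Y V_def by simp
  qed
  have zero: "(\<lambda>_. 0) \<in> adjoint_map m A ` {Y. psd_mat n Y}"
  proof (rule image_eqI)
    have "adjoint_map m A (0\<^sub>m n n) i = 0" for i
    proof (cases "i < m")
      case True
      have "frob {..<n} (($$) (A i)) (($$) (0\<^sub>m n n)) = 0"
        unfolding frob_def by (intro sum.neutral ballI) simp
      then show ?thesis by (simp add: adjoint_map_eq_frob[OF A psd_mat_zero True])
    qed (simp add: adjoint_map_def)
    then show "(\<lambda>_. 0) = adjoint_map m A (0\<^sub>m n n)" by auto
  qed (simp add: psd_mat_zero)
  have cone: "(\<lambda>i. s i + c * t i) \<in> adjoint_map m A ` {Y. psd_mat n Y}"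
    if st: "s \<in> adjoint_map m A ` {Y. psd_mat n Y}" "t \<in> adjoint_map m A ` {Y. psd_mat n Y}"
      and c: "0 \<le> c" for s t c
  proof -
    obtain Y W where Y: "psd_mat n Y" "s = adjoint_map m A Y" and W: "psd_mat n W" "t = adjoint_map m A W"
      using st by blast
    have "(\<lambda>i. s i + c * t i) = adjoint_map m A (Y + c \<cdot>\<^sub>m W)"
      unfolding Y(2) W(2) by (rule adjoint_map_add_scale[OF A Y(1) W(1) c, symmetric])
    then show ?thesis using psd_mat_add_scale[OF Y(1) W(1) c] by blast
  qed
  \<comment> \<open>Closedness enters here through a functional that separates \<open>y\<close>.
    Rank-one matrices show that its matrix is psd, so it vanishes at \<open>y\<close> after
    all.\<close>
  obtain x' where x': "(\<Sum>k<m. x' k * y k) < 0"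
    and dual: "\<And>s. s \<in> adjoint_map m A ` {Y. psd_mat n Y} \<Longrightarrow> 0 \<le> (\<Sum>k<m. x' k * s k)"
  proof -
    have "\<exists>x. (\<Sum>k<m. x k * y k) < 0 \<and> (\<forall>s\<in>adjoint_map m A ` {Y. psd_mat n Y}. 0 \<le> (\<Sum>k<m. x k * s k))"
      using y zero cone by (intro closed_cone_separation[OF closed]) (auto simp: adjoint_map_def y_def)
    then show ?thesis using that by blast
  qed
  have psd: "psd_on {..<n} (($$) (?lc x'))"
    unfolding psd_on_def
  proof (intro conjI ballI allI)
    fix i j assume "i \<in> {..<n}" "j \<in> {..<n}"
    then show "?lc x' $$ (i, j) = ?lc x' $$ (j, i)"
      using mat_lincomb_sym[of "{..<m}" n A x'] A unfolding sym_mat_iff by blast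
  next
    fix v :: "nat \<Rightarrow> real"
    let ?Y = "Matrix.mat n n (\<lambda>(i, j). v i * v j)"
    have "0 \<le> (\<Sum>k<m. x' k * adjoint_map m A ?Y k)"
      by (intro dual imageI) (simp add: psd_mat_rank_one)
    also have "\<dots> = frob {..<n} (($$) (?lc x')) (($$) ?Y)"
      by (rule sum_adjoint_map[OF A psd_mat_rank_one])
    also have "\<dots> = frob {..<n} (($$) (?lc x')) (\<lambda>(i, j). v i * v j)"
      by (intro frob_cong) auto
    finally show "0 \<le> quad_form {..<n} (($$) (?lc x')) v" by (simp only: frob_rank_one)
  qed
  have "(\<Sum>k<m. x' k * y k) = 0"
    by (intro sum_y_0 tail psd) (auto simp: mat_span_def simp del: mat_lincomb_index)
  then show False using x' by simp
qed

section \<open>Elementary reformulations\<close>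

lemma mat_span_sym:
  assumes "\<And>i. i < m \<Longrightarrow> sym_mat n (A i)" "V \<in> mat_span n m A"
  shows "sym_mat n V"
  using assms unfolding mat_span_def by (auto intro!: mat_lincomb_sym)

lemma mat_span_member:
  assumes "i < m" "A i \<in> carrier_mat n n"
  shows "A i \<in> mat_span n m A"
proof -
  have "mat_lincomb n n {..<m} (\<lambda>k. if k = i then 1 else 0) A = A i"
  proof (rule eq_matI)
    fix a b assume "a < dim_row (A i)" "b < dim_col (A i)"
    then have "mat_lincomb n n {..<m} (\<lambda>k. if k = i then 1 else 0) A $$ (a, b) =
        (\<Sum>k<m. if k = i then A k $$ (a, b) else 0)"
      using assms by (simp add: if_distrib[of "\<lambda>t. t * _"] cong: if_cong)
    then show "mat_lincomb n n {..<m} (\<lambda>k. if k = i then 1 else 0) A $$ (a, b) = A i $$ (a, b)"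
      using assms by simp
  qed (use assms in auto)
  then show ?thesis unfolding mat_span_def by (metis rangeI)
qed

lemma mat_span_combine:
  assumes "i < m" "l i \<noteq> 0"
  shows "mat_span n m (A(i := mat_lincomb n n {..<m} l A)) = mat_span n m A"
proof -
  let ?A' = "A(i := mat_lincomb n n {..<m} l A)"
  have lc: "mat_lincomb n n {..<m} x ?A' =
      mat_lincomb n n {..<m} (\<lambda>k. (if k = i then 0 else x k) + x i * l k) A" for x
  proof (rule eq_matI)
    fix a b assume "a < dim_row (mat_lincomb n n {..<m} (\<lambda>k. (if k = i then 0 else x k) + x i * l k) A)"
      "b < dim_col (mat_lincomb n n {..<m} (\<lambda>k. (if k = i then 0 else x k) + x i * l k) A)"
    then have ab: "a < n" "b < n" by auto
    have "(\<Sum>k<m. x k * ?A' k $$ (a, b)) =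
        x i * mat_lincomb n n {..<m} l A $$ (a, b) + (\<Sum>k\<in>{..<m} - {i}. x k * A k $$ (a, b))"
      using assms(1) by (subst sum.remove[of _ i]) (auto simp del: mat_lincomb_index)
    also have "(\<Sum>k\<in>{..<m} - {i}. x k * A k $$ (a, b)) = (\<Sum>k<m. (if k = i then 0 else x k) * A k $$ (a, b))"
      by (intro sum.mono_neutral_cong_left) auto
    finally show "mat_lincomb n n {..<m} x ?A' $$ (a, b) =
        mat_lincomb n n {..<m} (\<lambda>k. (if k = i then 0 else x k) + x i * l k) A $$ (a, b)"
      using ab by (simp add: distrib_right sum.distrib sum_distrib_left mult.assoc del: fun_upd_apply)
  qed auto
  show ?thesis
  proof (intro equalityI subsetI)
    fix V assume "V \<in> mat_span n m ?A'"
    then show "V \<in> mat_span n m A" unfolding mat_span_def by (auto simp: lc)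
  next
    fix V assume "V \<in> mat_span n m A"
    then obtain y where y: "V = mat_lincomb n n {..<m} y A" unfolding mat_span_def by blast
    \<comment> \<open>The combination is inverted by solving for the coefficient at
      \<open>i\<close>, which needs \<open>l i \<noteq> 0\<close>; the other coefficients are
      corrected by what the new matrix contributes.\<close>
    define x where "x = (\<lambda>k. if k = i then y i / l i else y k - y i / l i * l k)"
    have "(\<lambda>k. (if k = i then 0 else x k) + x i * l k) = y"
      using assms(2) by (auto simp: x_def)
    then have "V = mat_lincomb n n {..<m} x ?A'" unfolding lc y by simp
    then show "V \<in> mat_span n m ?A'" unfolding mat_span_def by blast
  qed
qed

text \<open>A swap is its own inverse, so one inclusion for arbitrary families suffices.\<close>

lemma mat_span_swap:
  assumes "i < m" "j < m"
  shows "mat_span n m (A(i := A j, j := A i)) = mat_span n m A"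
proof -
  have sub: "mat_span n m (A(i := A j, j := A i)) \<subseteq> mat_span n m A" for A
  proof
    fix V assume "V \<in> mat_span n m (A(i := A j, j := A i))"
    then obtain x where V: "V = mat_lincomb n n {..<m} x (A(i := A j, j := A i))"
      unfolding mat_span_def by blast
    let ?t = "\<lambda>k. if k = i then j else if k = j then i else k"
    have "(\<Sum>k<m. x k * (A(i := A j, j := A i)) k $$ p) = (\<Sum>k<m. x (?t k) * A k $$ p)" for p
      using assms by (intro sum.reindex_bij_witness[of _ ?t ?t]) auto
    then have "V = mat_lincomb n n {..<m} (\<lambda>k. x (?t k)) A"
      unfolding V mat_lincomb_def by (intro cong_mat) auto
    then show "V \<in> mat_span n m A" unfolding mat_span_def by blast
  qed
  let ?A' = "A(i := A j, j := A i)"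
  have "?A'(i := ?A' j, j := ?A' i) = A" by auto
  then show ?thesis using sub[of A] sub[of ?A'] by auto
qed

lemma elem_step_combine_sym:
  assumes "\<And>i. i < m \<Longrightarrow> sym_mat n (A i)" "j < m"
  shows "sym_mat n ((A(i := mat_lincomb n n {..<m} l A)) j)"
  using assms by (auto intro!: mat_lincomb_sym)

text \<open>Choose a reformulation in which the initial segment of matrices satisfying \<open>Q\<close> is as long as
  possible; the matrices with index in \<open>{p..<m}\<close> are left alone.\<close>

lemma reformulation_basis:
  assumes A: "\<And>i. i < m \<Longrightarrow> sym_mat n (A i)" and "p \<le> m"
  shows "\<exists>A' k. (elem_step n m r)\<^sup>*\<^sup>* (A, B) (A', B) \<and> k \<le> p \<and> (\<forall>i\<in>{p..<m}. A' i = A i) \<and>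
    (\<forall>i<m. sym_mat n (A' i)) \<and> mat_span n m A' = mat_span n m A \<and> (\<forall>i<k. Q (A' i)) \<and>
    (\<forall>c. Q (mat_lincomb n n {k..<m} c A') \<longrightarrow> (\<forall>i\<in>{k..<p}. c i = 0))"
proof -
  let ?R = "\<lambda>A' k. (elem_step n m r)\<^sup>*\<^sup>* (A, B) (A', B) \<and> k \<le> p \<and> (\<forall>i\<in>{p..<m}. A' i = A i) \<and>
    (\<forall>i<m. sym_mat n (A' i)) \<and> mat_span n m A' = mat_span n m A \<and> (\<forall>i<k. Q (A' i))"
  define P where "P = (\<lambda>k. \<exists>A'. ?R A' k)"
  define k where "k = (GREATEST k. P k)"
  have "P 0" unfolding P_def using A by (intro exI[of _ A]) auto
  have bound: "\<And>j. P j \<Longrightarrow> j \<le> p" by (auto simp: P_def)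
  have "P k" unfolding k_def using \<open>P 0\<close> bound by (rule GreatestI_nat)
  then obtain A' where A': "?R A' k" unfolding P_def by blast
  \<comment> \<open>A combination satisfying \<open>Q\<close> with nonzero coefficient at
    \<open>i\<close> may replace \<open>A' i\<close> and be swapped to position \<open>k\<close>,
    against maximality. It may involve matrices with index at least \<open>p\<close>, but as
    \<open>k \<le> i < p\<close> none of these is moved.\<close>
  have "c i = 0" if c: "Q (mat_lincomb n n {k..<m} c A')" and i: "i \<in> {k..<p}" for c i
  proof (rule ccontr)
    assume nz: "c i \<noteq> 0"
    define l where "l = (\<lambda>j. if k \<le> j then c j else 0)"
    have "mat_lincomb n n {..<m} l A' = mat_lincomb n n {k..<m} c A'"
      unfolding mat_lincomb_def
      by (intro cong_mat refl) (auto simp: l_def intro!: sum.mono_neutral_cong_right)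
    then have Ql: "Q (mat_lincomb n n {..<m} l A')" using c by simp
    have im: "i < m" "l i \<noteq> 0" using i nz \<open>p \<le> m\<close> by (auto simp: l_def)
    define A1 where "A1 = A'(i := mat_lincomb n n {..<m} l A')"
    define A2 where "A2 = A1(i := A1 k, k := A1 i)"
    have s1: "elem_step n m r (A', B) (A1, B)"
      unfolding A1_def using im by (rule elem_step.combine)
    have km: "k < m" using i \<open>p \<le> m\<close> by auto
    have s2: "(elem_step n m r)\<^sup>*\<^sup>* (A1, B) (A2, B)"
    proof (cases "i = k")
      case True
      then show ?thesis by (simp add: A2_def)
    next
      case False
      then show ?thesis unfolding A2_def using im km by (intro r_into_rtranclp elem_step.swap)
    qed
    have "(elem_step n m r)\<^sup>*\<^sup>* (A, B) (A2, B)"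
      using A' s1 s2 by (meson rtranclp.rtrancl_into_rtrancl rtranclp_trans)
    moreover have "\<forall>j\<in>{p..<m}. A2 j = A j" using A' i by (auto simp: A2_def A1_def)
    moreover have sym1: "\<forall>j<m. sym_mat n (A1 j)"
      unfolding A1_def using A' elem_step_combine_sym[of m n A'] by blast
    then have "\<forall>j<m. sym_mat n (A2 j)" using im km by (auto simp: A2_def)
    moreover have "mat_span n m A2 = mat_span n m A"
      unfolding A2_def mat_span_swap[OF im(1) km] A1_def mat_span_combine[of i m l, OF im]
      using A' by blast
    moreover have "Q (A2 j)" if "j < Suc k" for j
      using A' that Ql i by (cases "j = k") (auto simp: A2_def A1_def)
    moreover have "Suc k \<le> p" using i by auto
    ultimately have "P (Suc k)" unfolding P_def by blast
    then have "Suc k \<le> k" unfolding k_def by (rule Greatest_le_nat[OF _ bound])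
    then show False by simp
  qed
  then show ?thesis using A' by blast
qed

section \<open>Rigidity in terms of vectors, and its behaviour under congruence\<close>

lemma tail_psd_iff_vec:
  assumes "sym_mat n V" "r \<le> n"
  shows "psd_on {r..<n} (($$) V) \<longleftrightarrow> (\<forall>v\<in>carrier_vec n. (\<forall>i<r. v $ i = 0) \<longrightarrow> 0 \<le> v \<bullet> (V *\<^sub>v v))"
proof -
  have V: "V \<in> carrier_mat n n" "\<And>i j. i < n \<Longrightarrow> j < n \<Longrightarrow> V $$ (i, j) = V $$ (j, i)"
    using assms(1) unfolding sym_mat_iff by blast+
  have quad: "v \<bullet> (V *\<^sub>v v) = quad_form {r..<n} (($$) V) (($) v)"
    if "v \<in> carrier_vec n" "\<forall>i<r. v $ i = 0" for v
    unfolding scalar_prod_mult_mat_vec[OF V(1) that(1)] using that(2)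
    by (intro quad_form_mono_neutral) auto
  show ?thesis
  proof
    assume "psd_on {r..<n} (($$) V)"
    then show "\<forall>v\<in>carrier_vec n. (\<forall>i<r. v $ i = 0) \<longrightarrow> 0 \<le> v \<bullet> (V *\<^sub>v v)"
      by (auto simp: quad psd_on_nonneg)
  next
    assume nonneg: "\<forall>v\<in>carrier_vec n. (\<forall>i<r. v $ i = 0) \<longrightarrow> 0 \<le> v \<bullet> (V *\<^sub>v v)"
    show "psd_on {r..<n} (($$) V)"
      unfolding psd_on_def
    proof (intro conjI ballI allI)
      fix i j assume "i \<in> {r..<n}" "j \<in> {r..<n}"
      then show "V $$ (i, j) = V $$ (j, i)" using V(2)[of i j] by simp
    next
      fix w :: "nat \<Rightarrow> real"
      let ?v = "vec n (\<lambda>i. if i < r then 0 else w i)"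
      have v: "?v \<in> carrier_vec n" "\<forall>i<r. ?v $ i = 0" using assms(2) by auto
      have "0 \<le> quad_form {r..<n} (($$) V) (($) ?v)" using nonneg v unfolding quad[OF v, symmetric] by blast
      also have "\<dots> = quad_form {r..<n} (($$) V) w" by (intro quad_form_cong) auto
      finally show "0 \<le> quad_form {r..<n} (($$) V) w" .
    qed
  qed
qed

lemma tail_zero_iff_vec:
  fixes V :: "real mat"
  assumes "V \<in> carrier_mat n n" "r \<le> n"
  shows "(\<forall>i<n. \<forall>j\<in>{r..<n}. V $$ (i, j) = 0) \<longleftrightarrow>
    (\<forall>v\<in>carrier_vec n. (\<forall>i<r. v $ i = 0) \<longrightarrow> V *\<^sub>v v = 0\<^sub>v n)"
proof
  assume zero: "\<forall>i<n. \<forall>j\<in>{r..<n}. V $$ (i, j) = 0"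
  show "\<forall>v\<in>carrier_vec n. (\<forall>i<r. v $ i = 0) \<longrightarrow> V *\<^sub>v v = 0\<^sub>v n"
  proof (intro ballI impI eq_vecI)
    fix v :: "real Matrix.vec" and i
    assume v: "v \<in> carrier_vec n" "\<forall>i<r. v $ i = 0" and "i < dim_vec (0\<^sub>v n :: real Matrix.vec)"
    then have i: "i < n" by simp
    have "V $$ (i, j) * v $ j = 0" if "j < n" for j
      using zero v(2) i that by (cases "j < r") auto
    then have "(\<Sum>j<n. V $$ (i, j) * v $ j) = 0" by (intro sum.neutral) auto
    then show "(V *\<^sub>v v) $ i = 0\<^sub>v n $ i"
      using assms(1) v(1) i by (simp add: scalar_prod_def atLeast0LessThan)
  qed (use assms in auto)
next
  assume zero: "\<forall>v\<in>carrier_vec n. (\<forall>i<r. v $ i = 0) \<longrightarrow> V *\<^sub>v v = 0\<^sub>v n"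
  show "\<forall>i<n. \<forall>j\<in>{r..<n}. V $$ (i, j) = 0"
  proof (intro allI impI ballI)
    fix i j assume i: "i < n" and j: "j \<in> {r..<n}"
    have "V *\<^sub>v unit_vec n j = 0\<^sub>v n"
      using zero j assms(2) by auto
    then have "(V *\<^sub>v unit_vec n j) $ i = 0" using i by simp
    moreover have "(V *\<^sub>v unit_vec n j) $ i = V $$ (i, j)"
      using i j assms(1) by simp
    ultimately show "V $$ (i, j) = 0" by simp
  qed
qed

text \<open>Both conditions now refer only to the subspace of vectors with vanishing first
  \<open>r\<close> coordinates, so a congruence preserving this subspace is a change of
  variables.\<close>

lemma rigid_iff_vec:
  assumes "\<And>V. V \<in> L \<Longrightarrow> sym_mat n V" "r \<le> n"
  shows "rigid n r L \<longleftrightarrow> (\<forall>V\<in>L. (\<forall>v\<in>carrier_vec n. (\<forall>i<r. v $ i = 0) \<longrightarrow> 0 \<le> v \<bullet> (V *\<^sub>v v)) \<longrightarrow>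
    (\<forall>v\<in>carrier_vec n. (\<forall>i<r. v $ i = 0) \<longrightarrow> V *\<^sub>v v = 0\<^sub>v n))"
  unfolding rigid_def
proof (intro ball_cong refl)
  fix V assume "V \<in> L"
  then have "sym_mat n V" "V \<in> carrier_mat n n" using assms(1) by (auto simp: sym_mat_def)
  then show "(psd_on {r..<n} (($$) V) \<longrightarrow> (\<forall>i<n. \<forall>j\<in>{r..<n}. V $$ (i, j) = 0)) \<longleftrightarrow>
      ((\<forall>v\<in>carrier_vec n. (\<forall>i<r. v $ i = 0) \<longrightarrow> 0 \<le> v \<bullet> (V *\<^sub>v v)) \<longrightarrow>
      (\<forall>v\<in>carrier_vec n. (\<forall>i<r. v $ i = 0) \<longrightarrow> V *\<^sub>v v = 0\<^sub>v n))"
    by (simp only: tail_psd_iff_vec tail_zero_iff_vec assms(2))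
qed

lemma sym_mat_congruence:
  assumes "sym_mat n V" "T \<in> carrier_mat n n"
  shows "sym_mat n (transpose_mat T * V * T)"
  using assms unfolding sym_mat_def
  by (auto simp: transpose_mult[of _ n n _ n] assoc_mult_mat[of _ n n _ n _ n])

text \<open>The form of the transformed matrix at \<open>v\<close> is that of \<open>V\<close> at
  \<open>T v\<close>. Every tail vector \<open>w\<close> is \<open>T\<close> applied to the tail
  vector \<open>T' w\<close>, so positivity on the tail passes back to \<open>V\<close>; rigidity
  then gives \<open>V (T v) = 0\<close>, and the transformed matrix kills \<open>v\<close>.\<close>

lemma rigid_congruence:
  assumes sym: "\<And>V. V \<in> L \<Longrightarrow> sym_mat n V" and "r \<le> n"
    and T: "T \<in> carrier_mat n n" "T' \<in> carrier_mat n n" "T * T' = 1\<^sub>m n"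
    and tail: "\<And>v i. v \<in> carrier_vec n \<Longrightarrow> \<forall>i<r. v $ i = 0 \<Longrightarrow> i < r \<Longrightarrow> (T *\<^sub>v v) $ i = 0"
    and tail': "\<And>v i. v \<in> carrier_vec n \<Longrightarrow> \<forall>i<r. v $ i = 0 \<Longrightarrow> i < r \<Longrightarrow> (T' *\<^sub>v v) $ i = 0"
    and rigid: "rigid n r L"
  shows "rigid n r ((\<lambda>V. transpose_mat T * V * T) ` L)"
proof (subst rigid_iff_vec)
  show "\<And>V. V \<in> (\<lambda>V. transpose_mat T * V * T) ` L \<Longrightarrow> sym_mat n V"
    using sym sym_mat_congruence[OF _ T(1)] by auto
  show "r \<le> n" by fact
  have L: "\<And>V v. V \<in> L \<Longrightarrow> (\<forall>v\<in>carrier_vec n. (\<forall>i<r. v $ i = 0) \<longrightarrow> 0 \<le> v \<bullet> (V *\<^sub>v v)) \<Longrightarrow>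
      v \<in> carrier_vec n \<Longrightarrow> (\<forall>i<r. v $ i = 0) \<Longrightarrow> V *\<^sub>v v = 0\<^sub>v n"
  proof -
    fix V and v :: "real Matrix.vec"
    assume V: "V \<in> L" and psd: "\<forall>v\<in>carrier_vec n. (\<forall>i<r. v $ i = 0) \<longrightarrow> 0 \<le> v \<bullet> (V *\<^sub>v v)"
      and v: "v \<in> carrier_vec n" "\<forall>i<r. v $ i = 0"
    note Vs = sym[OF V]
    have "psd_on {r..<n} (($$) V)" using tail_psd_iff_vec[OF Vs \<open>r \<le> n\<close>] psd by (rule iffD2)
    then have "\<forall>i<n. \<forall>j\<in>{r..<n}. V $$ (i, j) = 0" using rigid V by (simp add: rigid_def)
    moreover have "V \<in> carrier_mat n n" using Vs by (simp add: sym_mat_def)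
    ultimately show "V *\<^sub>v v = 0\<^sub>v n" using tail_zero_iff_vec[of V n r] \<open>r \<le> n\<close> v by blast
  qed
  show "\<forall>V'\<in>(\<lambda>V. transpose_mat T * V * T) ` L.
      (\<forall>v\<in>carrier_vec n. (\<forall>i<r. v $ i = 0) \<longrightarrow> 0 \<le> v \<bullet> (V' *\<^sub>v v)) \<longrightarrow>
      (\<forall>v\<in>carrier_vec n. (\<forall>i<r. v $ i = 0) \<longrightarrow> V' *\<^sub>v v = 0\<^sub>v n)"
  proof (intro ballI impI)
    fix V' and v :: "real Matrix.vec"
    assume "V' \<in> (\<lambda>V. transpose_mat T * V * T) ` L"
      and psd: "\<forall>v\<in>carrier_vec n. (\<forall>i<r. v $ i = 0) \<longrightarrow> 0 \<le> v \<bullet> (V' *\<^sub>v v)"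
      and v: "v \<in> carrier_vec n" "\<forall>i<r. v $ i = 0"
    then obtain V where V: "V \<in> L" "V' = transpose_mat T * V * T" by blast
    then have Vc: "V \<in> carrier_mat n n" using sym by (auto simp: sym_mat_def)
    have V'_mult: "V' *\<^sub>v w = transpose_mat T *\<^sub>v (V *\<^sub>v (T *\<^sub>v w))" if "w \<in> carrier_vec n" for w
      unfolding V(2) using T(1) Vc that by (simp add: assoc_mult_mat_vec[of _ n n _ n])
    have "0 \<le> w \<bullet> (V *\<^sub>v w)" if w: "w \<in> carrier_vec n" "\<forall>i<r. w $ i = 0" for w
    proof -
      let ?u = "T' *\<^sub>v w"
      have u: "?u \<in> carrier_vec n" "\<forall>i<r. ?u $ i = 0" using T(2) w tail'[OF w] by auto
      have Tu: "T *\<^sub>v ?u = w" using T w(1) by (simp flip: assoc_mult_mat_vec[of _ n n _ n])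
      have "?u \<bullet> (V' *\<^sub>v ?u) = ?u \<bullet> (transpose_mat T *\<^sub>v (V *\<^sub>v w))"
        using V'_mult[OF u(1)] Tu by simp
      also have "\<dots> = (transpose_mat T *\<^sub>v (V *\<^sub>v w)) \<bullet> ?u"
        using T(1,2) Vc w(1) by (intro comm_scalar_prod[of _ n]) auto
      also have "\<dots> = (V *\<^sub>v w) \<bullet> (T *\<^sub>v ?u)"
        using T(1) Vc u(1) w(1) by (intro transpose_vec_mult_scalar[of _ n n]) auto
      also have "\<dots> = w \<bullet> (V *\<^sub>v w)"
        unfolding Tu using Vc w(1) by (intro comm_scalar_prod[of _ n]) auto
      finally show ?thesis using psd u by metis
    qed
    then have "V *\<^sub>v (T *\<^sub>v v) = 0\<^sub>v n"
      using T(1) v tail[OF v] by (intro L[OF V(1)]) auto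
    then show "V' *\<^sub>v v = 0\<^sub>v n"
      using V'_mult[OF v(1)] T(1) by auto
  qed
qed

lemma congruence_index:
  fixes V :: "real mat"
  assumes "V \<in> carrier_mat n n" "T \<in> carrier_mat n n" "a < n" "b < n"
  shows "(transpose_mat T * V * T) $$ (a, b) = (\<Sum>j<n. \<Sum>i<n. T $$ (i, a) * V $$ (i, j) * T $$ (j, b))"
proof -
  have "(transpose_mat T * V * T) $$ (a, b) = (\<Sum>j<n. (transpose_mat T * V) $$ (a, j) * T $$ (j, b))"
    using assms by (subst index_mult_mat) (auto simp: scalar_prod_def atLeast0LessThan)
  also have "\<dots> = (\<Sum>j<n. \<Sum>i<n. T $$ (i, a) * V $$ (i, j) * T $$ (j, b))"
    using assms by (intro sum.cong refl)
      (simp add: scalar_prod_def atLeast0LessThan sum_distrib_right)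
  finally show ?thesis .
qed

lemma mat_span_congruence:
  assumes A: "\<And>i. i < m \<Longrightarrow> A i \<in> carrier_mat n n" and T: "T \<in> carrier_mat n n"
  shows "mat_span n m (\<lambda>i. transpose_mat T * A i * T) = (\<lambda>V. transpose_mat T * V * T) ` mat_span n m A"
proof -
  have "mat_lincomb n n {..<m} x (\<lambda>i. transpose_mat T * A i * T) =
      transpose_mat T * mat_lincomb n n {..<m} x A * T" for x
  proof (rule eq_matI)
    fix a b
    assume "a < dim_row (transpose_mat T * mat_lincomb n n {..<m} x A * T)"
      "b < dim_col (transpose_mat T * mat_lincomb n n {..<m} x A * T)"
    then have ab: "a < n" "b < n" using T by auto
    have "(\<Sum>k<m. x k * (transpose_mat T * A k * T) $$ (a, b)) =
        (\<Sum>k<m. \<Sum>j<n. \<Sum>i<n. T $$ (i, a) * (x k * A k $$ (i, j)) * T $$ (j, b))"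
      using A T ab by (intro sum.cong refl)
        (simp add: congruence_index[of _ n] sum_distrib_left mult_ac del: index_mult_mat)
    also have "\<dots> = (\<Sum>j<n. \<Sum>k<m. \<Sum>i<n. T $$ (i, a) * (x k * A k $$ (i, j)) * T $$ (j, b))"
      by (rule sum.swap)
    also have "\<dots> = (\<Sum>j<n. \<Sum>i<n. \<Sum>k<m. T $$ (i, a) * (x k * A k $$ (i, j)) * T $$ (j, b))"
      by (intro sum.cong refl sum.swap)
    also have "\<dots> = (\<Sum>j<n. \<Sum>i<n. T $$ (i, a) * mat_lincomb n n {..<m} x A $$ (i, j) * T $$ (j, b))"
      by (intro sum.cong refl) (simp add: sum_distrib_left sum_distrib_right)
    also have "\<dots> = (transpose_mat T * mat_lincomb n n {..<m} x A * T) $$ (a, b)"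
      using T ab by (intro congruence_index[symmetric]) auto
    finally show "mat_lincomb n n {..<m} x (\<lambda>i. transpose_mat T * A i * T) $$ (a, b) =
        (transpose_mat T * mat_lincomb n n {..<m} x A * T) $$ (a, b)"
      using ab by simp
  qed (use T in auto)
  then show ?thesis unfolding mat_span_def by (simp add: image_image)
qed

lemma block_rotation_head:
  fixes M :: "real mat"
  assumes "r \<le> n" "M \<in> carrier_mat (n - r) (n - r)"
    and T: "T = four_block_mat (1\<^sub>m r) (0\<^sub>m r (n - r)) (0\<^sub>m (n - r) r) M"
    and "v \<in> carrier_vec n" "i < r"
  shows "(T *\<^sub>v v) $ i = v $ i"
proof -
  have Tc: "T \<in> carrier_mat n n"
    unfolding T using four_block_carrier_mat[of "1\<^sub>m r" r r M "n - r" "n - r"] assms by simp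
  have "(T *\<^sub>v v) $ i = (\<Sum>j<n. T $$ (i, j) * v $ j)"
    using Tc assms by (simp add: scalar_prod_def atLeast0LessThan)
  also have "\<dots> = (\<Sum>j<n. if j = i then v $ j else 0)"
    using assms by (intro sum.cong refl) (auto simp: T)
  finally show ?thesis using assms by simp
qed

text \<open>Only a rotation can change the span: a shift touches just the right-hand side, and swaps
  and combinations preserve it.\<close>

lemma elem_step_rigid:
  assumes "elem_step n m r (A, B) (A', B')" "r \<le> n" and A: "\<And>i. i < m \<Longrightarrow> sym_mat n (A i)"
  shows "(\<forall>i<m. sym_mat n (A' i)) \<and> (rigid n r (mat_span n m A') \<longleftrightarrow> rigid n r (mat_span n m A))"
  using assms(1)
proof cases
  case (rotate M T)
  have Tc: "T \<in> carrier_mat n n"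
    unfolding rotate using four_block_carrier_mat[of "1\<^sub>m r" r r M "n - r" "n - r"] rotate assms by simp
  obtain T' where inv: "T * T' = 1\<^sub>m (dim_row T)" "T' * T = 1\<^sub>m (dim_row T')"
    using \<open>invertible_mat T\<close> unfolding invertible_mat_def inverts_mat_def by blast
  \<comment> \<open>\<open>invertible_mat\<close> provides two product equations; comparing
    dimensions in them shows that \<open>T'\<close> is \<open>n\<close> by \<open>n\<close>.\<close>
  have "dim_col T' = n" using arg_cong[OF inv(1), of dim_col] Tc by simp
  moreover have "dim_row T' = n" using arg_cong[OF inv(2), of dim_col] Tc by simp
  ultimately have T'c: "T' \<in> carrier_mat n n" by auto
  have inv: "T * T' = 1\<^sub>m n" "T' * T = 1\<^sub>m n" using inv Tc T'c by auto
  note head = block_rotation_head[OF \<open>r \<le> n\<close> rotate(3,4)]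
  have tail: "(T *\<^sub>v v) $ i = 0" if "v \<in> carrier_vec n" "\<forall>i<r. v $ i = 0" "i < r" for v i
    using head[of v i] that by simp
  \<comment> \<open>The block shape of the inverse is not computed: \<open>T\<close> copies the
    first \<open>r\<close> coordinates of \<open>T' v\<close>, and
    \<open>T (T' v) = v\<close>.\<close>
  have tail': "(T' *\<^sub>v v) $ i = 0" if v: "v \<in> carrier_vec n" "\<forall>i<r. v $ i = 0" "i < r" for v i
  proof -
    have "T *\<^sub>v (T' *\<^sub>v v) = v" using Tc T'c v(1) inv(1) by (simp flip: assoc_mult_mat_vec[of _ n n _ n])
    then show ?thesis using head[of "T' *\<^sub>v v" i] T'c v by auto
  qed
  let ?L = "mat_span n m A" and ?C = "\<lambda>V. transpose_mat T * V * T" and ?C' = "\<lambda>V. transpose_mat T' * V * T'"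
  have A': "A' = (\<lambda>i. ?C (A i))" using rotate by simp
  have L: "\<And>V. V \<in> ?L \<Longrightarrow> sym_mat n V" using mat_span_sym[of m n A] A by blast
  then have L': "\<And>V. V \<in> ?C ` ?L \<Longrightarrow> sym_mat n V" using sym_mat_congruence[OF _ Tc] by blast
  have span: "mat_span n m A' = ?C ` ?L"
    unfolding A' using A Tc by (intro mat_span_congruence) (auto simp: sym_mat_def)
  have "?C' (?C V) = V" if "V \<in> ?L" for V
  proof -
    have Vc: "V \<in> carrier_mat n n" using L[OF that] by (simp add: sym_mat_def)
    have "?C' (?C V) = (transpose_mat T' * transpose_mat T) * V * (T * T')"
      using Tc T'c Vc by (simp add: assoc_mult_mat[of _ n n _ n _ n])
    also have "transpose_mat T' * transpose_mat T = 1\<^sub>m n"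
      using transpose_mult[OF Tc T'c] inv(1) by simp
    finally show ?thesis using inv(1) Vc by simp
  qed
  then have conj_inv: "?C' ` ?C ` ?L = ?L" by (force simp: image_image)
  have "rigid n r (?C ` ?L)" if "rigid n r ?L"
    using L \<open>r \<le> n\<close> Tc T'c inv(1) tail tail' that by (rule rigid_congruence[of ?L n r T T'])
  \<comment> \<open>The converse is the same invariance for the congruence by the inverse.\<close>
  moreover have "rigid n r ?L" if "rigid n r (?C ` ?L)"
  proof -
    have "rigid n r (?C' ` ?C ` ?L)"
      using L' \<open>r \<le> n\<close> T'c Tc inv(2) tail' tail that by (rule rigid_congruence[of "?C ` ?L" n r T' T])
    then show ?thesis unfolding conj_inv .
  qed
  moreover have "\<forall>i<m. sym_mat n (A' i)" unfolding A' using A sym_mat_congruence[OF _ Tc] by blast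
  ultimately show ?thesis unfolding span by blast
next
  case (shift \<mu>)
  then show ?thesis using A by simp
next
  case (swap i j)
  then show ?thesis using A mat_span_swap[of i m j n A] by auto
next
  case (combine i l)
  then show ?thesis
    using A elem_step_combine_sym[of m n A] mat_span_combine[of i m l n A] by auto
qed

lemma elementary_reformulation_rigid:
  assumes "elementary_reformulation n m r (A, B) P'" "r \<le> n" and A: "\<And>i. i < m \<Longrightarrow> sym_mat n (A i)"
  shows "(\<forall>i<m. sym_mat n (fst P' i)) \<and> (rigid n r (mat_span n m (fst P')) \<longleftrightarrow> rigid n r (mat_span n m A))"
  using assms(1) unfolding elementary_reformulation_def
proof (induction rule: rtranclp_induct)
  case base
  then show ?case using A by simp
next
  case (step P P')
  then show ?case
    using elem_step_rigid[of n m r "fst P" "snd P" "fst P'" "snd P'"] \<open>r \<le> n\<close> by simp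
qed

section \<open>Closedness\<close>

abbreviation tail_zero :: "nat \<Rightarrow> nat \<Rightarrow> real mat \<Rightarrow> bool" where
  "tail_zero n r V \<equiv> \<forall>i<n. \<forall>j\<in>{r..<n}. V $$ (i, j) = 0"

lemma mat_lincomb_subset_span:
  assumes "K \<subseteq> {..<m}"
  shows "mat_lincomb n n K c A \<in> mat_span n m A"
proof -
  have "mat_lincomb n n K c A = mat_lincomb n n {..<m} (\<lambda>k. if k \<in> K then c k else 0) A"
    unfolding mat_lincomb_def using assms
    by (intro cong_mat refl) (auto intro!: sum.mono_neutral_cong_left)
  then show ?thesis unfolding mat_span_def by blast
qed

text \<open>A combination with vanishing lower block is psd there, and rigidity removes its
  off-diagonal block too. Independence of the pairs \<open>(G, H)\<close> thus passes to the blocks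
  \<open>H\<close> alone.\<close>

lemma rigid_tail_indep:
  assumes A: "\<And>i. i < m \<Longrightarrow> sym_mat n (A i)" and rigid: "rigid n r (mat_span n m A)"
    and indep: "\<And>c. tail_zero n r (mat_lincomb n n {k..<m} c A) \<Longrightarrow> \<forall>i\<in>{k..<m}. c i = 0"
    and c: "\<And>i j. i \<in> {r..<n} \<Longrightarrow> j \<in> {r..<n} \<Longrightarrow> (\<Sum>q\<in>{k..<m}. c q * A q $$ (i, j)) = 0"
  shows "\<forall>q\<in>{k..<m}. c q = 0"
proof (rule indep)
  let ?V = "mat_lincomb n n {k..<m} c A"
  have "psd_on {r..<n} (($$) ?V) \<longleftrightarrow> psd_on {r..<n} (\<lambda>_. 0)"
    using c by (intro psd_on_cong) auto
  then have "psd_on {r..<n} (($$) ?V)" by (simp add: psd_on_def quad_form_def)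
  moreover have "?V \<in> mat_span n m A" by (intro mat_lincomb_subset_span) auto
  ultimately show "tail_zero n r ?V" using rigid unfolding rigid_def by blast
qed

text \<open>This is the common core of closedness and of the good form. \<open>B\<close> is
  arbitrary because combinations and swaps leave it alone; \<open>\<delta>\<close> quantifies the
  definiteness of \<open>U\<close>, so that a multiple of \<open>U\<close> can dominate any given
  form.\<close>

lemma rigid_basis:
  assumes A: "\<forall>i<m. sym_mat n (A i)" and "r \<le> n" and rigid: "rigid n r (mat_span n m A)"
  shows "\<exists>A' k U \<delta>. (elem_step n m r)\<^sup>*\<^sup>* (A, B) (A', B) \<and> k \<le> m \<and> (\<forall>i<m. sym_mat n (A' i)) \<and>
    mat_span n m A' = mat_span n m A \<and> (\<forall>i<k. tail_zero n r (A' i)) \<and>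
    (\<forall>c. (\<forall>i\<in>{r..<n}. \<forall>j\<in>{r..<n}. (\<Sum>q\<in>{k..<m}. c q * A' q $$ (i, j)) = 0) \<longrightarrow> (\<forall>q\<in>{k..<m}. c q = 0)) \<and>
    0 < \<delta> \<and> (\<forall>i\<in>{r..<n}. \<forall>j\<in>{r..<n}. U (i, j) = U (j, i)) \<and>
    (\<forall>v. \<delta> * (\<Sum>i\<in>{r..<n}. (v i)\<^sup>2) \<le> quad_form {r..<n} U v) \<and>
    (\<forall>q\<in>{k..<m}. frob {r..<n} (($$) (A' q)) U = 0)"
proof -
  obtain A' k where steps: "(elem_step n m r)\<^sup>*\<^sup>* (A, B) (A', B)" and k: "k \<le> m"
    and sym: "\<And>i. i < m \<Longrightarrow> sym_mat n (A' i)" and span: "mat_span n m A' = mat_span n m A"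
    and zero: "\<forall>i<k. tail_zero n r (A' i)"
    and indep: "\<And>c. tail_zero n r (mat_lincomb n n {k..<m} c A') \<Longrightarrow> \<forall>i\<in>{k..<m}. c i = 0"
    using reformulation_basis[of m n A m r B "tail_zero n r"] A by blast
  have rigid': "rigid n r (mat_span n m A')" using rigid span by simp
  have indep': "\<forall>q\<in>{k..<m}. c q = 0"
    if "\<And>i j. i \<in> {r..<n} \<Longrightarrow> j \<in> {r..<n} \<Longrightarrow> (\<Sum>q\<in>{k..<m}. c q * A' q $$ (i, j)) = 0" for c
    using sym rigid' indep that by (rule rigid_tail_indep[of m n A' r k])
  have no_psd: "(\<Sum>q\<in>{k..<m}. c q * A' q $$ (i, j)) = 0"
    if psd: "psd_on {r..<n} (\<lambda>p. \<Sum>q\<in>{k..<m}. c q * A' q $$ p)" and ij: "i \<in> {r..<n}" "j \<in> {r..<n}" for c i j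
  proof -
    let ?V = "mat_lincomb n n {k..<m} c A'"
    have "psd_on {r..<n} (\<lambda>p. \<Sum>q\<in>{k..<m}. c q * A' q $$ p) \<longleftrightarrow> psd_on {r..<n} (($$) ?V)"
      by (intro psd_on_cong) auto
    then have "psd_on {r..<n} (($$) ?V)" using psd by (rule iffD1)
    moreover have "?V \<in> mat_span n m A'" by (intro mat_lincomb_subset_span) auto
    ultimately have "tail_zero n r ?V" using rigid' unfolding rigid_def by blast
    then have "?V $$ (i, j) = 0" using ij by auto
    then show ?thesis using ij by simp
  qed
  have symI: "A' q $$ (i, j) = A' q $$ (j, i)" if "q \<in> {k..<m}" "i \<in> {r..<n}" "j \<in> {r..<n}" for q i j
    using sym[of q] that by (simp add: sym_mat_iff)
  have sym_all: "\<forall>i<m. sym_mat n (A' i)" using sym by blast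
  have indep_all: "\<forall>c. (\<forall>i\<in>{r..<n}. \<forall>j\<in>{r..<n}. (\<Sum>q\<in>{k..<m}. c q * A' q $$ (i, j)) = 0) \<longrightarrow>
      (\<forall>q\<in>{k..<m}. c q = 0)"
    by (intro allI impI indep') blast
  have "\<exists>U \<delta>. 0 < \<delta> \<and> (\<forall>i\<in>{r..<n}. \<forall>j\<in>{r..<n}. U (i, j) = U (j, i)) \<and>
    (\<forall>v. \<delta> * (\<Sum>i\<in>{r..<n}. (v i)\<^sup>2) \<le> quad_form {r..<n} U v) \<and>
    (\<forall>q\<in>{k..<m}. frob {r..<n} (($$) (A' q)) U = 0)"
    using finite_atLeastLessThan finite_atLeastLessThan symI indep' no_psd
    by (rule pd_orthogonal_exists[of "{r..<n}" "{k..<m}" "\<lambda>q. ($$) (A' q)"])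
  then obtain U \<delta> where U: "0 < \<delta>" "\<forall>i\<in>{r..<n}. \<forall>j\<in>{r..<n}. U (i, j) = U (j, i)"
    "\<forall>v. \<delta> * (\<Sum>i\<in>{r..<n}. (v i)\<^sup>2) \<le> quad_form {r..<n} U v"
    "\<forall>q\<in>{k..<m}. frob {r..<n} (($$) (A' q)) U = 0" by blast
  show ?thesis
    by (intro exI[of _ A'] exI[of _ k] exI[of _ U] exI[of _ \<delta>] conjI steps k sym_all span zero indep_all U)
qed

lemma frob_union:
  assumes "finite I" "finite J" "I \<inter> J = {}"
    "\<And>i j. i \<in> I \<Longrightarrow> j \<in> J \<Longrightarrow> g (i, j) = 0" "\<And>i j. i \<in> I \<Longrightarrow> j \<in> J \<Longrightarrow> g (j, i) = 0"
  shows "frob (I \<union> J) f g = frob I f g + frob J f g"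
proof -
  have "(\<Sum>i\<in>I. \<Sum>j\<in>J. f (i, j) * g (i, j)) = 0" "(\<Sum>i\<in>J. \<Sum>j\<in>I. f (i, j) * g (i, j)) = 0"
    using assms(4,5) by (auto intro!: sum.neutral)
  then show ?thesis
    unfolding frob_def using assms(1-3) by (simp add: sum.union_disjoint sum.distrib)
qed

lemma psd_on_block_diag:
  assumes fin: "finite I" "finite J" "I \<inter> J = {}" and psd: "psd_on I f" "psd_on J f"
    and cross: "\<And>i j. i \<in> I \<Longrightarrow> j \<in> J \<Longrightarrow> f (i, j) = 0" "\<And>i j. i \<in> I \<Longrightarrow> j \<in> J \<Longrightarrow> f (j, i) = 0"
  shows "psd_on (I \<union> J) f"
  unfolding psd_on_def
proof (intro conjI ballI allI)
  fix i j assume "i \<in> I \<union> J" "j \<in> I \<union> J"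
  then consider "i \<in> I" "j \<in> I" | "i \<in> J" "j \<in> J" | "i \<in> I" "j \<in> J" | "i \<in> J" "j \<in> I" by blast
  then show "f (i, j) = f (j, i)"
  proof cases
    case 1 then show ?thesis by (rule psd_on_sym[OF psd(1)])
  next
    case 2 then show ?thesis by (rule psd_on_sym[OF psd(2)])
  next
    case 3 then show ?thesis by (simp add: cross)
  next
    case 4 then show ?thesis by (simp add: cross)
  qed
next
  fix v
  have "(\<Sum>i\<in>I. v i * (\<Sum>j\<in>J. f (i, j) * v j)) = 0"
    by (intro sum.neutral ballI) (simp add: cross)
  then have "quad_form (I \<union> J) f v = quad_form I f v + quad_form J f v"
    using fin by (subst quad_form_split) (simp_all add: cross)
  then show "0 \<le> quad_form (I \<union> J) f v"
    using psd_on_nonneg[OF psd(1), of v] psd_on_nonneg[OF psd(2), of v] by simp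
qed

lemma rigid_imp_closed:
  assumes A: "\<And>i. i < m \<Longrightarrow> sym_mat n (A i)" and "r \<le> n"
    and Z: "block_id n r \<in> mat_span n m A"
    and rigid: "rigid n r (mat_span n m A)"
  shows "closed (adjoint_map m A ` {Y. psd_mat n Y})"
  unfolding closed_sequential_limits
proof (intro allI impI)
  fix x l assume xl: "(\<forall>t. x t \<in> adjoint_map m A ` {Y. psd_mat n Y}) \<and> x \<longlonglongrightarrow> l"
  then have "\<forall>t. \<exists>Y. psd_mat n Y \<and> x t = adjoint_map m A Y" by blast
  then obtain Y where Y: "\<And>t. psd_mat n (Y t)" and x: "\<And>t. x t = adjoint_map m A (Y t)"
    by (metis choice)
  have Yp: "psd_on {..<n} (($$) (Y t))" for t using Y by (simp add: psd_mat_iff)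
  have lim: "(\<lambda>t. x t i) \<longlonglongrightarrow> l i" for i
    using continuous_on_tendsto_compose[OF continuous_coord[of i], of x l] xl by simp
  \<comment> \<open>The limit of the pairing exists for every element of the span, so it can be
    studied in the adapted family \<open>A'\<close> and carried back to \<open>A\<close> by
    linearity.\<close>
  let ?lim = "\<lambda>V. lim (\<lambda>t. frob {..<n} (($$) V) (($$) (Y t)))"
  have conv: "(\<lambda>t. frob {..<n} (($$) V) (($$) (Y t))) \<longlonglongrightarrow> ?lim V" if V: "V \<in> mat_span n m A" for V
  proof -
    obtain c where c: "V = mat_lincomb n n {..<m} c A" using V unfolding mat_span_def by blast
    have "(\<lambda>t. \<Sum>i<m. c i * x t i) \<longlonglongrightarrow> (\<Sum>i<m. c i * l i)"
      by (intro tendsto_intros lim)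
    moreover have "(\<Sum>i<m. c i * x t i) = frob {..<n} (($$) V) (($$) (Y t))" for t
      unfolding c x using A Y by (rule sum_adjoint_map)
    ultimately have "(\<lambda>t. frob {..<n} (($$) V) (($$) (Y t))) \<longlonglongrightarrow> (\<Sum>i<m. c i * l i)"
      by simp
    then show ?thesis by (simp add: limI)
  qed
  have A_all: "\<forall>i<m. sym_mat n (A i)" using A by blast
  obtain A' k U \<delta> where k: "k \<le> m" and sym: "\<forall>i<m. sym_mat n (A' i)"
    and span: "mat_span n m A' = mat_span n m A" and zero: "\<forall>i<k. tail_zero n r (A' i)"
    and indep: "\<forall>c. (\<forall>i\<in>{r..<n}. \<forall>j\<in>{r..<n}. (\<Sum>q\<in>{k..<m}. c q * A' q $$ (i, j)) = 0) \<longrightarrow> (\<forall>q\<in>{k..<m}. c q = 0)"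
    and \<delta>: "0 < \<delta>" and U: "\<forall>i\<in>{r..<n}. \<forall>j\<in>{r..<n}. U (i, j) = U (j, i)"
    and U_ge: "\<forall>v. \<delta> * (\<Sum>i\<in>{r..<n}. (v i)\<^sup>2) \<le> quad_form {r..<n} U v"
    and U_orth: "\<forall>q\<in>{k..<m}. frob {r..<n} (($$) (A' q)) U = 0"
    using rigid_basis[of m n A r "0\<^sub>m n n", OF _ \<open>r \<le> n\<close> rigid, OF A_all]
    by (elim exE conjE) (rule that; assumption)
  have A'_span: "A' q \<in> mat_span n m A" if "q < m" for q
    using mat_span_member[of q m A' n] sym that unfolding span by (simp add: sym_mat_def)
  have A'_sym: "A' q $$ (i, j) = A' q $$ (j, i)" if "q < m" "i < n" "j < n" for q i j
    using sym that by (simp add: sym_mat_iff)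
  \<comment> \<open>As \<open>block_id n r\<close> lies in the span, the traces of the upper left
    blocks converge; for psd blocks this bounds all entries.\<close>
  have "(\<lambda>t. \<Sum>i<r. Y t $$ (i, i)) \<longlonglongrightarrow> ?lim (block_id n r)"
    using conv[OF Z] unfolding frob_block_id[OF \<open>r \<le> n\<close>] by simp
  then have "Bseq (\<lambda>t. \<Sum>i<r. Y t $$ (i, i))"
    by (intro convergent_imp_Bseq convergentI)
  then obtain R where R: "\<And>t. norm (\<Sum>i<r. Y t $$ (i, i)) \<le> R"
    unfolding Bseq_def by blast
  define f where "f = (\<lambda>t p. if p \<in> {..<r} \<times> {..<r} then Y t $$ p else 0)"
  let ?K = "{f. psd_on {..<r} f \<and> (\<forall>p. p \<notin> {..<r} \<times> {..<r} \<longrightarrow> f p = 0) \<and> (\<Sum>i<r. f (i, i)) \<le> R}"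
  have "f t \<in> ?K" for t
  proof -
    have "psd_on {..<r} (($$) (Y t))" using psd_on_subset[OF _ _ Yp] \<open>r \<le> n\<close> by simp
    also have "?this \<longleftrightarrow> psd_on {..<r} (f t)" by (intro psd_on_cong) (auto simp: f_def)
    finally have "psd_on {..<r} (f t)" .
    moreover have "(\<Sum>i<r. f t (i, i)) \<le> R" using R[of t] by (simp add: f_def)
    ultimately show ?thesis by (simp add: f_def)
  qed
  moreover have "seq_compact ?K" by (intro compact_imp_seq_compact compact_psd_trace_le) simp
  ultimately obtain g \<phi> where g: "g \<in> ?K" and \<phi>: "strict_mono (\<phi> :: nat \<Rightarrow> nat)" and lim_f: "(f \<circ> \<phi>) \<longlonglongrightarrow> g"
    unfolding seq_compact_def by blast
  have lim_fp: "(\<lambda>t. f (\<phi> t) p) \<longlonglongrightarrow> g p" for p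
    using continuous_on_tendsto_compose[OF continuous_coord[of p], of "f \<circ> \<phi>" g] lim_f by simp
  \<comment> \<open>The first \<open>k\<close> matrices pair only with the upper left block, so
    \<open>g\<close> already attains their limits.\<close>
  have head: "?lim (A' q) = frob {..<r} (($$) (A' q)) g" if q: "q < k" for q
  proof -
    have qm: "q < m" using q k by simp
    have "A' q $$ (i, j) = 0" if "i < n" "j < n" "r \<le> i \<or> r \<le> j" for i j
      using zero q that A'_sym[OF qm that(1,2)] by fastforce
    then have "frob {..<n} (($$) (A' q)) (($$) (Y t)) = frob {..<r} (($$) (A' q)) (($$) (Y t))" for t
      using \<open>r \<le> n\<close> by (intro frob_mono_neutral) auto
    also have "frob {..<r} (($$) (A' q)) (($$) (Y t)) = frob {..<r} (($$) (A' q)) (f t)" for t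
      by (intro frob_cong) (auto simp: f_def)
    finally have "(\<lambda>t. frob {..<r} (($$) (A' q)) (f t)) \<longlonglongrightarrow> ?lim (A' q)"
      using conv[OF A'_span[OF qm]] by simp
    then have "(\<lambda>t. frob {..<r} (($$) (A' q)) (f (\<phi> t))) \<longlonglongrightarrow> ?lim (A' q)"
      using LIMSEQ_subseq_LIMSEQ[OF _ \<phi>] by (fastforce simp: o_def)
    moreover have "(\<lambda>t. frob {..<r} (($$) (A' q)) (f (\<phi> t))) \<longlonglongrightarrow> frob {..<r} (($$) (A' q)) g"
      unfolding frob_def by (intro tendsto_intros lim_fp)
    ultimately show ?thesis by (rule LIMSEQ_unique)
  qed
  obtain X where Xsym: "\<forall>q i j. X q (i, j) = X q (j, i)"
    and X: "\<forall>p\<in>{k..<m}. \<forall>q\<in>{k..<m}. frob {r..<n} (($$) (A' p)) (X q) = (if p = q then 1 else 0)"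
  proof -
    have symI: "A' q $$ (i, j) = A' q $$ (j, i)" if "q \<in> {k..<m}" "i \<in> {r..<n}" "j \<in> {r..<n}" for q i j
      using A'_sym[of q i j] that by simp
    have indepI: "\<forall>q\<in>{k..<m}. c q = 0"
      if "\<And>i j. i \<in> {r..<n} \<Longrightarrow> j \<in> {r..<n} \<Longrightarrow> (\<Sum>q\<in>{k..<m}. c q * A' q $$ (i, j)) = 0" for c
      using indep that by blast
    have "\<exists>X. (\<forall>q i j. X q (i, j) = X q (j, i)) \<and>
      (\<forall>p\<in>{k..<m}. \<forall>q\<in>{k..<m}. frob {r..<n} (($$) (A' p)) (X q) = (if p = q then 1 else 0))"
      using finite_atLeastLessThan finite_atLeastLessThan symI indepI
      by (rule dual_basis_exists[of "{r..<n}" "{k..<m}" "\<lambda>q. ($$) (A' q)"])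
    then show ?thesis using that by blast
  qed
  \<comment> \<open>\<open>b q\<close> is the part of the limit that \<open>g\<close> does not
    supply and that the lower block has to produce.\<close>
  define b where "b = (\<lambda>q. ?lim (A' q) - frob {..<r} (($$) (A' q)) g)"
  \<comment> \<open>The dual basis solves these equations; \<open>h\<close> is symmetric but need
    not be psd.\<close>
  define h where "h = (\<lambda>p. \<Sum>q\<in>{k..<m}. b q * X q p)"
  obtain C where C: "0 \<le> C" "\<And>v. \<bar>quad_form {r..<n} h v\<bar> \<le> C * (\<Sum>i\<in>{r..<n}. (v i)\<^sup>2)"
    using quad_form_bounded[OF finite_atLeastLessThan, of r n h] by blast
  \<comment> \<open>The form of \<open>C / \<delta> * U\<close> is at least \<open>C\<close> times
    the squared length, which outweighs \<open>h\<close>. Orthogonality of \<open>U\<close> leaves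
    the equations intact.\<close>
  define y where "y = (\<lambda>p. h p + C / \<delta> * U p)"
  have y_psd: "psd_on {r..<n} y"
    unfolding psd_on_def
  proof (intro conjI ballI allI)
    fix i j assume "i \<in> {r..<n}" "j \<in> {r..<n}"
    moreover have "h (i, j) = h (j, i)"
      unfolding h_def by (intro sum.cong refl arg_cong2[of _ _ _ _ "(*)"]) (rule Xsym[rule_format])
    ultimately show "y (i, j) = y (j, i)" using U unfolding y_def by simp
  next
    fix v
    have "C / \<delta> * (\<delta> * (\<Sum>i\<in>{r..<n}. (v i)\<^sup>2)) \<le> C / \<delta> * quad_form {r..<n} U v"
      using U_ge C(1) \<delta> by (intro mult_left_mono) auto
    then show "0 \<le> quad_form {r..<n} y v"
      using C(2)[of v] \<delta> unfolding y_def quad_form_add quad_form_scale by simp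
  qed
  have y_frob: "frob {r..<n} (($$) (A' q)) y = b q" if q: "q \<in> {k..<m}" for q
  proof -
    have "frob {r..<n} (($$) (A' q)) h = (\<Sum>p\<in>{k..<m}. b p * (if q = p then 1 else 0))"
      unfolding h_def frob_sum_right using X q by (intro sum.cong refl) simp
    also have "\<dots> = b q" using q by (simp add: if_distrib[of "(*) _"] cong: if_cong)
    finally show ?thesis
      using U_orth q unfolding y_def frob_add_right frob_scale_right by simp
  qed
  \<comment> \<open>No limit of the off-diagonal blocks of \<open>Y t\<close> is taken; they are
    replaced by 0.\<close>
  define W where "W = Matrix.mat n n (\<lambda>(i, j). if i < r \<and> j < r then g (i, j)
    else if r \<le> i \<and> r \<le> j then y (i, j) else 0)"
  have split: "{..<n} = {..<r} \<union> {r..<n}" using \<open>r \<le> n\<close> by auto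
  have W_index: "W $$ (i, j) = (if i < r \<and> j < r then g (i, j) else if r \<le> i \<and> r \<le> j then y (i, j) else 0)"
    if "i < n" "j < n" for i j
    using that by (simp add: W_def)
  have "psd_on {..<r} g \<longleftrightarrow> psd_on {..<r} (($$) W)"
    using \<open>r \<le> n\<close> by (intro psd_on_cong) (simp add: W_index)
  moreover have "psd_on {r..<n} y \<longleftrightarrow> psd_on {r..<n} (($$) W)"
    by (intro psd_on_cong) (simp add: W_index)
  ultimately have W: "psd_mat n W"
    unfolding psd_mat_iff split using g y_psd \<open>r \<le> n\<close>
    by (intro conjI psd_on_block_diag) (auto simp: W_index, simp add: W_def)
  have "frob {..<n} (($$) V) (($$) W) = frob {..<r} (($$) V) g + frob {r..<n} (($$) V) y" for V
  proof -
    have "frob {..<n} (($$) V) (($$) W) = frob {..<r} (($$) V) (($$) W) + frob {r..<n} (($$) V) (($$) W)"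
      unfolding split using \<open>r \<le> n\<close> by (intro frob_union) (auto simp: W_index)
    moreover have "frob {..<r} (($$) V) (($$) W) = frob {..<r} (($$) V) g"
      using \<open>r \<le> n\<close> by (intro frob_cong) (auto simp: W_index)
    moreover have "frob {r..<n} (($$) V) (($$) W) = frob {r..<n} (($$) V) y"
      by (intro frob_cong) (auto simp: W_index)
    ultimately show ?thesis by simp
  qed
  note frob_W = this
  have W_lim: "frob {..<n} (($$) (A' q)) (($$) W) = ?lim (A' q)" if "q < m" for q
  proof (cases "q < k")
    case True
    have "A' q $$ (i, j) = 0" if "i < n" "j \<in> {r..<n}" for i j using zero True that by blast
    then have "frob {r..<n} (($$) (A' q)) y = 0"
      unfolding frob_def by (intro sum.neutral ballI) simp
    then show ?thesis unfolding frob_W head[OF True] by simp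
  next
    case False
    then have "q \<in> {k..<m}" using that by simp
    then show ?thesis unfolding frob_W y_frob[OF \<open>q \<in> {k..<m}\<close>] b_def by simp
  qed
  have "adjoint_map m A W i = l i" for i
  proof (cases "i < m")
    case True
    have "A i \<in> mat_span n m A'"
      unfolding span using A[OF True] True by (intro mat_span_member) (auto simp: sym_mat_def)
    then obtain d where d: "A i = mat_lincomb n n {..<m} d A'" unfolding mat_span_def by blast
    have "(\<lambda>t. \<Sum>q<m. d q * frob {..<n} (($$) (A' q)) (($$) (Y t))) \<longlonglongrightarrow> (\<Sum>q<m. d q * ?lim (A' q))"
      by (intro tendsto_intros conv A'_span) simp
    moreover have "x t i = frob {..<n} (($$) (A i)) (($$) (Y t))" for t
      unfolding x using A Y True by (rule adjoint_map_eq_frob)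
    then have "(\<Sum>q<m. d q * frob {..<n} (($$) (A' q)) (($$) (Y t))) = x t i" for t
      by (simp add: d frob_mat_lincomb)
    ultimately have "(\<lambda>t. x t i) \<longlonglongrightarrow> (\<Sum>q<m. d q * ?lim (A' q))" by simp
    then have "l i = (\<Sum>q<m. d q * ?lim (A' q))"
      by (rule LIMSEQ_unique[OF lim])
    also have "\<dots> = frob {..<n} (($$) (A i)) (($$) W)"
      unfolding d frob_mat_lincomb using W_lim by simp
    also have "\<dots> = adjoint_map m A W i" using A W True by (rule adjoint_map_eq_frob[symmetric])
    finally show ?thesis by simp
  next
    case False
    then have "(\<lambda>t. x t i) = (\<lambda>t. 0)" unfolding x adjoint_map_def by simp
    then have "l i = 0" using lim[of i] LIMSEQ_unique[OF _ tendsto_const] by metis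
    then show ?thesis using False by (simp add: adjoint_map_def)
  qed
  then have "l = adjoint_map m A W" by auto
  then show "l \<in> adjoint_map m A ` {Y. psd_mat n Y}" using W by blast
qed

section \<open>Normal forms\<close>

lemma sum_shift: "(\<Sum>i\<in>{r..<n}. f i) = (\<Sum>a<n - r. f (r + a))" for f :: "nat \<Rightarrow> real"
  by (rule sum.reindex_bij_witness[of _ "\<lambda>a. r + a" "\<lambda>i. i - r"]) auto

lemma quad_form_shift:
  "quad_form {r..<n} f v = quad_form {..<n - r} (\<lambda>(a, b). f (r + a, r + b)) (\<lambda>a. v (r + a))"
  unfolding quad_form_def sum_shift by simp

lemma frob_shift:
  "frob {r..<n} f g = frob {..<n - r} (\<lambda>(a, b). f (r + a, r + b)) (\<lambda>(a, b). g (r + a, r + b))"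
  unfolding frob_def sum_shift by simp

text \<open>The blocks of a normal form are indexed from 0, whereas the calculus above keeps the
  range \<open>{r..<n}\<close>.\<close>

lemma psd_on_shift: "psd_on {r..<n} f \<longleftrightarrow> psd_on {..<n - r} (\<lambda>(a, b). f (r + a, r + b))"
proof
  assume f: "psd_on {r..<n} f"
  show "psd_on {..<n - r} (\<lambda>(a, b). f (r + a, r + b))"
    unfolding psd_on_def
  proof (intro conjI ballI allI)
    fix a b assume "a \<in> {..<n - r}" "b \<in> {..<n - r}"
    then show "(case (a, b) of (a, b) \<Rightarrow> f (r + a, r + b)) = (case (b, a) of (a, b) \<Rightarrow> f (r + a, r + b))"
      using psd_on_sym[OF f, of "r + a" "r + b"] by simp
  next
    fix v
    show "0 \<le> quad_form {..<n - r} (\<lambda>(a, b). f (r + a, r + b)) v"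
      using psd_on_nonneg[OF f, of "\<lambda>i. v (i - r)"] unfolding quad_form_shift by simp
  qed
next
  assume f: "psd_on {..<n - r} (\<lambda>(a, b). f (r + a, r + b))"
  show "psd_on {r..<n} f"
    unfolding psd_on_def
  proof (intro conjI ballI allI)
    fix i j assume "i \<in> {r..<n}" "j \<in> {r..<n}"
    then show "f (i, j) = f (j, i)"
      using psd_on_sym[OF f, of "i - r" "j - r"] by (simp add: diff_less_mono)
  next
    fix v
    show "0 \<le> quad_form {r..<n} f v"
      unfolding quad_form_shift by (rule psd_on_nonneg[OF f])
  qed
qed

definition upper_block :: "nat \<Rightarrow> real mat \<Rightarrow> real mat" where
  "upper_block r V = Matrix.mat r r (\<lambda>(a, b). V $$ (a, b))"

definition side_block :: "nat \<Rightarrow> nat \<Rightarrow> real mat \<Rightarrow> real mat" where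
  "side_block n r V = Matrix.mat r (n - r) (\<lambda>(a, b). V $$ (a, r + b))"

definition lower_block :: "nat \<Rightarrow> nat \<Rightarrow> real mat \<Rightarrow> real mat" where
  "lower_block n r V = Matrix.mat (n - r) (n - r) (\<lambda>(a, b). V $$ (r + a, r + b))"

lemma psd_mat_lower_block: "psd_mat (n - r) (lower_block n r V) \<longleftrightarrow> psd_on {r..<n} (($$) V)"
proof -
  have "psd_on {..<n - r} (($$) (lower_block n r V)) \<longleftrightarrow> psd_on {..<n - r} (\<lambda>(a, b). V $$ (r + a, r + b))"
    by (intro psd_on_cong) (auto simp: lower_block_def)
  then show ?thesis by (simp add: psd_mat_iff psd_on_shift lower_block_def)
qed

text \<open>Symmetry alone gives the full block shape; for \<open>i < k\<close> a vanishing tail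
  makes the side and lower blocks zero.\<close>

lemma normal_shape_blocks:
  assumes "r \<le> n" "k \<le> m" and sym: "\<And>i. i < m \<Longrightarrow> sym_mat n (A i)"
    and zero: "\<And>i. i < k \<Longrightarrow> tail_zero n r (A i)"
  shows "normal_shape n m r k (\<lambda>i. upper_block r (A i)) (\<lambda>i. side_block n r (A i))
    (\<lambda>i. lower_block n r (A i)) (A, block_id n r)"
proof -
  have A: "A i \<in> carrier_mat n n" "\<And>a b. a < n \<Longrightarrow> b < n \<Longrightarrow> A i $$ (a, b) = A i $$ (b, a)" if "i < m" for i
    using sym[OF that] unfolding sym_mat_iff by blast+
  have symF: "sym_mat r (upper_block r (A i))" if "i < m" for i
    unfolding sym_mat_iff
  proof (intro conjI allI impI)
    fix a b assume "a < r" "b < r"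
    then show "upper_block r (A i) $$ (a, b) = upper_block r (A i) $$ (b, a)"
      using A(2)[OF that, of a b] \<open>r \<le> n\<close> by (simp add: upper_block_def)
  qed (simp add: upper_block_def)
  have symH: "sym_mat (n - r) (lower_block n r (A i))" if "i < m" for i
    unfolding sym_mat_iff
  proof (intro conjI allI impI)
    fix a b assume "a < n - r" "b < n - r"
    then show "lower_block n r (A i) $$ (a, b) = lower_block n r (A i) $$ (b, a)"
      using A(2)[OF that, of "r + a" "r + b"] by (simp add: lower_block_def)
  qed (simp add: lower_block_def)
  have full: "A i = four_block_mat (upper_block r (A i)) (side_block n r (A i))
      (transpose_mat (side_block n r (A i))) (lower_block n r (A i))" if "i < m" for i
  proof (rule eq_matI)
    fix a b
    assume "a < dim_row (four_block_mat (upper_block r (A i)) (side_block n r (A i))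
        (transpose_mat (side_block n r (A i))) (lower_block n r (A i)))"
      "b < dim_col (four_block_mat (upper_block r (A i)) (side_block n r (A i))
        (transpose_mat (side_block n r (A i))) (lower_block n r (A i)))"
    then have ab: "a < n" "b < n" using \<open>r \<le> n\<close> by (auto simp: upper_block_def lower_block_def)
    then show "A i $$ (a, b) = four_block_mat (upper_block r (A i)) (side_block n r (A i))
        (transpose_mat (side_block n r (A i))) (lower_block n r (A i)) $$ (a, b)"
      using \<open>r \<le> n\<close> A(2)[OF that ab]
      by (subst index_mat_four_block) (auto simp: upper_block_def side_block_def lower_block_def)
  qed (use A(1)[OF that] \<open>r \<le> n\<close> in \<open>auto simp: upper_block_def lower_block_def\<close>)
  have head: "A i = four_block_mat (upper_block r (A i)) (0\<^sub>m r (n - r)) (0\<^sub>m (n - r) r) (0\<^sub>m (n - r) (n - r))"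
    if "i < k" for i
  proof -
    have im: "i < m" using that \<open>k \<le> m\<close> by simp
    have z: "A i $$ (a, b) = 0" if "a < n" "b \<in> {r..<n}" for a b using zero[OF \<open>i < k\<close>] that by blast
    have "side_block n r (A i) = 0\<^sub>m r (n - r)"
      using \<open>r \<le> n\<close> by (intro eq_matI) (auto simp: side_block_def z)
    moreover have "lower_block n r (A i) = 0\<^sub>m (n - r) (n - r)"
      by (intro eq_matI) (auto simp: lower_block_def z)
    ultimately show ?thesis using full[OF im] by simp
  qed
  show ?thesis
    unfolding normal_shape.simps
  proof (intro conjI allI impI ballI)
    fix i assume "i < k"
    then show "sym_mat r (upper_block r (A i))" using \<open>k \<le> m\<close> by (intro symF) simp
    show "A i = four_block_mat (upper_block r (A i)) (0\<^sub>m r (n - r)) (0\<^sub>m (n - r) r) (0\<^sub>m (n - r) (n - r))"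
      using \<open>i < k\<close> by (rule head)
  next
    fix i assume "i \<in> {k..<m}"
    then have "i < m" by simp
    then show "sym_mat r (upper_block r (A i))" "sym_mat (n - r) (lower_block n r (A i))"
      "A i = four_block_mat (upper_block r (A i)) (side_block n r (A i))
        (transpose_mat (side_block n r (A i))) (lower_block n r (A i))"
      by (fact symF symH full)+
    show "side_block n r (A i) \<in> carrier_mat r (n - r)" by (simp add: side_block_def)
  qed (use assms in auto)
qed

lemma normal_shape_tail:
  assumes "normal_shape n m r k F G H (A, B)"
  shows "i < k \<Longrightarrow> tail_zero n r (A i)"
    and "i \<in> {k..<m} \<Longrightarrow> a < r \<Longrightarrow> b < n - r \<Longrightarrow> A i $$ (a, r + b) = G i $$ (a, b)"
    and "i \<in> {k..<m} \<Longrightarrow> a < n - r \<Longrightarrow> b < n - r \<Longrightarrow> A i $$ (r + a, r + b) = H i $$ (a, b)"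
proof -
  have rn: "r \<le> n" using assms by simp
  {
    assume "i < k"
    then have "sym_mat r (F i)"
      and Ai: "A i = four_block_mat (F i) (0\<^sub>m r (n - r)) (0\<^sub>m (n - r) r) (0\<^sub>m (n - r) (n - r))"
      using assms by auto
    then have Fi: "dim_row (F i) = r" "dim_col (F i) = r" by (auto simp: sym_mat_def)
    show "tail_zero n r (A i)"
      unfolding Ai
    proof (intro allI impI ballI)
      fix a b assume "a < n" "b \<in> {r..<n}"
      then show "four_block_mat (F i) (0\<^sub>m r (n - r)) (0\<^sub>m (n - r) r) (0\<^sub>m (n - r) (n - r)) $$ (a, b) = 0"
        using Fi rn by (subst index_mat_four_block) auto
    qed
  next
    assume i: "i \<in> {k..<m}"
    then have shape: "sym_mat r (F i)" "G i \<in> carrier_mat r (n - r)" "sym_mat (n - r) (H i)"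
      and Ai: "A i = four_block_mat (F i) (G i) (transpose_mat (G i)) (H i)"
      using assms by auto
    then have dims: "dim_row (F i) = r" "dim_col (F i) = r" "dim_row (H i) = n - r" "dim_col (H i) = n - r"
      by (auto simp: sym_mat_def)
    {
      assume "a < r" "b < n - r"
      then show "A i $$ (a, r + b) = G i $$ (a, b)"
        unfolding Ai using dims by (subst index_mat_four_block) auto
    next
      assume "a < n - r" "b < n - r"
      then show "A i $$ (r + a, r + b) = H i $$ (a, b)"
        unfolding Ai using dims by (subst index_mat_four_block) auto
    }
  }
qed

section \<open>Each normal form decides rigidity, and rigidity decides which form exists\<close>

text \<open>With \<open>f\<close> written as a sum of rank-one matrices, the pairing is a sum of
  values of a positive definite form, so it vanishes only if all the vectors do.\<close>

lemma pd_frob_zero: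
  assumes U: "pd_mat d U" and S: "psd_on {..<d} f" and zero: "frob {..<d} (($$) U) f = 0"
    and ij: "i < d" "j < d"
  shows "f (i, j) = 0"
proof -
  obtain w where w: "\<And>i j. i \<in> {..<d} \<Longrightarrow> j \<in> {..<d} \<Longrightarrow> f (i, j) = (\<Sum>a\<in>{..<d}. w a i * w a j)"
    using psd_on_decomp[OF finite_lessThan S] by blast
  have Uc: "U \<in> carrier_mat d d" using U by (simp add: pd_mat_def sym_mat_def)
  have pos: "0 < quad_form {..<d} (($$) U) v" if "i < d" "v i \<noteq> 0" for v i
  proof -
    have "vec d v \<noteq> 0\<^sub>v d" using that by (metis index_vec index_zero_vec(1))
    then have "0 < vec d v \<bullet> (U *\<^sub>v vec d v)" using U by (simp add: pd_mat_def)
    then show ?thesis by (simp add: scalar_prod_mult_mat_vec[OF Uc] quad_form_vec)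
  qed
  have nonneg: "0 \<le> quad_form {..<d} (($$) U) v" for v
  proof (cases "\<exists>i<d. v i \<noteq> 0")
    case True
    then show ?thesis using pos by (auto intro: less_imp_le)
  next
    case False
    then show ?thesis by (simp add: quad_form_def)
  qed
  have "(\<Sum>a\<in>{..<d}. quad_form {..<d} (($$) U) (w a)) = 0"
    using zero frob_decomp[of "{..<d}" f w "{..<d}" "($$) U"] w by simp
  then have "\<forall>a\<in>{..<d}. quad_form {..<d} (($$) U) (w a) = 0"
    using nonneg by (subst (asm) sum_nonneg_eq_0_iff) auto
  then have "w a i = 0" if "a < d" for a
    using pos[OF ij(1), of "w a"] that by fastforce
  then show ?thesis using w[of i j] ij by simp
qed

text \<open>The first \<open>k\<close> matrices contribute nothing to the last columns. If the lower
  block of \<open>V\<close> is psd, orthogonality to \<open>U\<close> makes it 0; independence of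
  the \<open>H i\<close> then kills the coefficients from \<open>k\<close> on, and with them the
  off-diagonal block.\<close>

lemma good_normal_form_rigid:
  assumes "good_normal_form n m r (A, B)" and sym: "\<And>i. i < m \<Longrightarrow> sym_mat n (A i)"
  shows "rigid n r (mat_span n m A)"
proof -
  obtain k F G H U where "k \<le> m" and shape: "normal_shape n m r k F G H (A, B)"
    and indep: "mat_lin_indep (n - r) (n - r) {k..<m} H"
    and U: "pd_mat (n - r) U" and orth: "\<And>i. i \<in> {k..<m} \<Longrightarrow> mat_inner (H i) U = 0"
    using assms(1) unfolding good_normal_form_def by blast
  note tail = normal_shape_tail[OF shape]
  show ?thesis
    unfolding rigid_def mat_span_def
  proof (intro ballI impI allI)
    fix V i j
    assume "V \<in> range (\<lambda>x. mat_lincomb n n {..<m} x A)" and psd: "psd_on {r..<n} (($$) V)"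
      and ij: "i < n" "j \<in> {r..<n}"
    then obtain x where V: "V = mat_lincomb n n {..<m} x A" by blast
    have rn: "r \<le> n" using shape by simp
    have split: "(\<Sum>q<m. x q * A q $$ (a, b)) = (\<Sum>q\<in>{k..<m}. x q * A q $$ (a, b))"
      if "a < n" "b \<in> {r..<n}" for a b
      using tail(1) that by (intro sum.mono_neutral_right) (auto simp: not_le)
    let ?W = "mat_lincomb (n - r) (n - r) {k..<m} x H"
    have V_lower: "V $$ (r + a, r + b) = ?W $$ (a, b)" if "a < n - r" "b < n - r" for a b
    proof -
      have "V $$ (r + a, r + b) = (\<Sum>q\<in>{k..<m}. x q * A q $$ (r + a, r + b))"
        unfolding V using that split[of "r + a" "r + b"] by simp
      also have "\<dots> = (\<Sum>q\<in>{k..<m}. x q * H q $$ (a, b))"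
        using that tail(3) by (intro sum.cong refl) simp
      finally show ?thesis using that by simp
    qed
    have Hc: "H q \<in> carrier_mat (n - r) (n - r)" if "q \<in> {k..<m}" for q
      using shape that by (auto simp: sym_mat_def)
    have "psd_on {..<n - r} (\<lambda>(a, b). V $$ (r + a, r + b)) \<longleftrightarrow> psd_on {..<n - r} (($$) ?W)"
      using V_lower by (intro psd_on_cong) simp
    then have W_psd: "psd_on {..<n - r} (($$) ?W)" using psd unfolding psd_on_shift by blast
    have "frob {..<n - r} (($$) (H q)) (($$) U) = 0" if "q \<in> {k..<m}" for q
      using orth[OF that] mat_inner_eq_frob[OF Hc[OF that], of U] U by (simp add: pd_mat_def)
    then have "frob {..<n - r} (($$) ?W) (($$) U) = 0"
      unfolding frob_mat_lincomb by (intro sum.neutral) simp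
    then have "frob {..<n - r} (($$) U) (($$) ?W) = 0" by (subst frob_commute)
    then have "?W = 0\<^sub>m (n - r) (n - r)"
      using pd_frob_zero[OF U W_psd] by (intro eq_matI) (auto simp del: mat_lincomb_index)
    then have x0: "x q = 0" if "q \<in> {k..<m}" for q
      using indep that unfolding mat_lin_indep_def by blast
    show "V $$ (i, j) = 0"
      unfolding V using ij split[OF ij] x0 by simp
  qed
qed

text \<open>The last matrix itself violates rigidity: its lower block is psd, and a vanishing pair
  \<open>(G, H)\<close> would contradict independence.\<close>

lemma bad_normal_form_not_rigid:
  assumes "bad_normal_form n m r (A, B)" and sym: "\<And>i. i < m \<Longrightarrow> sym_mat n (A i)"
  shows "\<not> rigid n r (mat_span n m A)"
proof
  assume rigid: "rigid n r (mat_span n m A)"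
  obtain k F G H where km: "k < m" and shape: "normal_shape n m r k F G H (A, B)"
    and indep: "mat_lin_indep n (n - r) {k..<m} (\<lambda>i. G i @\<^sub>r H i)"
    and psd: "psd_mat (n - r) (H (m - 1))"
    using assms(1) unfolding bad_normal_form_def by blast
  note tail = normal_shape_tail[OF shape]
  let ?q = "m - 1"
  have q: "?q \<in> {k..<m}" "?q < m" using km by auto
  have rn: "r \<le> n" using shape by simp
  have "psd_on {..<n - r} (\<lambda>(a, b). A ?q $$ (r + a, r + b)) \<longleftrightarrow> psd_on {..<n - r} (($$) (H ?q))"
    using tail(3)[OF q(1)] by (intro psd_on_cong) simp
  then have "psd_on {r..<n} (($$) (A ?q))" using psd unfolding psd_on_shift psd_mat_iff by blast
  moreover have "A ?q \<in> mat_span n m A"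
    using q(2) sym[OF q(2)] by (intro mat_span_member) (auto simp: sym_mat_def)
  ultimately have zero: "tail_zero n r (A ?q)" using rigid unfolding rigid_def by blast
  have G0: "G ?q $$ (a, b) = 0" if "a < r" "b < n - r" for a b
    using tail(2)[OF q(1) that] zero that rn by auto
  have H0: "H ?q $$ (a, b) = 0" if "a < n - r" "b < n - r" for a b
    using tail(3)[OF q(1) that] zero that by auto
  have "G ?q \<in> carrier_mat r (n - r)" "H ?q \<in> carrier_mat (n - r) (n - r)"
    using shape q(1) by (auto simp: sym_mat_def)
  then have GH: "(G ?q @\<^sub>r H ?q) $$ (a, b) = 0" if "a < n" "b < n - r" for a b
    using that G0 H0 unfolding append_rows_def by (subst index_mat_four_block) auto
  let ?c = "\<lambda>i. if i = ?q then 1 else (0 :: real)"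
  have "mat_lincomb n (n - r) {k..<m} ?c (\<lambda>i. G i @\<^sub>r H i) = 0\<^sub>m n (n - r)"
  proof (rule eq_matI)
    fix a b assume "a < dim_row (0\<^sub>m n (n - r) :: real mat)" "b < dim_col (0\<^sub>m n (n - r) :: real mat)"
    then have ab: "a < n" "b < n - r" by auto
    have "(\<Sum>i\<in>{k..<m}. ?c i * (G i @\<^sub>r H i) $$ (a, b)) = 0"
      using GH[OF ab] by (intro sum.neutral) auto
    then show "mat_lincomb n (n - r) {k..<m} ?c (\<lambda>i. G i @\<^sub>r H i) $$ (a, b) = 0\<^sub>m n (n - r) $$ (a, b)"
      using ab by simp
  qed auto
  then have "?c ?q = 0" using indep q(1) unfolding mat_lin_indep_def by blast
  then show False by simp
qed

text \<open>Because \<open>?Z\<close> lies in the common span, every slack of the new system is a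
  slack of the homogeneous one, and \<open>x = 0\<close> shows that \<open>?Z\<close> is among
  them.\<close>

lemma max_rank_slack_reformulated:
  assumes max: "max_rank_slack n m (A, 0\<^sub>m n n) (block_id n r)" and "r \<le> n"
    and span: "mat_span n m A' = mat_span n m A"
  shows "max_rank_slack n m (A', block_id n r) (block_id n r)"
proof -
  let ?Z = "block_id n r"
  have Z: "psd_mat n ?Z" "?Z \<in> mat_span n m A"
    and max_rank: "\<And>S. psd_mat n S \<Longrightarrow> S \<in> mat_span n m A \<Longrightarrow> vec_space.rank n S \<le> vec_space.rank n ?Z"
    using max unfolding max_rank_slack_def slack_homogeneous_iff by auto
  have Zc: "?Z \<in> carrier_mat n n" using \<open>r \<le> n\<close> by (rule block_id_carrier)
  have "?Z - mat_lincomb n n {..<m} x A' \<in> mat_span n m A" for x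
  proof -
    have "?Z + (- 1) \<cdot>\<^sub>m mat_lincomb n n {..<m} x A' \<in> mat_span n m A'"
      using Z(2) span by (intro mat_span_add_scale) (auto simp: mat_span_def)
    moreover have "?Z + (- 1) \<cdot>\<^sub>m mat_lincomb n n {..<m} x A' = ?Z - mat_lincomb n n {..<m} x A'"
      using Zc by (intro eq_matI) auto
    ultimately show ?thesis using span by simp
  qed
  moreover have "?Z = ?Z - mat_lincomb n n {..<m} (\<lambda>_. 0) A'"
    using Zc by (intro eq_matI) auto
  ultimately show ?thesis
    unfolding max_rank_slack_def slack.simps using Z(1) max_rank by blast
qed

lemma shift_to_block_id:
  assumes "block_id n r \<in> mat_span n m A"
  shows "elem_step n m r (A, 0\<^sub>m n n) (A, block_id n r)"
proof -
  obtain z where "block_id n r = mat_lincomb n n {..<m} z A"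
    using assms unfolding mat_span_def by blast
  then have "block_id n r = 0\<^sub>m n n + mat_lincomb n n {..<m} z A" by simp
  then show ?thesis using elem_step.shift[of n m r A "0\<^sub>m n n" z] by simp
qed

lemma rigid_imp_good:
  assumes A: "\<forall>i<m. sym_mat n (A i)" and "r \<le> n"
    and max: "max_rank_slack n m (A, 0\<^sub>m n n) (block_id n r)"
    and rigid: "rigid n r (mat_span n m A)"
  shows "has_good_reformulation n m r (A, 0\<^sub>m n n)"
proof -
  let ?Z = "block_id n r"
  have Z: "?Z \<in> mat_span n m A"
    using max unfolding max_rank_slack_def slack_homogeneous_iff by blast
  obtain A' k U \<delta> where steps: "(elem_step n m r)\<^sup>*\<^sup>* (A, ?Z) (A', ?Z)"
    and k: "k \<le> m" and sym: "\<forall>i<m. sym_mat n (A' i)"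
    and span: "mat_span n m A' = mat_span n m A" and zero: "\<forall>i<k. tail_zero n r (A' i)"
    and indep: "\<forall>c. (\<forall>i\<in>{r..<n}. \<forall>j\<in>{r..<n}. (\<Sum>q\<in>{k..<m}. c q * A' q $$ (i, j)) = 0) \<longrightarrow> (\<forall>q\<in>{k..<m}. c q = 0)"
    and \<delta>: "0 < \<delta>" and U: "\<forall>i\<in>{r..<n}. \<forall>j\<in>{r..<n}. U (i, j) = U (j, i)"
    and U_ge: "\<forall>v. \<delta> * (\<Sum>i\<in>{r..<n}. (v i)\<^sup>2) \<le> quad_form {r..<n} U v"
    and U_orth: "\<forall>q\<in>{k..<m}. frob {r..<n} (($$) (A' q)) U = 0"
    using rigid_basis[of m n A r ?Z, OF A \<open>r \<le> n\<close> rigid]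
    by (elim exE conjE) (rule that; assumption)
  have "elementary_reformulation n m r (A, 0\<^sub>m n n) (A', ?Z)"
    unfolding elementary_reformulation_def
    using shift_to_block_id[OF Z] steps by (rule converse_rtranclp_into_rtranclp)
  moreover have "good_normal_form n m r (A', ?Z)"
    unfolding good_normal_form_def
  proof (intro exI conjI)
    show "k \<le> m" by fact
    show "normal_shape n m r k (\<lambda>i. upper_block r (A' i)) (\<lambda>i. side_block n r (A' i))
        (\<lambda>i. lower_block n r (A' i)) (A', ?Z)"
      using \<open>r \<le> n\<close> k sym zero by (intro normal_shape_blocks) auto
    show "max_rank_slack n m (A', ?Z) ?Z"
      using max \<open>r \<le> n\<close> span by (rule max_rank_slack_reformulated)
    show "mat_lin_indep (n - r) (n - r) {k..<m} (\<lambda>i. lower_block n r (A' i))"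
      unfolding mat_lin_indep_def
    proof (intro allI impI)
      fix c assume c: "mat_lincomb (n - r) (n - r) {k..<m} c (\<lambda>i. lower_block n r (A' i)) = 0\<^sub>m (n - r) (n - r)"
      have "(\<Sum>q\<in>{k..<m}. c q * A' q $$ (i, j)) = 0" if ij: "i \<in> {r..<n}" "j \<in> {r..<n}" for i j
      proof -
        have *: "i - r < n - r" "j - r < n - r" using ij by auto
        have "(\<Sum>q\<in>{k..<m}. c q * A' q $$ (i, j)) =
            mat_lincomb (n - r) (n - r) {k..<m} c (\<lambda>i. lower_block n r (A' i)) $$ (i - r, j - r)"
          using ij * by (simp add: lower_block_def)
        then show ?thesis unfolding c using * by simp
      qed
      then show "\<forall>i\<in>{k..<m}. c i = 0" using indep by blast
    qed
    let ?U = "Matrix.mat (n - r) (n - r) (\<lambda>(a, b). U (r + a, r + b))"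
    have U_sym: "sym_mat (n - r) ?U" unfolding sym_mat_iff using U by auto
    show "pd_mat (n - r) ?U"
      unfolding pd_mat_def
    proof (intro conjI ballI impI U_sym)
      fix v :: "real Matrix.vec" assume v: "v \<in> carrier_vec (n - r)" "v \<noteq> 0\<^sub>v (n - r)"
      define w where "w = (\<lambda>i. v $ (i - r))"
      have "\<exists>a<n - r. v $ a \<noteq> 0"
      proof (rule ccontr)
        assume "\<not> ?thesis"
        then have "v = 0\<^sub>v (n - r)" using v(1) by (intro eq_vecI) auto
        then show False using v(2) by simp
      qed
      then obtain a where a: "a < n - r" "v $ a \<noteq> 0" by blast
      then have "0 < (\<Sum>i\<in>{r..<n}. (w i)\<^sup>2)"
        by (intro sum_pos2[of _ "r + a"]) (auto simp: w_def)
      then have "0 < \<delta> * (\<Sum>i\<in>{r..<n}. (w i)\<^sup>2)" using \<delta> by simp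
      also have "\<dots> \<le> quad_form {r..<n} U w" using U_ge by blast
      also have "\<dots> = quad_form {..<n - r} (($$) ?U) (($) v)"
        unfolding quad_form_shift by (intro quad_form_cong) (auto simp: w_def)
      also have "\<dots> = v \<bullet> (?U *\<^sub>v v)"
        by (rule scalar_prod_mult_mat_vec[symmetric]) (use v(1) in auto)
      finally show "0 < v \<bullet> (?U *\<^sub>v v)" .
    qed
    show "\<forall>i\<in>{k..<m}. mat_inner (lower_block n r (A' i)) ?U = 0"
    proof
      fix i assume i: "i \<in> {k..<m}"
      have "mat_inner (lower_block n r (A' i)) ?U = frob {..<n - r} (($$) (lower_block n r (A' i))) (($$) ?U)"
        using U_sym by (intro mat_inner_eq_frob) (simp_all add: lower_block_def)
      also have "\<dots> = frob {r..<n} (($$) (A' i)) U"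
        unfolding frob_shift by (intro frob_cong) (auto simp: lower_block_def)
      finally show "mat_inner (lower_block n r (A' i)) ?U = 0" using U_orth i by simp
    qed
  qed
  ultimately show ?thesis unfolding has_good_reformulation_def by blast
qed

lemma not_rigid_imp_bad:
  assumes A: "\<forall>i<m. sym_mat n (A i)" and "r \<le> n"
    and max: "max_rank_slack n m (A, 0\<^sub>m n n) (block_id n r)"
    and not_rigid: "\<not> rigid n r (mat_span n m A)"
  shows "has_bad_reformulation n m r (A, 0\<^sub>m n n)"
proof -
  let ?Z = "block_id n r"
  have Z: "?Z \<in> mat_span n m A"
    using max unfolding max_rank_slack_def slack_homogeneous_iff by blast
  obtain x where V_psd: "psd_on {r..<n} (($$) (mat_lincomb n n {..<m} x A))"
    and V_nz: "\<not> tail_zero n r (mat_lincomb n n {..<m} x A)"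
    using not_rigid unfolding rigid_def mat_span_def by blast
  define V where "V = mat_lincomb n n {..<m} x A"
  \<comment> \<open>The operation \<open>combine\<close> requires a nonzero coefficient; the zero
    combination has zero tail.\<close>
  have "\<exists>i<m. x i \<noteq> 0"
  proof (rule ccontr)
    assume "\<not> ?thesis"
    then have "tail_zero n r (mat_lincomb n n {..<m} x A)" by simp
    then show False using V_nz by blast
  qed
  then obtain i where i: "i < m" "x i \<noteq> 0" by blast
  let ?q = "m - 1"
  have q: "?q < m" using i by simp
  define A1 where "A1 = A(i := V)"
  define A2 where "A2 = A1(i := A1 ?q, ?q := A1 i)"
  have s1: "elem_step n m r (A, ?Z) (A1, ?Z)"
    unfolding A1_def V_def using i by (rule elem_step.combine)
  have s2: "(elem_step n m r)\<^sup>*\<^sup>* (A1, ?Z) (A2, ?Z)"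
  proof (cases "i = ?q")
    case True
    then show ?thesis by (simp add: A2_def)
  next
    case False
    then show ?thesis unfolding A2_def using i(1) q by (intro r_into_rtranclp elem_step.swap)
  qed
  have sym1: "\<forall>j<m. sym_mat n (A1 j)"
    unfolding A1_def V_def using A elem_step_combine_sym[of m n A] by blast
  have sym2: "sym_mat n (A2 j)" if "j < m" for j using sym1 i(1) q that by (simp add: A2_def)
  have span2: "mat_span n m A2 = mat_span n m A"
    unfolding A2_def mat_span_swap[OF i(1) q] A1_def V_def by (rule mat_span_combine[of i m x, OF i])
  \<comment> \<open>The bound \<open>m - 1\<close> protects \<open>V\<close>, which sits in the last
    position, while the other matrices are reduced.\<close>
  obtain A' k where s3: "(elem_step n m r)\<^sup>*\<^sup>* (A2, ?Z) (A', ?Z)" and k: "k \<le> ?q"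
    and last: "\<forall>i\<in>{?q..<m}. A' i = A2 i" and sym: "\<forall>i<m. sym_mat n (A' i)"
    and span: "mat_span n m A' = mat_span n m A2" and zero: "\<forall>i<k. tail_zero n r (A' i)"
    and indep: "\<forall>c. tail_zero n r (mat_lincomb n n {k..<m} c A') \<longrightarrow> (\<forall>i\<in>{k..<?q}. c i = 0)"
    using reformulation_basis[of m n A2 ?q r ?Z "tail_zero n r"] sym2 by (metis (no_types, lifting) diff_le_self)
  have A'q: "A' ?q = V" using last q by (simp add: A2_def A1_def)
  have "(elem_step n m r)\<^sup>*\<^sup>* (A, 0\<^sub>m n n) (A', ?Z)"
    using shift_to_block_id[OF Z] s1 s2 s3
    by (meson converse_rtranclp_into_rtranclp rtranclp_trans)
  then have "elementary_reformulation n m r (A, 0\<^sub>m n n) (A', ?Z)"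
    unfolding elementary_reformulation_def .
  moreover have "bad_normal_form n m r (A', ?Z)"
    unfolding bad_normal_form_def
  proof (intro exI conjI)
    show "k < m" using k q by simp
    show "normal_shape n m r k (\<lambda>i. upper_block r (A' i)) (\<lambda>i. side_block n r (A' i))
        (\<lambda>i. lower_block n r (A' i)) (A', ?Z)"
      using \<open>r \<le> n\<close> k sym zero by (intro normal_shape_blocks) auto
    show "max_rank_slack n m (A', ?Z) ?Z"
      using max \<open>r \<le> n\<close> span[unfolded span2] by (rule max_rank_slack_reformulated)
    show "psd_mat (n - r) (lower_block n r (A' ?q))"
      unfolding A'q psd_mat_lower_block V_def by (rule V_psd)
    show "mat_lin_indep n (n - r) {k..<m} (\<lambda>i. side_block n r (A' i) @\<^sub>r lower_block n r (A' i))"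
      unfolding mat_lin_indep_def
    proof (intro allI impI)
      let ?GH = "\<lambda>i. side_block n r (A' i) @\<^sub>r lower_block n r (A' i)"
      fix c assume c: "mat_lincomb n (n - r) {k..<m} c ?GH = 0\<^sub>m n (n - r)"
      have GH: "?GH q $$ (a, b - r) = A' q $$ (a, b)" if "a < n" "b \<in> {r..<n}" for q a b
      proof -
        have *: "b - r < n - r" using that by auto
        show ?thesis
          unfolding append_rows_def using that * \<open>r \<le> n\<close>
          by (subst index_mat_four_block) (auto simp: side_block_def lower_block_def)
      qed
      have tail: "(\<Sum>q\<in>{k..<m}. c q * A' q $$ (a, b)) = 0" if ab: "a < n" "b \<in> {r..<n}" for a b
      proof -
        have *: "b - r < n - r" using ab by auto
        have "(\<Sum>q\<in>{k..<m}. c q * A' q $$ (a, b)) = mat_lincomb n (n - r) {k..<m} c ?GH $$ (a, b - r)"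
          using ab * by (simp add: GH)
        then show ?thesis unfolding c using ab * by simp
      qed
      then have "tail_zero n r (mat_lincomb n n {k..<m} c A')" by simp
      then have c0: "\<forall>i\<in>{k..<?q}. c i = 0" using indep by blast
      \<comment> \<open>The other coefficients vanish by maximality of \<open>k\<close>, so a
        nonzero last one would make the tail of \<open>V\<close> vanish.\<close>
      have "c ?q = 0"
      proof (rule ccontr)
        assume nz: "c ?q \<noteq> 0"
        have "V $$ (a, b) = 0" if ab: "a < n" "b \<in> {r..<n}" for a b
        proof -
          have "(\<Sum>p\<in>{k..<m}. c p * A' p $$ (a, b)) = (\<Sum>p\<in>{?q}. c p * A' p $$ (a, b))"
            using c0 k q by (intro sum.mono_neutral_right) auto
          then show ?thesis using tail[OF ab] nz A'q by simp
        qed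
        then show False using V_nz unfolding V_def by blast
      qed
      then show "\<forall>i\<in>{k..<m}. c i = 0" using c0 by (metis Suc_pred' atLeastLessThan_iff less_Suc_eq less_zeroE neq0_conv)
    qed
  qed
  ultimately show ?thesis unfolding has_bad_reformulation_def by blast
qed

theorem corollary2:
  fixes A :: "nat \<Rightarrow> real mat" and n m r :: nat
  assumes "\<And>i. i < m \<Longrightarrow> sym_mat n (A i)"
    and "r \<le> n"
    and "max_rank_slack n m (A, 0\<^sub>m n n) (block_id n r)"
  shows "(\<not> closedin (Euclidean_space m) (adjoint_map m A ` {Y. psd_mat n Y})
            \<longleftrightarrow> has_bad_reformulation n m r (A, 0\<^sub>m n n)) \<and>
         (closedin (Euclidean_space m) (adjoint_map m A ` {Y. psd_mat n Y})
            \<longleftrightarrow> has_good_reformulation n m r (A, 0\<^sub>m n n))"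
proof -
  let ?R = "rigid n r (mat_span n m A)"
  have A: "\<forall>i<m. sym_mat n (A i)" using assms(1) by blast
  have Z: "block_id n r \<in> mat_span n m A"
    using assms(3) unfolding max_rank_slack_def slack_homogeneous_iff by blast
  have "adjoint_map m A ` {Y. psd_mat n Y} \<subseteq> topspace (Euclidean_space m)"
    by (auto simp: topspace_Euclidean_space adjoint_map_def)
  \<comment> \<open>The image consists of sequences vanishing from \<open>m\<close> on, for which
    closedness in \<open>Euclidean_space m\<close> and in the function space agree.\<close>
  then have "closedin (Euclidean_space m) (adjoint_map m A ` {Y. psd_mat n Y}) \<longleftrightarrow>
      closed (adjoint_map m A ` {Y. psd_mat n Y})"
    by (simp add: closedin_Euclidean_space_iff)
  also have "\<dots> \<longleftrightarrow> ?R"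
    using closed_imp_rigid[of m n A r] rigid_imp_closed[of m n A r] assms Z by blast
  finally have closed: "closedin (Euclidean_space m) (adjoint_map m A ` {Y. psd_mat n Y}) \<longleftrightarrow> ?R" .
  have good: "?R" if reform: "has_good_reformulation n m r (A, 0\<^sub>m n n)"
  proof -
    obtain A' B' where P: "elementary_reformulation n m r (A, 0\<^sub>m n n) (A', B')" "good_normal_form n m r (A', B')"
      using reform unfolding has_good_reformulation_def by (metis surj_pair)
    have "(\<forall>i<m. sym_mat n (A' i)) \<and> (rigid n r (mat_span n m A') \<longleftrightarrow> ?R)"
      using elementary_reformulation_rigid[OF P(1) assms(2)] A by simp
    then show ?thesis using good_normal_form_rigid[OF P(2)] by blast
  qed
  have bad: "\<not> ?R" if reform: "has_bad_reformulation n m r (A, 0\<^sub>m n n)"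
  proof -
    obtain A' B' where P: "elementary_reformulation n m r (A, 0\<^sub>m n n) (A', B')" "bad_normal_form n m r (A', B')"
      using reform unfolding has_bad_reformulation_def by (metis surj_pair)
    have "(\<forall>i<m. sym_mat n (A' i)) \<and> (rigid n r (mat_span n m A') \<longleftrightarrow> ?R)"
      using elementary_reformulation_rigid[OF P(1) assms(2)] A by simp
    then show ?thesis using bad_normal_form_not_rigid[OF P(2)] by blast
  qed
  show ?thesis
    unfolding closed using good bad rigid_imp_good[OF A assms(2,3)] not_rigid_imp_bad[OF A assms(2,3)] by blast
qed

end
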